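(* Let $A$ be a non-trivial abelian group and let $\mathsf{Ab}$ be the category of abelian groups. In $\mathsf{Gpd}(\mathsf{Ab})$, let $D(A)$ be the discrete groupoid on $A$, and let $\mathbb{Y}$ be the internal groupoid (an internal equivalence relation) with object of objects $A\times A$, object of arrows $A\times(A\times A)$, domain $1_A\times p_1$ and codomain $1_A\times p_2$, where $p_1,p_2\colon A\times A\to A$ are the projections. Let $F\colon D(A)\to\mathbb{Y}$ be the functor given by $a\mapsto(a,0)$ on objects and $a\mapsto(a,(0,0))$ on arrows, and let $G\colon D(A)\to\mathbb{Y}$ be the functor given by $a\mapsto(0,a)$ on objects and $a\mapsto(0,(a,a))$ on arrows. Then $F$ is a final functor, but the pullback of $F$ along $G$ is not inverted by $\pi_0$. Consequently, for $\mathcal{C}=\mathsf{Ab}$, final functors are not stably in the class $\mathcal{E}$ of functors inverted by $\pi_0$, and the pair $(\mathcal{E}',\mathcal{M}^* )$ associated with the reflection $\pi_0\colon\mathsf{Gpd}(\mathcal{C})\to\mathcal{C}$ is not a factorization system on $\mathsf{Gpd}(\mathcal{C})$; thus, in general, there is no monotone-light factorization system associated with this reflection.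
   Context: Let $\mathcal{C}$ be a (Barr-)exact category and $\mathsf{Gpd}(\mathcal{C})$ its category of internal groupoids. For an internal groupoid $\mathbb{X}$ with domain and codomain morphisms $d,c\colon X_1\to X_0$, $\pi_0(\mathbb{X})$ is the codomain of the coequalizer of $(d,c)$; $\pi_0$ is left adjoint to the discrete groupoid functor $D\colon\mathcal{C}\to\mathsf{Gpd}(\mathcal{C})$, with unit $\eta\colon 1\to D\pi_0$. $\mathcal{E}$ is the class of morphisms of $\mathsf{Gpd}(\mathcal{C})$ sent to isomorphisms by $\pi_0$. $\mathcal{M}$ is the class of morphisms $m\colon\mathbb{A}\to\mathbb{B}$ for which the naturality square $\eta_{\mathbb{B}}\, m = D\pi_0(m)\,\eta_{\mathbb{A}}$ is a pullback. $\mathcal{E}'$ is the class of morphisms stably in $\mathcal{E}$, i.e. all of whose pullbacks (along arbitrary morphisms) are in $\mathcal{E}$. $\mathcal{M}^*$ is the class of morphisms $f\colon\mathbb{A}\to\mathbb{B}$ for which there is an effective descent morphism $p\colon\mathbb{E}\to\mathbb{B}$ (i.e. the pullback functor $p^*$ between the slice categories over $\mathbb{B}$ and $\mathbb{E}$ is monadic) such that the pullback of $f$ along $p$ is in $\mathcal{M}$. If $(\mathcal{E}',\mathcal{M}^* )$ is a factorization system (in the usual orthogonal sense), it is called the monotone-light factorization system associated with the reflection. An internal functor $(f_0,f_1)\colon\mathbb{X}\to\mathbb{Y}$ is a discrete fibration if the square $c f_1=f_0 c$ is a pullback. Final functors are the morphisms of $\mathsf{Gpd}(\mathcal{C})$ in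 the class (left) orthogonal to the internal discrete fibrations: $e$ is final if for every commutative square $ge=mf$ with $m$ a discrete fibration there is a unique $\delta$ with $\delta e=f$ and $m\delta=g$. *)

theory Defs
  imports "HOL-Algebra.Weak_Morphisms" "HOL-Library.Infinite_Typeclass"
begin

record ('o, 'm) cat =
  Obj :: "'o set"
  Arr :: "'m set"
  Dom :: "'m \<Rightarrow> 'o"
  Cod :: "'m \<Rightarrow> 'o"
  Ide :: "'o \<Rightarrow> 'm"
  Comp :: "'m \<Rightarrow> 'm \<Rightarrow> 'm" (infixl "\<cdot>\<index>" 70)

definition Hom :: "('o, 'm) cat \<Rightarrow> 'o \<Rightarrow> 'o \<Rightarrow> 'm set" where
  "Hom C a b = {f \<in> Arr C. Dom C f = a \<and> Cod C f = b}"

definition category :: "('o, 'm) cat \<Rightarrow> bool" where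
  "category C \<longleftrightarrow>
     (\<forall>f \<in> Arr C. Dom C f \<in> Obj C \<and> Cod C f \<in> Obj C) \<and>
     (\<forall>a \<in> Obj C. Ide C a \<in> Hom C a a) \<and>
     (\<forall>f \<in> Arr C. \<forall>g \<in> Arr C. Cod C f = Dom C g \<longrightarrow>
        g \<cdot>\<^bsub>C\<^esub> f \<in> Hom C (Dom C f) (Cod C g)) \<and>
     (\<forall>f \<in> Arr C. f \<cdot>\<^bsub>C\<^esub> Ide C (Dom C f) = f \<and> Ide C (Cod C f) \<cdot>\<^bsub>C\<^esub> f = f) \<and>
     (\<forall>f \<in> Arr C. \<forall>g \<in> Arr C. \<forall>h \<in> Arr C. Cod C f = Dom C g \<longrightarrow> Cod C g = Dom C h \<longrightarrow>
        h \<cdot>\<^bsub>C\<^esub> (g \<cdot>\<^bsub>C\<^esub> f) = (h \<cdot>\<^bsub>C\<^esub> g) \<cdot>\<^bsub>C\<^esub> f)"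

definition is_iso :: "('o, 'm) cat \<Rightarrow> 'm \<Rightarrow> bool" where
  "is_iso C f \<longleftrightarrow> f \<in> Arr C \<and>
     (\<exists>g \<in> Hom C (Cod C f) (Dom C f). g \<cdot>\<^bsub>C\<^esub> f = Ide C (Dom C f) \<and> f \<cdot>\<^bsub>C\<^esub> g = Ide C (Cod C f))"

definition is_terminal :: "('o, 'm) cat \<Rightarrow> 'o \<Rightarrow> bool" where
  "is_terminal C t \<longleftrightarrow> t \<in> Obj C \<and> (\<forall>a \<in> Obj C. \<exists>!f. f \<in> Hom C a t)"

text \<open>In \<open>is_pullback C f g p q\<close> the square is \<open>f \<cdot> p = g \<cdot> q\<close>, so that \<open>p\<close> is a pullback of
  \<open>g\<close> along \<open>f\<close> and \<open>q\<close> is a pullback of \<open>f\<close> along \<open>g\<close>.\<close>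

definition is_pullback :: "('o, 'm) cat \<Rightarrow> 'm \<Rightarrow> 'm \<Rightarrow> 'm \<Rightarrow> 'm \<Rightarrow> bool" where
  "is_pullback C f g p q \<longleftrightarrow>
     f \<in> Arr C \<and> g \<in> Arr C \<and> Cod C f = Cod C g \<and>
     p \<in> Arr C \<and> q \<in> Arr C \<and> Dom C p = Dom C q \<and> Cod C p = Dom C f \<and> Cod C q = Dom C g \<and>
     f \<cdot>\<^bsub>C\<^esub> p = g \<cdot>\<^bsub>C\<^esub> q \<and>
     (\<forall>u \<in> Arr C. \<forall>v \<in> Arr C.
        Dom C u = Dom C v \<and> Cod C u = Dom C f \<and> Cod C v = Dom C g \<and> f \<cdot>\<^bsub>C\<^esub> u = g \<cdot>\<^bsub>C\<^esub> v \<longrightarrow>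
        (\<exists>!w. w \<in> Hom C (Dom C u) (Dom C p) \<and> p \<cdot>\<^bsub>C\<^esub> w = u \<and> q \<cdot>\<^bsub>C\<^esub> w = v))"

text \<open>Chosen pullback projections, and the arrow \<open>\<langle>u, v\<rangle>\<close> into the chosen pullback of \<open>f\<close> and \<open>g\<close>.\<close>

definition pb :: "('o, 'm) cat \<Rightarrow> 'm \<Rightarrow> 'm \<Rightarrow> 'm \<times> 'm" where
  "pb C f g = (SOME pq. is_pullback C f g (fst pq) (snd pq))"

definition pb1 :: "('o, 'm) cat \<Rightarrow> 'm \<Rightarrow> 'm \<Rightarrow> 'm" where
  "pb1 C f g = fst (pb C f g)"

definition pb2 :: "('o, 'm) cat \<Rightarrow> 'm \<Rightarrow> 'm \<Rightarrow> 'm" where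
  "pb2 C f g = snd (pb C f g)"

definition tup :: "('o, 'm) cat \<Rightarrow> 'm \<Rightarrow> 'm \<Rightarrow> 'm \<Rightarrow> 'm \<Rightarrow> 'm" where
  "tup C f g u v = (THE w. w \<in> Hom C (Dom C u) (Dom C (pb1 C f g)) \<and>
     pb1 C f g \<cdot>\<^bsub>C\<^esub> w = u \<and> pb2 C f g \<cdot>\<^bsub>C\<^esub> w = v)"

definition is_coequalizer :: "('o, 'm) cat \<Rightarrow> 'm \<Rightarrow> 'm \<Rightarrow> 'm \<Rightarrow> bool" where
  "is_coequalizer C f g q \<longleftrightarrow>
     f \<in> Arr C \<and> g \<in> Arr C \<and> Dom C f = Dom C g \<and> Cod C f = Cod C g \<and>
     q \<in> Arr C \<and> Dom C q = Cod C f \<and> q \<cdot>\<^bsub>C\<^esub> f = q \<cdot>\<^bsub>C\<^esub> g \<and>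
     (\<forall>h \<in> Arr C. Dom C h = Cod C f \<and> h \<cdot>\<^bsub>C\<^esub> f = h \<cdot>\<^bsub>C\<^esub> g \<longrightarrow>
        (\<exists>!w. w \<in> Hom C (Cod C q) (Cod C h) \<and> w \<cdot>\<^bsub>C\<^esub> q = h))"

definition regular_epi :: "('o, 'm) cat \<Rightarrow> 'm \<Rightarrow> bool" where
  "regular_epi C q \<longleftrightarrow> (\<exists>f g. is_coequalizer C f g q)"

definition equivalence_relation :: "('o, 'm) cat \<Rightarrow> 'm \<Rightarrow> 'm \<Rightarrow> bool" where
  "equivalence_relation C r s \<longleftrightarrow>
     r \<in> Arr C \<and> s \<in> Arr C \<and> Dom C r = Dom C s \<and> Cod C r = Cod C s \<and>
     (\<forall>u \<in> Arr C. \<forall>v \<in> Arr C. Dom C u = Dom C v \<and> Cod C u = Dom C r \<and> Cod C v = Dom C r \<and>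
        r \<cdot>\<^bsub>C\<^esub> u = r \<cdot>\<^bsub>C\<^esub> v \<and> s \<cdot>\<^bsub>C\<^esub> u = s \<cdot>\<^bsub>C\<^esub> v \<longrightarrow> u = v) \<and>
     (\<exists>e \<in> Hom C (Cod C r) (Dom C r). r \<cdot>\<^bsub>C\<^esub> e = Ide C (Cod C r) \<and> s \<cdot>\<^bsub>C\<^esub> e = Ide C (Cod C r)) \<and>
     (\<exists>i \<in> Hom C (Dom C r) (Dom C r). r \<cdot>\<^bsub>C\<^esub> i = s \<and> s \<cdot>\<^bsub>C\<^esub> i = r) \<and>
     (\<exists>t \<in> Hom C (Dom C (pb1 C s r)) (Dom C r).
        r \<cdot>\<^bsub>C\<^esub> t = r \<cdot>\<^bsub>C\<^esub> pb1 C s r \<and> s \<cdot>\<^bsub>C\<^esub> t = s \<cdot>\<^bsub>C\<^esub> pb2 C s r)"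

definition barr_exact :: "('o, 'm) cat \<Rightarrow> bool" where
  "barr_exact C \<longleftrightarrow> category C \<and>
     (\<exists>t. is_terminal C t) \<and>
     (\<forall>f \<in> Arr C. \<forall>g \<in> Arr C. Cod C f = Cod C g \<longrightarrow> (\<exists>p q. is_pullback C f g p q)) \<and>
     (\<forall>f p q. is_pullback C f f p q \<longrightarrow> (\<exists>e. is_coequalizer C p q e)) \<and>
     (\<forall>f g p q. is_pullback C f g p q \<and> regular_epi C f \<longrightarrow> regular_epi C q) \<and>
     (\<forall>r s. equivalence_relation C r s \<longrightarrow> (\<exists>f. is_pullback C f f r s))"

record ('o1, 'm1, 'o2, 'm2) funct =
  FO :: "'o1 \<Rightarrow> 'o2"
  FA :: "'m1 \<Rightarrow> 'm2"

definition is_functor ::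
  "('o1, 'm1) cat \<Rightarrow> ('o2, 'm2) cat \<Rightarrow> ('o1, 'm1, 'o2, 'm2) funct \<Rightarrow> bool" where
  "is_functor C D F \<longleftrightarrow>
     (\<forall>a \<in> Obj C. FO F a \<in> Obj D) \<and>
     (\<forall>f \<in> Arr C. FA F f \<in> Hom D (FO F (Dom C f)) (FO F (Cod C f))) \<and>
     (\<forall>a \<in> Obj C. FA F (Ide C a) = Ide D (FO F a)) \<and>
     (\<forall>f \<in> Arr C. \<forall>g \<in> Arr C. Cod C f = Dom C g \<longrightarrow>
        FA F (g \<cdot>\<^bsub>C\<^esub> f) = FA F g \<cdot>\<^bsub>D\<^esub> FA F f)"

definition id_funct :: "('o, 'm, 'o, 'm) funct" where
  "id_funct = \<lparr>FO = (\<lambda>a. a), FA = (\<lambda>f. f)\<rparr>"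

definition comp_funct ::
  "('o2, 'm2, 'o3, 'm3) funct \<Rightarrow> ('o1, 'm1, 'o2, 'm2) funct \<Rightarrow> ('o1, 'm1, 'o3, 'm3) funct" where
  "comp_funct G F = \<lparr>FO = FO G \<circ> FO F, FA = FA G \<circ> FA F\<rparr>"

definition nat_trans :: "('o1, 'm1) cat \<Rightarrow> ('o2, 'm2) cat \<Rightarrow> ('o1, 'm1, 'o2, 'm2) funct \<Rightarrow>
    ('o1, 'm1, 'o2, 'm2) funct \<Rightarrow> ('o1 \<Rightarrow> 'm2) \<Rightarrow> bool" where
  "nat_trans C D F G \<tau> \<longleftrightarrow>
     (\<forall>a \<in> Obj C. \<tau> a \<in> Hom D (FO F a) (FO G a)) \<and>
     (\<forall>f \<in> Arr C. FA G f \<cdot>\<^bsub>D\<^esub> \<tau> (Dom C f) = \<tau> (Cod C f) \<cdot>\<^bsub>D\<^esub> FA F f)"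

definition nat_iso :: "('o1, 'm1) cat \<Rightarrow> ('o2, 'm2) cat \<Rightarrow> ('o1, 'm1, 'o2, 'm2) funct \<Rightarrow>
    ('o1, 'm1, 'o2, 'm2) funct \<Rightarrow> ('o1 \<Rightarrow> 'm2) \<Rightarrow> bool" where
  "nat_iso C D F G \<tau> \<longleftrightarrow> nat_trans C D F G \<tau> \<and> (\<forall>a \<in> Obj C. is_iso D (\<tau> a))"

definition is_equivalence ::
  "('o1, 'm1) cat \<Rightarrow> ('o2, 'm2) cat \<Rightarrow> ('o1, 'm1, 'o2, 'm2) funct \<Rightarrow> bool" where
  "is_equivalence C D F \<longleftrightarrow> is_functor C D F \<and>
     (\<exists>G \<sigma> \<tau>. is_functor D C G \<and>
        nat_iso C C id_funct (comp_funct G F) \<sigma> \<and> nat_iso D D (comp_funct F G) id_funct \<tau>)"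

definition is_adjunction :: "('o1, 'm1) cat \<Rightarrow> ('o2, 'm2) cat \<Rightarrow> ('o1, 'm1, 'o2, 'm2) funct \<Rightarrow>
    ('o2, 'm2, 'o1, 'm1) funct \<Rightarrow> ('o1 \<Rightarrow> 'm1) \<Rightarrow> ('o2 \<Rightarrow> 'm2) \<Rightarrow> bool" where
  "is_adjunction C D L U \<eta> \<epsilon> \<longleftrightarrow> is_functor C D L \<and> is_functor D C U \<and>
     nat_trans C C id_funct (comp_funct U L) \<eta> \<and> nat_trans D D (comp_funct L U) id_funct \<epsilon> \<and>
     (\<forall>a \<in> Obj C. \<epsilon> (FO L a) \<cdot>\<^bsub>D\<^esub> FA L (\<eta> a) = Ide D (FO L a)) \<and>
     (\<forall>b \<in> Obj D. FA U (\<epsilon> b) \<cdot>\<^bsub>C\<^esub> \<eta> (FO U b) = Ide C (FO U b))"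

text \<open>The Eilenberg--Moore category of the monad \<open>(T, \<eta>, \<mu>)\<close> on \<open>C\<close>: algebras are pairs \<open>(a, x)\<close> with
  structure arrow \<open>x : T a \<rightarrow> a\<close>, arrows are triples (domain, underlying arrow, codomain).\<close>

definition EM_cat :: "('o, 'm) cat \<Rightarrow> ('o, 'm, 'o, 'm) funct \<Rightarrow> ('o \<Rightarrow> 'm) \<Rightarrow> ('o \<Rightarrow> 'm) \<Rightarrow>
    ('o \<times> 'm, ('o \<times> 'm) \<times> 'm \<times> ('o \<times> 'm)) cat" where
  "EM_cat C T \<eta> \<mu> =
    (let algs = {(a, x). a \<in> Obj C \<and> x \<in> Hom C (FO T a) a \<and> x \<cdot>\<^bsub>C\<^esub> \<eta> a = Ide C a \<and>
                    x \<cdot>\<^bsub>C\<^esub> \<mu> a = x \<cdot>\<^bsub>C\<^esub> FA T x}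
     in \<lparr>Obj = algs,
         Arr = {((a, x), h, (b, y)). (a, x) \<in> algs \<and> (b, y) \<in> algs \<and> h \<in> Hom C a b \<and>
                  h \<cdot>\<^bsub>C\<^esub> x = y \<cdot>\<^bsub>C\<^esub> FA T h},
         Dom = (\<lambda>(A, h, B). A),
         Cod = (\<lambda>(A, h, B). B),
         Ide = (\<lambda>A. (A, Ide C (fst A), A)),
         Comp = (\<lambda>(B', k, B) (A, h, A'). (A, k \<cdot>\<^bsub>C\<^esub> h, B))\<rparr>)"

definition EM_comparison :: "('o2, 'm2) cat \<Rightarrow> ('o2, 'm2, 'o1, 'm1) funct \<Rightarrow> ('o2 \<Rightarrow> 'm2) \<Rightarrow>
    ('o2, 'm2, 'o1 \<times> 'm1, ('o1 \<times> 'm1) \<times> 'm1 \<times> ('o1 \<times> 'm1)) funct" where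
  "EM_comparison D U \<epsilon> =
    (let K = (\<lambda>b. (FO U b, FA U (\<epsilon> b)))
     in \<lparr>FO = K, FA = (\<lambda>f. (K (Dom D f), FA U f, K (Cod D f)))\<rparr>)"

definition monadic ::
  "('o1, 'm1) cat \<Rightarrow> ('o2, 'm2) cat \<Rightarrow> ('o2, 'm2, 'o1, 'm1) funct \<Rightarrow> bool" where
  "monadic C D U \<longleftrightarrow>
     (\<exists>L \<eta> \<epsilon>. is_adjunction C D L U \<eta> \<epsilon> \<and>
        is_equivalence D (EM_cat C (comp_funct U L) \<eta> (\<lambda>a. FA U (\<epsilon> (FO L a))))
          (EM_comparison D U \<epsilon>))"

text \<open>An arrow of the slice from \<open>f\<close> to \<open>g\<close> is a triple \<open>(f, h, g)\<close> with \<open>g \<cdot> h = f\<close>.\<close>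

definition slice :: "('o, 'm) cat \<Rightarrow> 'o \<Rightarrow> ('m, 'm \<times> 'm \<times> 'm) cat" where
  "slice C b =
    \<lparr>Obj = {f \<in> Arr C. Cod C f = b},
     Arr = {(f, h, g). f \<in> Arr C \<and> g \<in> Arr C \<and> Cod C f = b \<and> Cod C g = b \<and>
              h \<in> Hom C (Dom C f) (Dom C g) \<and> g \<cdot>\<^bsub>C\<^esub> h = f},
     Dom = (\<lambda>(f, h, g). f),
     Cod = (\<lambda>(f, h, g). g),
     Ide = (\<lambda>f. (f, Ide C (Dom C f), f)),
     Comp = (\<lambda>(g', k, g) (f, h, f'). (f, k \<cdot>\<^bsub>C\<^esub> h, g))\<rparr>"

definition pullback_functor :: "('o, 'm) cat \<Rightarrow> 'm \<Rightarrow> ('m, 'm \<times> 'm \<times> 'm, 'm, 'm \<times> 'm \<times> 'm) funct" where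
  "pullback_functor C p =
    \<lparr>FO = (\<lambda>f. pb2 C f p),
     FA = (\<lambda>(f, h, g). (pb2 C f p, tup C g p (h \<cdot>\<^bsub>C\<^esub> pb1 C f p) (pb2 C f p), pb2 C g p))\<rparr>"

definition effective_descent :: "('o, 'm) cat \<Rightarrow> 'm \<Rightarrow> bool" where
  "effective_descent C p \<longleftrightarrow> p \<in> Arr C \<and>
     monadic (slice C (Dom C p)) (slice C (Cod C p)) (pullback_functor C p)"

definition orthogonal :: "('o, 'm) cat \<Rightarrow> 'm \<Rightarrow> 'm \<Rightarrow> bool" where
  "orthogonal C e m \<longleftrightarrow>
     (\<forall>f g. f \<in> Hom C (Dom C e) (Dom C m) \<and> g \<in> Hom C (Cod C e) (Cod C m) \<and>
        g \<cdot>\<^bsub>C\<^esub> e = m \<cdot>\<^bsub>C\<^esub> f \<longrightarrow>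
        (\<exists>!\<delta>. \<delta> \<in> Hom C (Cod C e) (Dom C m) \<and> \<delta> \<cdot>\<^bsub>C\<^esub> e = f \<and> m \<cdot>\<^bsub>C\<^esub> \<delta> = g))"

definition factorization_system :: "('o, 'm) cat \<Rightarrow> 'm set \<Rightarrow> 'm set \<Rightarrow> bool" where
  "factorization_system C E M \<longleftrightarrow>
     E = {e \<in> Arr C. \<forall>m \<in> M. orthogonal C e m} \<and>
     M = {m \<in> Arr C. \<forall>e \<in> E. orthogonal C e m} \<and>
     (\<forall>f \<in> Arr C. \<exists>e \<in> E. \<exists>m \<in> M. Cod C e = Dom C m \<and> f = m \<cdot>\<^bsub>C\<^esub> e)"

text \<open>The composition \<open>gm\<close> is defined on the chosen pullback of \<open>(gc, gd)\<close>, whose generalized elements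
  are the pairs \<open>(f, g)\<close> with the codomain of \<open>f\<close> equal to the domain of \<open>g\<close>.\<close>

record ('o, 'm) igpd =
  G0 :: 'o
  G1 :: 'o
  gd :: 'm
  gc :: 'm
  ge :: 'm
  gm :: 'm

definition internal_category :: "('o, 'm) cat \<Rightarrow> ('o, 'm) igpd \<Rightarrow> bool" where
  "internal_category C X \<longleftrightarrow>
    (let d = gd X; c = gc X; e = ge X; m = gm X; \<pi>\<^sub>1 = pb1 C c d; \<pi>\<^sub>2 = pb2 C c d;
         \<rho>\<^sub>1 = pb1 C \<pi>\<^sub>2 \<pi>\<^sub>1; \<rho>\<^sub>2 = pb2 C \<pi>\<^sub>2 \<pi>\<^sub>1
     in G0 X \<in> Obj C \<and> G1 X \<in> Obj C \<and>
        d \<in> Hom C (G1 X) (G0 X) \<and> c \<in> Hom C (G1 X) (G0 X) \<and>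
        e \<in> Hom C (G0 X) (G1 X) \<and> m \<in> Hom C (Dom C \<pi>\<^sub>1) (G1 X) \<and>
        d \<cdot>\<^bsub>C\<^esub> e = Ide C (G0 X) \<and> c \<cdot>\<^bsub>C\<^esub> e = Ide C (G0 X) \<and>
        d \<cdot>\<^bsub>C\<^esub> m = d \<cdot>\<^bsub>C\<^esub> \<pi>\<^sub>1 \<and> c \<cdot>\<^bsub>C\<^esub> m = c \<cdot>\<^bsub>C\<^esub> \<pi>\<^sub>2 \<and>
        m \<cdot>\<^bsub>C\<^esub> tup C c d (e \<cdot>\<^bsub>C\<^esub> d) (Ide C (G1 X)) = Ide C (G1 X) \<and>
        m \<cdot>\<^bsub>C\<^esub> tup C c d (Ide C (G1 X)) (e \<cdot>\<^bsub>C\<^esub> c) = Ide C (G1 X) \<and>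
        m \<cdot>\<^bsub>C\<^esub> tup C c d (m \<cdot>\<^bsub>C\<^esub> \<rho>\<^sub>1) (\<pi>\<^sub>2 \<cdot>\<^bsub>C\<^esub> \<rho>\<^sub>2) =
          m \<cdot>\<^bsub>C\<^esub> tup C c d (\<pi>\<^sub>1 \<cdot>\<^bsub>C\<^esub> \<rho>\<^sub>1) (m \<cdot>\<^bsub>C\<^esub> \<rho>\<^sub>2))"

definition internal_groupoid :: "('o, 'm) cat \<Rightarrow> ('o, 'm) igpd \<Rightarrow> bool" where
  "internal_groupoid C X \<longleftrightarrow> internal_category C X \<and>
     (\<exists>i \<in> Hom C (G1 X) (G1 X).
        gd X \<cdot>\<^bsub>C\<^esub> i = gc X \<and> gc X \<cdot>\<^bsub>C\<^esub> i = gd X \<and>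
        gm X \<cdot>\<^bsub>C\<^esub> tup C (gc X) (gd X) (Ide C (G1 X)) i = ge X \<cdot>\<^bsub>C\<^esub> gd X \<and>
        gm X \<cdot>\<^bsub>C\<^esub> tup C (gc X) (gd X) i (Ide C (G1 X)) = ge X \<cdot>\<^bsub>C\<^esub> gc X)"

record ('o, 'm) ifun =
  Src :: "('o, 'm) igpd"
  Tgt :: "('o, 'm) igpd"
  F0 :: 'm
  F1 :: 'm

definition internal_functor :: "('o, 'm) cat \<Rightarrow> ('o, 'm) ifun \<Rightarrow> bool" where
  "internal_functor C F \<longleftrightarrow>
    (let X = Src F; Y = Tgt F; \<pi>\<^sub>1 = pb1 C (gc X) (gd X); \<pi>\<^sub>2 = pb2 C (gc X) (gd X)
     in F0 F \<in> Hom C (G0 X) (G0 Y) \<and> F1 F \<in> Hom C (G1 X) (G1 Y) \<and>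
        gd Y \<cdot>\<^bsub>C\<^esub> F1 F = F0 F \<cdot>\<^bsub>C\<^esub> gd X \<and> gc Y \<cdot>\<^bsub>C\<^esub> F1 F = F0 F \<cdot>\<^bsub>C\<^esub> gc X \<and>
        F1 F \<cdot>\<^bsub>C\<^esub> ge X = ge Y \<cdot>\<^bsub>C\<^esub> F0 F \<and>
        F1 F \<cdot>\<^bsub>C\<^esub> gm X = gm Y \<cdot>\<^bsub>C\<^esub> tup C (gc Y) (gd Y) (F1 F \<cdot>\<^bsub>C\<^esub> \<pi>\<^sub>1) (F1 F \<cdot>\<^bsub>C\<^esub> \<pi>\<^sub>2))"

definition Gpd :: "('o, 'm) cat \<Rightarrow> (('o, 'm) igpd, ('o, 'm) ifun) cat" where
  "Gpd C =
    \<lparr>Obj = {X. internal_groupoid C X},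
     Arr = {F. internal_groupoid C (Src F) \<and> internal_groupoid C (Tgt F) \<and> internal_functor C F},
     Dom = Src,
     Cod = Tgt,
     Ide = (\<lambda>X. \<lparr>Src = X, Tgt = X, F0 = Ide C (G0 X), F1 = Ide C (G1 X)\<rparr>),
     Comp = (\<lambda>G F. \<lparr>Src = Src F, Tgt = Tgt G, F0 = F0 G \<cdot>\<^bsub>C\<^esub> F0 F, F1 = F1 G \<cdot>\<^bsub>C\<^esub> F1 F\<rparr>)\<rparr>"

text \<open>The functor \<open>D\<close> on objects and on arrows; an arrow pair composable in the discrete groupoid is
  \<open>(x, x)\<close>, so that composition is a pullback projection.\<close>

definition disc :: "('o, 'm) cat \<Rightarrow> 'o \<Rightarrow> ('o, 'm) igpd" where
  "disc C a = \<lparr>G0 = a, G1 = a, gd = Ide C a, gc = Ide C a, ge = Ide C a,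
     gm = pb1 C (Ide C a) (Ide C a)\<rparr>"

definition disc_map :: "('o, 'm) cat \<Rightarrow> 'm \<Rightarrow> ('o, 'm) ifun" where
  "disc_map C h = \<lparr>Src = disc C (Dom C h), Tgt = disc C (Cod C h), F0 = h, F1 = h\<rparr>"

text \<open>The internal groupoid of an internal equivalence relation \<open>(r, s)\<close>: since \<open>r\<close> and \<open>s\<close> are jointly
  monic, its identities and its composition are determined by their domains and codomains.\<close>

definition relation_groupoid :: "('o, 'm) cat \<Rightarrow> 'm \<Rightarrow> 'm \<Rightarrow> ('o, 'm) igpd" where
  "relation_groupoid C r s =
    \<lparr>G0 = Cod C r, G1 = Dom C r, gd = r, gc = s,
     ge = (THE e. e \<in> Hom C (Cod C r) (Dom C r) \<and>
             r \<cdot>\<^bsub>C\<^esub> e = Ide C (Cod C r) \<and> s \<cdot>\<^bsub>C\<^esub> e = Ide C (Cod C r)),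
     gm = (THE m. m \<in> Hom C (Dom C (pb1 C s r)) (Dom C r) \<and>
             r \<cdot>\<^bsub>C\<^esub> m = r \<cdot>\<^bsub>C\<^esub> pb1 C s r \<and> s \<cdot>\<^bsub>C\<^esub> m = s \<cdot>\<^bsub>C\<^esub> pb2 C s r)\<rparr>"

definition discrete_fibration :: "('o, 'm) cat \<Rightarrow> ('o, 'm) ifun \<Rightarrow> bool" where
  "discrete_fibration C F \<longleftrightarrow> F \<in> Arr (Gpd C) \<and>
     is_pullback C (gc (Tgt F)) (F0 F) (F1 F) (gc (Src F))"

definition final_functors :: "('o, 'm) cat \<Rightarrow> ('o, 'm) ifun set" where
  "final_functors C =
     {e \<in> Arr (Gpd C). \<forall>m. discrete_fibration C m \<longrightarrow> orthogonal (Gpd C) e m}"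

definition pi0_quot :: "('o, 'm) cat \<Rightarrow> ('o, 'm) igpd \<Rightarrow> 'm" where
  "pi0_quot C X = (SOME q. is_coequalizer C (gd X) (gc X) q)"

definition pi0 :: "('o, 'm) cat \<Rightarrow> ('o, 'm) igpd \<Rightarrow> 'o" where
  "pi0 C X = Cod C (pi0_quot C X)"

definition pi0_map :: "('o, 'm) cat \<Rightarrow> ('o, 'm) ifun \<Rightarrow> 'm" where
  "pi0_map C F = (THE h. h \<in> Hom C (pi0 C (Src F)) (pi0 C (Tgt F)) \<and>
     h \<cdot>\<^bsub>C\<^esub> pi0_quot C (Src F) = pi0_quot C (Tgt F) \<cdot>\<^bsub>C\<^esub> F0 F)"

definition pi0_unit :: "('o, 'm) cat \<Rightarrow> ('o, 'm) igpd \<Rightarrow> ('o, 'm) ifun" where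
  "pi0_unit C X = \<lparr>Src = X, Tgt = disc C (pi0 C X), F0 = pi0_quot C X,
     F1 = pi0_quot C X \<cdot>\<^bsub>C\<^esub> gd X\<rparr>"

definition class_E :: "('o, 'm) cat \<Rightarrow> ('o, 'm) ifun set" where
  "class_E C = {f \<in> Arr (Gpd C). is_iso C (pi0_map C f)}"

definition class_M :: "('o, 'm) cat \<Rightarrow> ('o, 'm) ifun set" where
  "class_M C = {m \<in> Arr (Gpd C).
     is_pullback (Gpd C) (pi0_unit C (Tgt m)) (disc_map C (pi0_map C m)) m (pi0_unit C (Src m))}"

definition class_E' :: "('o, 'm) cat \<Rightarrow> ('o, 'm) ifun set" where
  "class_E' C = {f \<in> Arr (Gpd C). \<forall>g p q. is_pullback (Gpd C) f g p q \<longrightarrow> q \<in> class_E C}"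

definition class_M_star :: "('o, 'm) cat \<Rightarrow> ('o, 'm) ifun set" where
  "class_M_star C = {f \<in> Arr (Gpd C).
     \<exists>p r q. effective_descent (Gpd C) p \<and> is_pullback (Gpd C) f p r q \<and> q \<in> class_M C}"

definition has_monotone_light_factorization :: "('o, 'm) cat \<Rightarrow> bool" where
  "has_monotone_light_factorization C \<longleftrightarrow>
     factorization_system (Gpd C) (class_E' C) (class_M_star C)"

text \<open>Abelian groups (written multiplicatively, as in HOL-Algebra) whose elements are taken from a
  fixed type \<open>'u\<close>, which plays the role of the universe. For infinite \<open>'u\<close> this category has all
  finite limits. Arrows are triples (domain, map, codomain), the map being extensional on the
  carrier of the domain.\<close>

type_synonym 'u ab_arr = "'u monoid \<times> ('u \<Rightarrow> 'u) \<times> 'u monoid"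

definition Ab :: "('u monoid, 'u ab_arr) cat" where
  "Ab =
    \<lparr>Obj = {G. comm_group G},
     Arr = {(G, f, H). comm_group G \<and> comm_group H \<and> f \<in> hom G H \<inter> extensional (carrier G)},
     Dom = (\<lambda>(G, f, H). G),
     Cod = (\<lambda>(G, f, H). H),
     Ide = (\<lambda>G. (G, \<lambda>x \<in> carrier G. x, G)),
     Comp = (\<lambda>(H', g, K) (G, f, H). (G, compose (carrier G) g f, K))\<rparr>"

text \<open>An infinite type is closed under pairing: \<open>upair\<close> is obtained from an arbitrarily chosen
  injection of \<open>'u \<times> 'u\<close> into \<open>'u\<close>, and products of groups are transported along it.\<close>

definition pairing :: "'u::infinite \<times> 'u \<Rightarrow> 'u" where
  "pairing = (SOME e. inj e)"

lemma inj_pairing: "inj (pairing :: 'u::infinite \<times> 'u \<Rightarrow> 'u)"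
proof -
  have "(card_of (UNIV \<times> UNIV :: ('u \<times> 'u) set), card_of (UNIV :: 'u set)) \<in> ordIso"
    by (rule card_of_Times_same_infinite) (rule infinite_UNIV)
  then obtain e :: "'u \<times> 'u \<Rightarrow> 'u" where "bij_betw e UNIV UNIV"
    unfolding card_of_ordIso[symmetric] by auto
  then have "inj e" by (rule bij_betw_imp_inj_on)
  then show ?thesis unfolding pairing_def by (rule someI[where P = inj])
qed

abbreviation upair :: "'u::infinite \<Rightarrow> 'u \<Rightarrow> 'u" ("\<langle>_,/ _\<rangle>") where
  "\<langle>a, b\<rangle> \<equiv> pairing (a, b)"

definition ufst :: "'u::infinite \<Rightarrow> 'u" where
  "ufst z = fst (inv_into UNIV pairing z)"

definition usnd :: "'u::infinite \<Rightarrow> 'u" where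
  "usnd z = snd (inv_into UNIV pairing z)"

lemma ufst_upair [simp]: "ufst \<langle>a, b\<rangle> = a" and usnd_upair [simp]: "usnd \<langle>a, b\<rangle> = b"
  by (simp_all add: ufst_def usnd_def inj_pairing)

definition ab_prod :: "'u::infinite monoid \<Rightarrow> 'u monoid \<Rightarrow> 'u monoid" (infixr "\<times>\<^sub>u" 80) where
  "G \<times>\<^sub>u H = image_group pairing (G \<times>\<times> H)"

definition ab_proj1 :: "'u::infinite monoid \<Rightarrow> 'u monoid \<Rightarrow> 'u ab_arr" where
  "ab_proj1 G H = (G \<times>\<^sub>u H, \<lambda>z \<in> carrier (G \<times>\<^sub>u H). ufst z, G)"

definition ab_proj2 :: "'u::infinite monoid \<Rightarrow> 'u monoid \<Rightarrow> 'u ab_arr" where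
  "ab_proj2 G H = (G \<times>\<^sub>u H, \<lambda>z \<in> carrier (G \<times>\<^sub>u H). usnd z, H)"

definition ab_prod_map :: "'u::infinite ab_arr \<Rightarrow> 'u ab_arr \<Rightarrow> 'u ab_arr" where
  "ab_prod_map = (\<lambda>(G, f, G') (H, h, H').
     (G \<times>\<^sub>u H, \<lambda>z \<in> carrier (G \<times>\<^sub>u H). \<langle>f (ufst z), h (usnd z)\<rangle>, G' \<times>\<^sub>u H'))"

definition Y_dom :: "'u::infinite monoid \<Rightarrow> 'u ab_arr" where
  "Y_dom A = ab_prod_map (Ide Ab A) (ab_proj1 A A)"

definition Y_cod :: "'u::infinite monoid \<Rightarrow> 'u ab_arr" where
  "Y_cod A = ab_prod_map (Ide Ab A) (ab_proj2 A A)"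

definition Y_gpd :: "'u::infinite monoid \<Rightarrow> ('u monoid, 'u ab_arr) igpd" where
  "Y_gpd A = relation_groupoid Ab (Y_dom A) (Y_cod A)"

definition F_fun :: "'u::infinite monoid \<Rightarrow> ('u monoid, 'u ab_arr) ifun" where
  "F_fun A =
    \<lparr>Src = disc Ab A, Tgt = Y_gpd A,
     F0 = (A, \<lambda>a \<in> carrier A. \<langle>a, \<one>\<^bsub>A\<^esub>\<rangle>, A \<times>\<^sub>u A),
     F1 = (A, \<lambda>a \<in> carrier A. \<langle>a, \<langle>\<one>\<^bsub>A\<^esub>, \<one>\<^bsub>A\<^esub>\<rangle>\<rangle>, A \<times>\<^sub>u (A \<times>\<^sub>u A))\<rparr>"

definition G_fun :: "'u::infinite monoid \<Rightarrow> ('u monoid, 'u ab_arr) ifun" where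
  "G_fun A =
    \<lparr>Src = disc Ab A, Tgt = Y_gpd A,
     F0 = (A, \<lambda>a \<in> carrier A. \<langle>\<one>\<^bsub>A\<^esub>, a\<rangle>, A \<times>\<^sub>u A),
     F1 = (A, \<lambda>a \<in> carrier A. \<langle>\<one>\<^bsub>A\<^esub>, \<langle>a, a\<rangle>\<rangle>, A \<times>\<^sub>u (A \<times>\<^sub>u A))\<rparr>"

end

theory Submission
  imports Defs "HOL-Algebra.Elementary_Groups" "HOL-Library.Countable"
begin

text \<open>
  Groups are written additively in the comments, and \<open>X\<^sub>0\<close>, \<open>X\<^sub>1\<close> are the groups of objects and of arrows
  of an internal groupoid \<open>X\<close>.

  In abelian groups an internal groupoid is no more than a reflexive graph: the composite of
  \<open>f : x \<rightarrow> y\<close> and \<open>g : y \<rightarrow> z\<close> has to be \<open>f - 1\<^sub>y + g\<close>, and every homomorphism of reflexive graphs is a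
  functor (\<open>internal_groupoid_Ab_iff\<close>, \<open>Gpd_Hom\<close>). Consequently a functor \<open>Y \<rightarrow> X\<close> is the same thing as a
  pair of homomorphisms, one from \<open>A\<close> to \<open>X\<^sub>0\<close>, which is its restriction along \<open>F\<close>, and one from \<open>A\<close> to
  the kernel of the codomain map \<open>X\<^sub>1 \<rightarrow> X\<^sub>0\<close> (\<open>Y_ext\<close>, \<open>Y_extend\<close>). A discrete fibration induces an
  isomorphism on these kernels, hence \<open>F\<close> is final (\<open>F_final\<close>). On objects \<open>F\<close> and \<open>G\<close> are the two
  inclusions of \<open>A\<close> into \<open>A \<times> A\<close>, which only meet in \<open>0\<close>; so the pullback of \<open>F\<close> along \<open>G\<close> is the
  functor \<open>0 \<rightarrow> D(A)\<close>, which \<open>\<pi>\<^sub>0\<close> sends to \<open>0 \<rightarrow> A\<close> (\<open>F_G_pullback_exists\<close>, \<open>F_G_pullback_not_iso\<close>). Thus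
  \<open>F\<close> is not in \<open>\<E>'\<close> when \<open>A\<close> is non-trivial.

  If \<open>(\<E>', \<M>\<^sup>*)\<close> were a factorization system, then \<open>\<E>'\<close> would contain every morphism orthogonal to \<open>\<M>\<^sup>*\<close>.
  It is therefore enough that \<open>F\<close> is orthogonal to \<open>\<M>\<^sup>*\<close> for one non-trivial group, and the group of
  integers \<open>Z\<close> is convenient as it is projective. First, \<open>F\<close> is orthogonal to \<open>\<M>\<close>, because a morphism in
  \<open>\<M>\<close> is a pullback of a functor between discrete groupoids, and all functors \<open>D(Z) \<rightarrow> D(B)\<close> extend
  uniquely along \<open>F\<close> (\<open>F_orthogonal_M\<close>). Secondly, let the pullback \<open>q\<close> of \<open>m\<close> along an effective descent
  morphism \<open>p\<close> be in \<open>\<M>\<close>. Monadicity makes \<open>p\<^sup>*\<close> reflect isomorphisms, so \<open>p\<close> is an extremal epimorphism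
  (\<open>effective_descent_extremal\<close>) and hence surjective on arrows (\<open>effective_descent_surjective\<close>). As \<open>Z\<close> is
  projective, all functors from \<open>Y\<close> to the codomain of \<open>p\<close> lift along \<open>p\<close> (\<open>Y_projective\<close>), and such lifts
  transport the orthogonality of \<open>F\<close> to \<open>q\<close> into orthogonality to \<open>m\<close> (\<open>F_orthogonal_M_star\<close>).
\<close>

section \<open>Categories, slices and descent\<close>

lemma Hom_iff: "f \<in> Hom C a b \<longleftrightarrow> f \<in> Arr C \<and> Dom C f = a \<and> Cod C f = b"
  by (simp add: Hom_def)

lemma HomD:
  assumes "f \<in> Hom C a b"
  shows "f \<in> Arr C" "Dom C f = a" "Cod C f = b"
  using assms by (simp_all add: Hom_iff)

lemma Arr_Hom: "f \<in> Arr C \<Longrightarrow> f \<in> Hom C (Dom C f) (Cod C f)"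
  by (simp add: Hom_iff)

lemma category_Ide: "category C \<Longrightarrow> a \<in> Obj C \<Longrightarrow> Ide C a \<in> Hom C a a"
  by (simp add: category_def)

lemma category_Obj: "category C \<Longrightarrow> f \<in> Hom C a b \<Longrightarrow> a \<in> Obj C \<and> b \<in> Obj C"
  by (auto simp: category_def Hom_iff)

lemma category_comp:
  "category C \<Longrightarrow> f \<in> Hom C a b \<Longrightarrow> g \<in> Hom C b c \<Longrightarrow> g \<cdot>\<^bsub>C\<^esub> f \<in> Hom C a c"
  unfolding category_def Hom_iff by metis

lemma category_Ide_right: "category C \<Longrightarrow> f \<in> Hom C a b \<Longrightarrow> f \<cdot>\<^bsub>C\<^esub> Ide C a = f"
  unfolding category_def Hom_iff by metis

lemma category_Ide_left: "category C \<Longrightarrow> f \<in> Hom C a b \<Longrightarrow> Ide C b \<cdot>\<^bsub>C\<^esub> f = f"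
  unfolding category_def Hom_iff by metis

lemma category_assoc:
  "category C \<Longrightarrow> f \<in> Hom C a b \<Longrightarrow> g \<in> Hom C b c \<Longrightarrow> h \<in> Hom C c d \<Longrightarrow>
     h \<cdot>\<^bsub>C\<^esub> (g \<cdot>\<^bsub>C\<^esub> f) = (h \<cdot>\<^bsub>C\<^esub> g) \<cdot>\<^bsub>C\<^esub> f"
  unfolding category_def Hom_iff by metis

lemma category_cancel:
  assumes C: "category C" and f: "f \<in> Hom C a b" and g: "g \<in> Hom C b c" and h: "h \<in> Hom C c b"
    and hg: "h \<cdot>\<^bsub>C\<^esub> g = Ide C b"
  shows "h \<cdot>\<^bsub>C\<^esub> (g \<cdot>\<^bsub>C\<^esub> f) = f"
  using category_assoc[OF C f g h] hg category_Ide_left[OF C f] by simp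

lemma is_isoI:
  assumes "f \<in> Hom C a b" "g \<in> Hom C b a" "g \<cdot>\<^bsub>C\<^esub> f = Ide C a" "f \<cdot>\<^bsub>C\<^esub> g = Ide C b"
  shows "is_iso C f"
  unfolding is_iso_def using assms HomD[OF assms(1)] by auto

lemma is_isoE:
  assumes "is_iso C f" "f \<in> Hom C a b"
  obtains g where "g \<in> Hom C b a" "g \<cdot>\<^bsub>C\<^esub> f = Ide C a" "f \<cdot>\<^bsub>C\<^esub> g = Ide C b"
  using assms(1) HomD[OF assms(2)] that unfolding is_iso_def by blast

lemma is_iso_comp:
  assumes C: "category C" and f: "f \<in> Hom C a b" "is_iso C f" and g: "g \<in> Hom C b c" "is_iso C g"
  shows "is_iso C (g \<cdot>\<^bsub>C\<^esub> f)"
proof -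
  from f obtain f' where f': "f' \<in> Hom C b a" "f' \<cdot>\<^bsub>C\<^esub> f = Ide C a" "f \<cdot>\<^bsub>C\<^esub> f' = Ide C b"
    by (elim is_isoE)
  from g obtain g' where g': "g' \<in> Hom C c b" "g' \<cdot>\<^bsub>C\<^esub> g = Ide C b" "g \<cdot>\<^bsub>C\<^esub> g' = Ide C c"
    by (elim is_isoE)
  note cat = category_comp[OF C] category_assoc[OF C] category_Ide_left[OF C] category_Ide_right[OF C]
  show ?thesis
  proof (rule is_isoI)
    show "g \<cdot>\<^bsub>C\<^esub> f \<in> Hom C a c" "f' \<cdot>\<^bsub>C\<^esub> g' \<in> Hom C c a"
      using f f' g g' cat(1) by blast+
    show "(f' \<cdot>\<^bsub>C\<^esub> g') \<cdot>\<^bsub>C\<^esub> (g \<cdot>\<^bsub>C\<^esub> f) = Ide C a"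
      using cat(2)[OF cat(1)[OF f(1) g(1)] g'(1) f'(1)] category_cancel[OF C f(1) g(1) g'(1,2)] f' by simp
    show "(g \<cdot>\<^bsub>C\<^esub> f) \<cdot>\<^bsub>C\<^esub> (f' \<cdot>\<^bsub>C\<^esub> g') = Ide C c"
      using cat(2)[OF cat(1)[OF g'(1) f'(1)] f(1) g(1)] category_cancel[OF C g'(1) f'(1) f(1) f'(3)] g' by simp
  qed
qed

lemma is_pullbackI:
  assumes "f \<in> Hom C a c" "g \<in> Hom C b c" "p \<in> Hom C x a" "q \<in> Hom C x b"
    and "f \<cdot>\<^bsub>C\<^esub> p = g \<cdot>\<^bsub>C\<^esub> q"
    and "\<And>z u v. u \<in> Hom C z a \<Longrightarrow> v \<in> Hom C z b \<Longrightarrow> f \<cdot>\<^bsub>C\<^esub> u = g \<cdot>\<^bsub>C\<^esub> v \<Longrightarrow>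
      \<exists>!w. w \<in> Hom C z x \<and> p \<cdot>\<^bsub>C\<^esub> w = u \<and> q \<cdot>\<^bsub>C\<^esub> w = v"
  shows "is_pullback C f g p q"
  unfolding is_pullback_def
proof (intro conjI ballI impI)
  fix u v assume "u \<in> Arr C" "v \<in> Arr C"
    and "Dom C u = Dom C v \<and> Cod C u = Dom C f \<and> Cod C v = Dom C g \<and> f \<cdot>\<^bsub>C\<^esub> u = g \<cdot>\<^bsub>C\<^esub> v"
  then show "\<exists>!w. w \<in> Hom C (Dom C u) (Dom C p) \<and> p \<cdot>\<^bsub>C\<^esub> w = u \<and> q \<cdot>\<^bsub>C\<^esub> w = v"
    using assms(6)[of u "Dom C u" v] HomD[OF assms(1)] HomD[OF assms(2)] HomD[OF assms(3)]
    by (auto simp: Hom_iff)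
qed (use assms(1-5) in \<open>auto simp: Hom_iff\<close>)

lemma pullback_lift:
  assumes "is_pullback C f g p q" "u \<in> Hom C z (Dom C f)" "v \<in> Hom C z (Dom C g)"
    "f \<cdot>\<^bsub>C\<^esub> u = g \<cdot>\<^bsub>C\<^esub> v"
  shows "\<exists>!w. w \<in> Hom C z (Dom C p) \<and> p \<cdot>\<^bsub>C\<^esub> w = u \<and> q \<cdot>\<^bsub>C\<^esub> w = v"
proof -
  have "Dom C u = Dom C v \<and> Cod C u = Dom C f \<and> Cod C v = Dom C g \<and> f \<cdot>\<^bsub>C\<^esub> u = g \<cdot>\<^bsub>C\<^esub> v"
    using HomD[OF assms(2)] HomD[OF assms(3)] assms(4) by simp
  then show ?thesis
    using assms(1) HomD(1,2)[OF assms(2)] HomD(1)[OF assms(3)] unfolding is_pullback_def by blast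
qed

lemma pullback_ext:
  assumes C: "category C" and pb: "is_pullback C f g p q"
    and w: "w \<in> Hom C z (Dom C p)" "w' \<in> Hom C z (Dom C p)"
    and eq: "p \<cdot>\<^bsub>C\<^esub> w = p \<cdot>\<^bsub>C\<^esub> w'" "q \<cdot>\<^bsub>C\<^esub> w = q \<cdot>\<^bsub>C\<^esub> w'"
  shows "w = w'"
proof -
  have p: "f \<in> Hom C (Dom C f) (Cod C f)" "g \<in> Hom C (Dom C g) (Cod C f)"
    "p \<in> Hom C (Dom C p) (Dom C f)" "q \<in> Hom C (Dom C p) (Dom C g)" "f \<cdot>\<^bsub>C\<^esub> p = g \<cdot>\<^bsub>C\<^esub> q"
    using pb by (auto simp: is_pullback_def Hom_iff)
  have "f \<cdot>\<^bsub>C\<^esub> (p \<cdot>\<^bsub>C\<^esub> w) = g \<cdot>\<^bsub>C\<^esub> (q \<cdot>\<^bsub>C\<^esub> w)"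
    using category_assoc[OF C w(1) p(3,1)] category_assoc[OF C w(1) p(4,2)] p(5) by simp
  then have "\<exists>!w'. w' \<in> Hom C z (Dom C p) \<and> p \<cdot>\<^bsub>C\<^esub> w' = p \<cdot>\<^bsub>C\<^esub> w \<and> q \<cdot>\<^bsub>C\<^esub> w' = q \<cdot>\<^bsub>C\<^esub> w"
    using pullback_lift[OF pb] category_comp[OF C w(1)] p by blast
  then show ?thesis using w eq by metis
qed

lemma pb_is_pullback:
  assumes "is_pullback C f g p q"
  shows "is_pullback C f g (pb1 C f g) (pb2 C f g)"
proof -
  have "\<exists>pq. is_pullback C f g (fst pq) (snd pq)"
    using assms by (intro exI[of _ "(p, q)"]) simp
  then show ?thesis unfolding pb1_def pb2_def pb_def by (rule someI_ex)
qed

lemma tup: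
  assumes "is_pullback C f g (pb1 C f g) (pb2 C f g)"
    and "u \<in> Hom C z (Dom C f)" "v \<in> Hom C z (Dom C g)" "f \<cdot>\<^bsub>C\<^esub> u = g \<cdot>\<^bsub>C\<^esub> v"
  shows "tup C f g u v \<in> Hom C z (Dom C (pb1 C f g))"
    and "pb1 C f g \<cdot>\<^bsub>C\<^esub> tup C f g u v = u"
    and "pb2 C f g \<cdot>\<^bsub>C\<^esub> tup C f g u v = v"
proof -
  have "Dom C u = z" using assms(2) by (simp add: Hom_iff)
  then have "\<exists>!w. w \<in> Hom C (Dom C u) (Dom C (pb1 C f g)) \<and>
     pb1 C f g \<cdot>\<^bsub>C\<^esub> w = u \<and> pb2 C f g \<cdot>\<^bsub>C\<^esub> w = v"
    using pullback_lift[OF assms] by simp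
  from theI'[OF this] \<open>Dom C u = z\<close>
  show "tup C f g u v \<in> Hom C z (Dom C (pb1 C f g))"
    "pb1 C f g \<cdot>\<^bsub>C\<^esub> tup C f g u v = u" "pb2 C f g \<cdot>\<^bsub>C\<^esub> tup C f g u v = v"
    unfolding tup_def by auto
qed

lemma equivalence_relation_mono:
  assumes eq: "equivalence_relation C r s"
    and uv: "u \<in> Hom C z (Dom C r)" "v \<in> Hom C z (Dom C r)" "r \<cdot>\<^bsub>C\<^esub> u = r \<cdot>\<^bsub>C\<^esub> v" "s \<cdot>\<^bsub>C\<^esub> u = s \<cdot>\<^bsub>C\<^esub> v"
  shows "u = v"
proof -
  have "\<forall>u \<in> Arr C. \<forall>v \<in> Arr C. Dom C u = Dom C v \<and> Cod C u = Dom C r \<and> Cod C v = Dom C r \<and>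
      r \<cdot>\<^bsub>C\<^esub> u = r \<cdot>\<^bsub>C\<^esub> v \<and> s \<cdot>\<^bsub>C\<^esub> u = s \<cdot>\<^bsub>C\<^esub> v \<longrightarrow> u = v"
    using eq by (simp add: equivalence_relation_def)
  then show ?thesis using HomD[OF uv(1)] HomD[OF uv(2)] uv(3,4) by simp
qed

lemma slice_Hom:
  "t \<in> Hom (slice C b) f g \<longleftrightarrow> (\<exists>h. t = (f, h, g) \<and> f \<in> Hom C (Dom C f) b \<and> g \<in> Hom C (Dom C g) b \<and>
     h \<in> Hom C (Dom C f) (Dom C g) \<and> g \<cdot>\<^bsub>C\<^esub> h = f)"
  by (auto simp: slice_def Hom_iff)

lemma category_slice:
  assumes C: "category C"
  shows "category (slice C b)"
  unfolding category_def
proof (intro conjI ballI impI)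
  note cat = category_comp[OF C] category_assoc[OF C] category_Ide_left[OF C] category_Ide_right[OF C]
  fix f assume f: "f \<in> Arr (slice C b)"
  then show "Dom (slice C b) f \<in> Obj (slice C b)" "Cod (slice C b) f \<in> Obj (slice C b)"
    by (auto simp: slice_def)
  from f show "f \<cdot>\<^bsub>slice C b\<^esub> Ide (slice C b) (Dom (slice C b) f) = f"
    "Ide (slice C b) (Cod (slice C b) f) \<cdot>\<^bsub>slice C b\<^esub> f = f"
    using cat by (auto simp: slice_def)
next
  fix f assume "f \<in> Obj (slice C b)"
  then show "Ide (slice C b) f \<in> Hom (slice C b) f f"
    using C category_Ide[OF C] category_Obj[OF C] category_Ide_right[OF C]
    by (force simp: slice_def Hom_iff)
next
  fix f g assume "f \<in> Arr (slice C b)" "g \<in> Arr (slice C b)"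
    "Cod (slice C b) f = Dom (slice C b) g"
  then have "f \<in> Hom (slice C b) (Dom (slice C b) f) (Dom (slice C b) g)"
    "g \<in> Hom (slice C b) (Dom (slice C b) g) (Cod (slice C b) g)"
    using Arr_Hom by metis+
  then obtain x y z k l where "f = (x, k, y)" "g = (y, l, z)"
    and x: "x \<in> Hom C (Dom C x) b" "z \<in> Hom C (Dom C z) b" "y \<cdot>\<^bsub>C\<^esub> k = x" "z \<cdot>\<^bsub>C\<^esub> l = y"
    and k: "k \<in> Hom C (Dom C x) (Dom C y)" "l \<in> Hom C (Dom C y) (Dom C z)"
    unfolding slice_Hom by blast
  moreover have "z \<cdot>\<^bsub>C\<^esub> (l \<cdot>\<^bsub>C\<^esub> k) = x"
    using category_assoc[OF C k x(2)] x(3,4) by simp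
  ultimately show "g \<cdot>\<^bsub>slice C b\<^esub> f \<in> Hom (slice C b) (Dom (slice C b) f) (Cod (slice C b) g)"
    using category_comp[OF C k] unfolding slice_Hom by (auto simp: slice_def)
next
  fix f g h assume "f \<in> Arr (slice C b)" "g \<in> Arr (slice C b)" "h \<in> Arr (slice C b)"
    "Cod (slice C b) f = Dom (slice C b) g" "Cod (slice C b) g = Dom (slice C b) h"
  then show "h \<cdot>\<^bsub>slice C b\<^esub> (g \<cdot>\<^bsub>slice C b\<^esub> f) = (h \<cdot>\<^bsub>slice C b\<^esub> g) \<cdot>\<^bsub>slice C b\<^esub> f"
    by (auto simp: slice_def category_assoc[OF C])
qed

lemma slice_iso:
  assumes C: "category C" and t: "(f, h, g) \<in> Hom (slice C b) f g"
    and iso: "is_iso C f" "is_iso C g"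
  shows "is_iso (slice C b) (f, h, g)"
proof -
  note cat = category_comp[OF C] category_assoc[OF C] category_Ide_left[OF C] category_Ide_right[OF C]
  have f: "f \<in> Hom C (Dom C f) b" and g: "g \<in> Hom C (Dom C g) b"
    and h: "h \<in> Hom C (Dom C f) (Dom C g)" "g \<cdot>\<^bsub>C\<^esub> h = f"
    using t unfolding slice_Hom by auto
  obtain f' where f': "f' \<in> Hom C b (Dom C f)" "f' \<cdot>\<^bsub>C\<^esub> f = Ide C (Dom C f)" "f \<cdot>\<^bsub>C\<^esub> f' = Ide C b"
    using is_isoE[OF iso(1) f] .
  obtain g' where g': "g' \<in> Hom C b (Dom C g)" "g' \<cdot>\<^bsub>C\<^esub> g = Ide C (Dom C g)" "g \<cdot>\<^bsub>C\<^esub> g' = Ide C b"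
    using is_isoE[OF iso(2) g] .
  have k: "f' \<cdot>\<^bsub>C\<^esub> g \<in> Hom C (Dom C g) (Dom C f)" using f' g cat(1) by blast
  have h_eq: "h = g' \<cdot>\<^bsub>C\<^esub> f" using category_cancel[OF C h(1) g g'(1,2)] h(2) by simp
  have 1: "f \<cdot>\<^bsub>C\<^esub> (f' \<cdot>\<^bsub>C\<^esub> g) = g" by (rule category_cancel[OF C g f'(1) f f'(3)])
  have 2: "(f' \<cdot>\<^bsub>C\<^esub> g) \<cdot>\<^bsub>C\<^esub> h = Ide C (Dom C f)" using cat(2)[OF h(1) g f'(1)] h(2) f'(2) by simp
  have 3: "h \<cdot>\<^bsub>C\<^esub> (f' \<cdot>\<^bsub>C\<^esub> g) = Ide C (Dom C g)"
    unfolding h_eq using cat(2)[OF k f g'(1)] 1 g'(2) by simp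
  show ?thesis
  proof (rule is_isoI)
    show "(f, h, g) \<in> Hom (slice C b) f g" by fact
    show "(g, f' \<cdot>\<^bsub>C\<^esub> g, f) \<in> Hom (slice C b) g f"
      unfolding slice_Hom using f g k 1 by auto
    show "(g, f' \<cdot>\<^bsub>C\<^esub> g, f) \<cdot>\<^bsub>slice C b\<^esub> (f, h, g) = Ide (slice C b) f"
      "(f, h, g) \<cdot>\<^bsub>slice C b\<^esub> (g, f' \<cdot>\<^bsub>C\<^esub> g, f) = Ide (slice C b) g"
      using 2 3 by (simp_all add: slice_def)
  qed
qed

lemma functor_Hom: "is_functor C D F \<Longrightarrow> f \<in> Hom C a b \<Longrightarrow> FA F f \<in> Hom D (FO F a) (FO F b)"
  unfolding is_functor_def by (metis HomD)

lemma functor_Ide: "is_functor C D F \<Longrightarrow> a \<in> Obj C \<Longrightarrow> FA F (Ide C a) = Ide D (FO F a)"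
  unfolding is_functor_def by metis

lemma functor_comp:
  "is_functor C D F \<Longrightarrow> f \<in> Hom C a b \<Longrightarrow> g \<in> Hom C b c \<Longrightarrow>
     FA F (g \<cdot>\<^bsub>C\<^esub> f) = FA F g \<cdot>\<^bsub>D\<^esub> FA F f"
  unfolding is_functor_def by (metis HomD)

lemma functor_Obj: "is_functor C D F \<Longrightarrow> a \<in> Obj C \<Longrightarrow> FO F a \<in> Obj D"
  unfolding is_functor_def by metis

lemma functor_compose:
  assumes F: "is_functor B C F" and G: "is_functor C D G"
  shows "is_functor B D (comp_funct G F)"
  unfolding is_functor_def
proof (intro conjI ballI impI)
  fix a assume a: "a \<in> Obj B"
  show "FO (comp_funct G F) a \<in> Obj D"
    using functor_Obj[OF G functor_Obj[OF F a]] by (simp add: comp_funct_def)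
  show "FA (comp_funct G F) (Ide B a) = Ide D (FO (comp_funct G F) a)"
    using functor_Ide[OF F a] functor_Ide[OF G functor_Obj[OF F a]] by (simp add: comp_funct_def)
next
  fix f assume "f \<in> Arr B"
  from functor_Hom[OF G functor_Hom[OF F Arr_Hom[OF this]]]
  show "FA (comp_funct G F) f \<in> Hom D (FO (comp_funct G F) (Dom B f)) (FO (comp_funct G F) (Cod B f))"
    by (simp add: comp_funct_def)
next
  fix f g assume "f \<in> Arr B" "g \<in> Arr B" "Cod B f = Dom B g"
  then have f: "f \<in> Hom B (Dom B f) (Dom B g)" and g: "g \<in> Hom B (Dom B g) (Cod B g)"
    by (simp_all add: Hom_iff)
  show "FA (comp_funct G F) (g \<cdot>\<^bsub>B\<^esub> f) = FA (comp_funct G F) g \<cdot>\<^bsub>D\<^esub> FA (comp_funct G F) f"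
    using functor_comp[OF F f g] functor_comp[OF G functor_Hom[OF F f] functor_Hom[OF F g]]
    by (simp add: comp_funct_def)
qed

lemma functor_iso:
  assumes F: "is_functor C D F" and C: "category C" and f: "f \<in> Hom C a b" "is_iso C f"
  shows "is_iso D (FA F f)"
proof -
  obtain g where g: "g \<in> Hom C b a" "g \<cdot>\<^bsub>C\<^esub> f = Ide C a" "f \<cdot>\<^bsub>C\<^esub> g = Ide C b"
    using is_isoE[OF f(2,1)] .
  show ?thesis
  proof (rule is_isoI)
    show "FA F f \<in> Hom D (FO F a) (FO F b)" "FA F g \<in> Hom D (FO F b) (FO F a)"
      by (rule functor_Hom[OF F f(1)], rule functor_Hom[OF F g(1)])
    show "FA F g \<cdot>\<^bsub>D\<^esub> FA F f = Ide D (FO F a)" "FA F f \<cdot>\<^bsub>D\<^esub> FA F g = Ide D (FO F b)"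
      using functor_comp[OF F] functor_Ide[OF F] category_Obj[OF C f(1)] f g by metis+
  qed
qed

lemma equivalence_reflects_iso:
  assumes eq: "is_equivalence C D F" and C: "category C" and D: "category D"
    and f: "f \<in> Hom C a b" and iso: "is_iso D (FA F f)"
  shows "is_iso C f"
proof -
  obtain G \<sigma> where F: "is_functor C D F" and G: "is_functor D C G"
    and \<sigma>: "nat_iso C C id_funct (comp_funct G F) \<sigma>"
    using eq unfolding is_equivalence_def by blast
  have ab: "a \<in> Obj C" "b \<in> Obj C" using category_Obj[OF C f] by auto
  define h where "h = FA G (FA F f)"
  have h: "h \<in> Hom C (FO G (FO F a)) (FO G (FO F b))"
    unfolding h_def using functor_Hom[OF G functor_Hom[OF F f]] .
  have h_iso: "is_iso C h"
    unfolding h_def using functor_iso[OF G D functor_Hom[OF F f] iso] .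
  have \<sigma>a: "\<sigma> a \<in> Hom C a (FO G (FO F a))" "is_iso C (\<sigma> a)"
    and \<sigma>b: "\<sigma> b \<in> Hom C b (FO G (FO F b))" "is_iso C (\<sigma> b)"
    and nat: "h \<cdot>\<^bsub>C\<^esub> \<sigma> a = \<sigma> b \<cdot>\<^bsub>C\<^esub> f"
    using \<sigma> ab HomD[OF f]
    by (auto simp: nat_iso_def nat_trans_def id_funct_def comp_funct_def h_def)
  obtain t where t: "t \<in> Hom C (FO G (FO F b)) b" "t \<cdot>\<^bsub>C\<^esub> \<sigma> b = Ide C b" "\<sigma> b \<cdot>\<^bsub>C\<^esub> t = Ide C (FO G (FO F b))"
    using is_isoE[OF \<sigma>b(2,1)] .
  have "is_iso C t" using is_isoI[OF t(1) \<sigma>b(1) t(3,2)] .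
  moreover have "is_iso C (h \<cdot>\<^bsub>C\<^esub> \<sigma> a)"
    using is_iso_comp[OF C \<sigma>a h h_iso] .
  ultimately have "is_iso C (t \<cdot>\<^bsub>C\<^esub> (h \<cdot>\<^bsub>C\<^esub> \<sigma> a))"
    using is_iso_comp[OF C category_comp[OF C \<sigma>a(1) h] _ t(1)] by blast
  moreover have "t \<cdot>\<^bsub>C\<^esub> (h \<cdot>\<^bsub>C\<^esub> \<sigma> a) = f"
    unfolding nat by (rule category_cancel[OF C f \<sigma>b(1) t(1,2)])
  ultimately show ?thesis by simp
qed

lemma EM_Hom:
  "t \<in> Hom (EM_cat C T \<eta> \<mu>) X Y \<longleftrightarrow>
     X \<in> Obj (EM_cat C T \<eta> \<mu>) \<and> Y \<in> Obj (EM_cat C T \<eta> \<mu>) \<and>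
     (\<exists>h. t = (X, h, Y) \<and> h \<in> Hom C (fst X) (fst Y) \<and> h \<cdot>\<^bsub>C\<^esub> snd X = snd Y \<cdot>\<^bsub>C\<^esub> FA T h)"
  by (auto simp: EM_cat_def Hom_iff Let_def)

lemma EM_Obj:
  "X \<in> Obj (EM_cat C T \<eta> \<mu>) \<longleftrightarrow> fst X \<in> Obj C \<and> snd X \<in> Hom C (FO T (fst X)) (fst X) \<and>
     snd X \<cdot>\<^bsub>C\<^esub> \<eta> (fst X) = Ide C (fst X) \<and> snd X \<cdot>\<^bsub>C\<^esub> \<mu> (fst X) = snd X \<cdot>\<^bsub>C\<^esub> FA T (snd X)"
  by (auto simp: EM_cat_def Let_def)

lemma EM_Ide: "Ide (EM_cat C T \<eta> \<mu>) X = (X, Ide C (fst X), X)"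
  by (simp add: EM_cat_def Let_def)

lemma EM_Comp: "(Y', k, Z) \<cdot>\<^bsub>EM_cat C T \<eta> \<mu>\<^esub> (X, h, Y) = (X, k \<cdot>\<^bsub>C\<^esub> h, Z)"
  by (simp add: EM_cat_def Let_def)

lemma category_EM:
  assumes C: "category C" and T: "is_functor C C T"
  shows "category (EM_cat C T \<eta> \<mu>)" (is "category ?E")
proof -
  note cat = category_comp[OF C] category_assoc[OF C] category_Ide_left[OF C] category_Ide_right[OF C]
  have comp: "g \<cdot>\<^bsub>?E\<^esub> f \<in> Hom ?E X Z" if f: "f \<in> Hom ?E X Y" and g: "g \<in> Hom ?E Y Z" for f g X Y Z
  proof -
    from f obtain h where h: "f = (X, h, Y)" "h \<in> Hom C (fst X) (fst Y)"
      "h \<cdot>\<^bsub>C\<^esub> snd X = snd Y \<cdot>\<^bsub>C\<^esub> FA T h" unfolding EM_Hom by auto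
    from g obtain k where k: "g = (Y, k, Z)" "k \<in> Hom C (fst Y) (fst Z)"
      "k \<cdot>\<^bsub>C\<^esub> snd Y = snd Z \<cdot>\<^bsub>C\<^esub> FA T k" unfolding EM_Hom by auto
    have X: "snd X \<in> Hom C (FO T (fst X)) (fst X)" "snd Y \<in> Hom C (FO T (fst Y)) (fst Y)"
      "snd Z \<in> Hom C (FO T (fst Z)) (fst Z)" using f g unfolding EM_Hom EM_Obj by auto
    have Th: "FA T h \<in> Hom C (FO T (fst X)) (FO T (fst Y))"
      "FA T k \<in> Hom C (FO T (fst Y)) (FO T (fst Z))" using functor_Hom[OF T] h k by auto
    have "(k \<cdot>\<^bsub>C\<^esub> h) \<cdot>\<^bsub>C\<^esub> snd X = k \<cdot>\<^bsub>C\<^esub> (snd Y \<cdot>\<^bsub>C\<^esub> FA T h)"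
      using cat(2)[OF X(1) h(2) k(2)] h(3) by simp
    also have "\<dots> = (snd Z \<cdot>\<^bsub>C\<^esub> FA T k) \<cdot>\<^bsub>C\<^esub> FA T h"
      using cat(2)[OF Th(1) X(2) k(2)] k(3) by simp
    also have "\<dots> = snd Z \<cdot>\<^bsub>C\<^esub> FA T (k \<cdot>\<^bsub>C\<^esub> h)"
      using cat(2)[OF Th(1,2) X(3)] functor_comp[OF T h(2) k(2)] by simp
    finally show ?thesis
      using f g h k cat(1) unfolding EM_Hom by (auto simp: EM_Comp)
  qed
  have ide: "Ide ?E X \<in> Hom ?E X X" if X: "X \<in> Obj ?E" for X
    using X category_Ide[OF C] functor_Ide[OF T] cat(3,4) unfolding EM_Hom EM_Ide
    by (auto simp: EM_Obj)
  show ?thesis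
    unfolding category_def
  proof (intro conjI ballI impI)
    fix f assume f: "f \<in> Arr ?E"
    then have f': "f \<in> Hom ?E (Dom ?E f) (Cod ?E f)" by (rule Arr_Hom)
    then show "Dom ?E f \<in> Obj ?E" "Cod ?E f \<in> Obj ?E" unfolding EM_Hom by auto
    from f' show "f \<cdot>\<^bsub>?E\<^esub> Ide ?E (Dom ?E f) = f" "Ide ?E (Cod ?E f) \<cdot>\<^bsub>?E\<^esub> f = f"
      unfolding EM_Hom using cat(3,4) by (metis EM_Ide EM_Comp)+
  next
    fix f g assume "f \<in> Arr ?E" "g \<in> Arr ?E" "Cod ?E f = Dom ?E g"
    then show "g \<cdot>\<^bsub>?E\<^esub> f \<in> Hom ?E (Dom ?E f) (Cod ?E g)" using comp Arr_Hom by metis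
  next
    fix f g h assume "f \<in> Arr ?E" "g \<in> Arr ?E" "h \<in> Arr ?E" "Cod ?E f = Dom ?E g" "Cod ?E g = Dom ?E h"
    then have "f \<in> Hom ?E (Dom ?E f) (Dom ?E g)" "g \<in> Hom ?E (Dom ?E g) (Dom ?E h)"
      "h \<in> Hom ?E (Dom ?E h) (Cod ?E h)" using Arr_Hom by metis+
    then obtain X Y Z W k l m where "f = (X, k, Y)" "g = (Y, l, Z)" "h = (Z, m, W)"
      and k: "k \<in> Hom C (fst X) (fst Y)" "l \<in> Hom C (fst Y) (fst Z)" "m \<in> Hom C (fst Z) (fst W)"
      unfolding EM_Hom by blast
    then show "h \<cdot>\<^bsub>?E\<^esub> (g \<cdot>\<^bsub>?E\<^esub> f) = (h \<cdot>\<^bsub>?E\<^esub> g) \<cdot>\<^bsub>?E\<^esub> f"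
      using cat(2)[OF k] by (simp add: EM_Comp)
  qed (rule ide)
qed

text \<open>An algebra homomorphism that is invertible in the base category is invertible as an algebra
  homomorphism, and the comparison functor, being an equivalence, reflects isomorphisms.\<close>

lemma monadic_reflects_iso:
  assumes mon: "monadic C D U" and C: "category C" and D: "category D"
    and f: "f \<in> Hom D a b" and iso: "is_iso C (FA U f)"
  shows "is_iso D f"
proof -
  obtain L \<eta> \<epsilon> where adj: "is_adjunction C D L U \<eta> \<epsilon>"
    and eq: "is_equivalence D (EM_cat C (comp_funct U L) \<eta> (\<lambda>a. FA U (\<epsilon> (FO L a)))) (EM_comparison D U \<epsilon>)"
    using mon unfolding monadic_def by blast
  define T where "T = comp_funct U L"
  define E where "E = EM_cat C T \<eta> (\<lambda>a. FA U (\<epsilon> (FO L a)))"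
  define K where "K = EM_comparison D U \<epsilon>"
  note cat = category_comp[OF C] category_assoc[OF C] category_Ide_left[OF C] category_Ide_right[OF C]
  have U: "is_functor D C U" and L: "is_functor C D L" using adj by (auto simp: is_adjunction_def)
  have T: "is_functor C C T"
    unfolding T_def by (rule functor_compose[OF L U])
  have E: "category E" unfolding E_def by (rule category_EM[OF C T])
  have eq: "is_equivalence D E K" using eq by (simp add: E_def K_def T_def)
  then have K: "is_functor D E K" by (simp add: is_equivalence_def)
  define h where "h = FA U f"
  define x where "x = snd (FO K a)"
  define y where "y = snd (FO K b)"
  have fstK: "fst (FO K c) = FO U c" for c by (simp add: K_def EM_comparison_def Let_def)
  have Kf: "FA K f = (FO K a, h, FO K b)"
    using HomD[OF f] by (simp add: K_def EM_comparison_def Let_def h_def)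
  have KfE: "(FO K a, h, FO K b) \<in> Hom E (FO K a) (FO K b)" using functor_Hom[OF K f] Kf by simp
  then have h: "h \<in> Hom C (FO U a) (FO U b)" "h \<cdot>\<^bsub>C\<^esub> x = y \<cdot>\<^bsub>C\<^esub> FA T h"
    and x: "x \<in> Hom C (FO T (FO U a)) (FO U a)" and y: "y \<in> Hom C (FO T (FO U b)) (FO U b)"
    and Kab: "FO K a \<in> Obj E" "FO K b \<in> Obj E"
    unfolding E_def EM_Hom EM_Obj x_def y_def by (simp_all add: fstK)
  obtain k where k: "k \<in> Hom C (FO U b) (FO U a)" "k \<cdot>\<^bsub>C\<^esub> h = Ide C (FO U a)" "h \<cdot>\<^bsub>C\<^esub> k = Ide C (FO U b)"
    using is_isoE[OF iso[folded h_def] h(1)] .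
  have Tk: "FA T k \<in> Hom C (FO T (FO U b)) (FO T (FO U a))"
    and Th: "FA T h \<in> Hom C (FO T (FO U a)) (FO T (FO U b))" using functor_Hom[OF T] h k by auto
  have Thk: "FA T h \<cdot>\<^bsub>C\<^esub> FA T k = Ide C (FO T (FO U b))"
    using functor_comp[OF T k(1) h(1)] k(3) functor_Ide[OF T] category_Obj[OF C h(1)] by simp
  have "x \<cdot>\<^bsub>C\<^esub> FA T k = ((k \<cdot>\<^bsub>C\<^esub> h) \<cdot>\<^bsub>C\<^esub> x) \<cdot>\<^bsub>C\<^esub> FA T k"
    using cat(3)[OF x] k(2) by simp
  also have "\<dots> = (k \<cdot>\<^bsub>C\<^esub> (y \<cdot>\<^bsub>C\<^esub> FA T h)) \<cdot>\<^bsub>C\<^esub> FA T k"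
    using cat(2)[OF x h(1) k(1)] h(2) by simp
  also have "\<dots> = k \<cdot>\<^bsub>C\<^esub> (y \<cdot>\<^bsub>C\<^esub> (FA T h \<cdot>\<^bsub>C\<^esub> FA T k))"
    using cat(2)[OF Tk cat(1)[OF Th y] k(1)] cat(2)[OF Tk Th y] by simp
  also have "\<dots> = k \<cdot>\<^bsub>C\<^esub> y" using Thk cat(4)[OF y] by simp
  finally have kalg: "(FO K b, k, FO K a) \<in> Hom E (FO K b) (FO K a)"
    using k(1) Kab unfolding E_def EM_Hom by (simp add: fstK x_def y_def)
  have "is_iso E (FA K f)"
    unfolding Kf
    by (rule is_isoI[OF KfE kalg]) (simp_all add: E_def EM_Comp EM_Ide fstK k)
  then show ?thesis using equivalence_reflects_iso[OF eq D E f] by blast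
qed

text \<open>When \<open>p = n k\<close> with \<open>n\<close> monic, the pair \<open>(k, 1)\<close> is a pullback of \<open>(n, p)\<close>, so the chosen pullback
  of \<open>n\<close> along \<open>p\<close> is isomorphic to an identity.\<close>

lemma pullback_mono_iso:
  assumes C: "category C" and n: "n \<in> Hom C a b"
    and mono: "\<And>z u v. u \<in> Hom C z a \<Longrightarrow> v \<in> Hom C z a \<Longrightarrow> n \<cdot>\<^bsub>C\<^esub> u = n \<cdot>\<^bsub>C\<^esub> v \<Longrightarrow> u = v"
    and k: "k \<in> Hom C x a" and p: "p \<in> Hom C x b" "n \<cdot>\<^bsub>C\<^esub> k = p"
  shows "is_pullback C n p (pb1 C n p) (pb2 C n p)" and "is_iso C (pb2 C n p)"
proof -
  note cat = category_comp[OF C] category_assoc[OF C] category_Ide_left[OF C] category_Ide_right[OF C]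
  have idx: "Ide C x \<in> Hom C x x" using category_Ide[OF C] category_Obj[OF C k] by simp
  have "is_pullback C n p k (Ide C x)"
  proof (rule is_pullbackI[OF n p(1) k idx])
    show "n \<cdot>\<^bsub>C\<^esub> k = p \<cdot>\<^bsub>C\<^esub> Ide C x" using p(2) cat(4)[OF p(1)] by simp
    fix z u v assume u: "u \<in> Hom C z a" and v: "v \<in> Hom C z x" and eq: "n \<cdot>\<^bsub>C\<^esub> u = p \<cdot>\<^bsub>C\<^esub> v"
    have "n \<cdot>\<^bsub>C\<^esub> (k \<cdot>\<^bsub>C\<^esub> v) = n \<cdot>\<^bsub>C\<^esub> u" using cat(2)[OF v k n] eq p(2) by simp
    then have kv: "k \<cdot>\<^bsub>C\<^esub> v = u" by (rule mono[OF cat(1)[OF v k] u])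
    show "\<exists>!w. w \<in> Hom C z x \<and> k \<cdot>\<^bsub>C\<^esub> w = u \<and> Ide C x \<cdot>\<^bsub>C\<^esub> w = v"
    proof (rule ex1I[of _ v])
      show "v \<in> Hom C z x \<and> k \<cdot>\<^bsub>C\<^esub> v = u \<and> Ide C x \<cdot>\<^bsub>C\<^esub> v = v"
        using v kv cat(3)[OF v] by (intro conjI)
      fix w assume w: "w \<in> Hom C z x \<and> k \<cdot>\<^bsub>C\<^esub> w = u \<and> Ide C x \<cdot>\<^bsub>C\<^esub> w = v"
      then have "w \<in> Hom C z x" by (rule conjunct1)
      from cat(3)[OF this] w show "w = v" by simp
    qed
  qed
  then show pb: "is_pullback C n p (pb1 C n p) (pb2 C n p)" by (rule pb_is_pullback)
  define P where "P = Dom C (pb1 C n p)"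
  define q where "q = pb1 C n p"
  define r where "r = pb2 C n p"
  have q: "q \<in> Hom C P a" and r: "r \<in> Hom C P x" and sq: "n \<cdot>\<^bsub>C\<^esub> q = p \<cdot>\<^bsub>C\<^esub> r"
    using pb HomD[OF n] HomD[OF p(1)] by (auto simp: is_pullback_def Hom_iff P_def q_def r_def)
  obtain s where s: "s \<in> Hom C x P" "q \<cdot>\<^bsub>C\<^esub> s = k" "r \<cdot>\<^bsub>C\<^esub> s = Ide C x"
    using pullback_lift[OF pb, of k x "Ide C x"] k idx HomD[OF n] HomD[OF p(1)] p(2) cat(4)[OF p(1)]
    unfolding P_def q_def r_def by auto
  have "s \<cdot>\<^bsub>C\<^esub> r = Ide C P"
  proof (rule pullback_ext[OF C pb])
    have "n \<cdot>\<^bsub>C\<^esub> (k \<cdot>\<^bsub>C\<^esub> r) = n \<cdot>\<^bsub>C\<^esub> q" using cat(2)[OF r k n] p(2) sq by simp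
    then have kr: "k \<cdot>\<^bsub>C\<^esub> r = q" by (rule mono[OF cat(1)[OF r k] q])
    have idP: "Ide C P \<in> Hom C P P" using category_Ide[OF C] category_Obj[OF C r] by simp
    show "s \<cdot>\<^bsub>C\<^esub> r \<in> Hom C P (Dom C (pb1 C n p))" "Ide C P \<in> Hom C P (Dom C (pb1 C n p))"
      using cat(1)[OF r s(1)] idP by (simp_all add: P_def)
    show "pb1 C n p \<cdot>\<^bsub>C\<^esub> (s \<cdot>\<^bsub>C\<^esub> r) = pb1 C n p \<cdot>\<^bsub>C\<^esub> Ide C P"
      using cat(2)[OF r s(1) q] s(2) kr cat(4)[OF q] by (simp add: q_def)
    show "pb2 C n p \<cdot>\<^bsub>C\<^esub> (s \<cdot>\<^bsub>C\<^esub> r) = pb2 C n p \<cdot>\<^bsub>C\<^esub> Ide C P"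
      using cat(2)[OF r s(1) r] s(3) cat(3)[OF r] cat(4)[OF r] by (simp add: r_def)
  qed
  then show "is_iso C (pb2 C n p)"
    using is_isoI[OF r s(1) _ s(3)] by (simp add: r_def)
qed

text \<open>An effective descent morphism is an extremal epimorphism: if \<open>p\<close> factors through a monomorphism
  \<open>n\<close>, then \<open>p\<^sup>*\<close> sends \<open>n\<close>, seen as an arrow of the slice from \<open>n\<close> to the identity, to an isomorphism,
  and the monadic functor \<open>p\<^sup>*\<close> reflects it.\<close>

theorem effective_descent_extremal:
  assumes C: "category C" and p: "effective_descent C p" "p \<in> Hom C x b"
    and n: "n \<in> Hom C a b"
    and mono: "\<And>z u v. u \<in> Hom C z a \<Longrightarrow> v \<in> Hom C z a \<Longrightarrow> n \<cdot>\<^bsub>C\<^esub> u = n \<cdot>\<^bsub>C\<^esub> v \<Longrightarrow> u = v"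
    and k: "k \<in> Hom C x a" "n \<cdot>\<^bsub>C\<^esub> k = p"
  shows "is_iso C n"
proof -
  note cat = category_comp[OF C] category_assoc[OF C] category_Ide_left[OF C] category_Ide_right[OF C]
  have idb: "Ide C b \<in> Hom C b b" using category_Ide[OF C] category_Obj[OF C n] by simp
  define i where "i = Ide C b"
  have i: "i \<in> Hom C b b" using idb by (simp add: i_def)
  have mono_i: "u = v" if "u \<in> Hom C z b" "v \<in> Hom C z b" "i \<cdot>\<^bsub>C\<^esub> u = i \<cdot>\<^bsub>C\<^esub> v" for z u v
    using that cat(3) by (metis i_def)
  note N = pullback_mono_iso[OF C n mono k(1) p(2) k(2)]
  have ip: "i \<cdot>\<^bsub>C\<^esub> p = p" using cat(3)[OF p(2)] by (simp add: i_def)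
  have I: "is_pullback C i p (pb1 C i p) (pb2 C i p)" "is_iso C (pb2 C i p)"
    by (rule pullback_mono_iso[OF C i _ p(2) p(2) ip], erule (2) mono_i)+
  define P where "P = Dom C (pb1 C n p)"
  define Q where "Q = Dom C (pb1 C i p)"
  have n1: "pb1 C n p \<in> Hom C P a" and n2: "pb2 C n p \<in> Hom C P x"
    and nsq: "n \<cdot>\<^bsub>C\<^esub> pb1 C n p = p \<cdot>\<^bsub>C\<^esub> pb2 C n p"
    using N(1) HomD[OF n] HomD[OF p(2)] by (auto simp: is_pullback_def Hom_iff P_def)
  have i1: "pb1 C i p \<in> Hom C Q b" and i2: "pb2 C i p \<in> Hom C Q x"
    using I(1) HomD[OF i] HomD[OF p(2)] by (auto simp: is_pullback_def Hom_iff Q_def)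
  define t where "t = tup C i p (n \<cdot>\<^bsub>C\<^esub> pb1 C n p) (pb2 C n p)"
  have t: "t \<in> Hom C P Q" "pb2 C i p \<cdot>\<^bsub>C\<^esub> t = pb2 C n p"
    using tup[OF I(1), of "n \<cdot>\<^bsub>C\<^esub> pb1 C n p" P "pb2 C n p"] cat(1)[OF n1 n] n2 HomD[OF i]
      HomD[OF p(2)] cat(3)[OF cat(1)[OF n1 n]] nsq
    unfolding t_def Q_def by (auto simp: i_def)
  let ?f = "(n, n, i)"
  have f: "?f \<in> Hom (slice C b) n i"
    unfolding slice_Hom using n i HomD[OF n] HomD[OF i] cat(3)[OF n] by (auto simp: i_def)
  have "FA (pullback_functor C p) ?f = (pb2 C n p, t, pb2 C i p)"
    by (simp add: pullback_functor_def t_def)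
  moreover have "is_iso (slice C x) (pb2 C n p, t, pb2 C i p)"
    by (rule slice_iso[OF C _ N(2) I(2)])
      (use n2 i2 t HomD[OF n2] HomD[OF i2] in \<open>auto simp: slice_Hom\<close>)
  moreover have "monadic (slice C x) (slice C b) (pullback_functor C p)"
    using p(1) HomD[OF p(2)] by (simp add: effective_descent_def)
  ultimately have "is_iso (slice C b) ?f"
    using monadic_reflects_iso category_slice[OF C] f by metis
  then obtain s where s: "s \<in> Hom (slice C b) i n" "s \<cdot>\<^bsub>slice C b\<^esub> ?f = Ide (slice C b) n"
    "?f \<cdot>\<^bsub>slice C b\<^esub> s = Ide (slice C b) i"
    using is_isoE[OF _ f] by blast
  then obtain h where "s = (i, h, n)" "h \<in> Hom C b a"
    unfolding slice_Hom using HomD[OF n] HomD[OF i] by auto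
  with s n show ?thesis
    using HomD[OF n] HomD[OF i] by (intro is_isoI[of n C a b h]) (auto simp: slice_def i_def)
qed

section \<open>Abelian groups\<close>

definition app :: "'u ab_arr \<Rightarrow> 'u \<Rightarrow> 'u" (infixl "\<bullet>" 90) where
  "f \<bullet> x = fst (snd f) x"

definition ab_arr :: "'u monoid \<Rightarrow> 'u monoid \<Rightarrow> ('u \<Rightarrow> 'u) \<Rightarrow> 'u ab_arr" where
  "ab_arr G H \<phi> = (G, restrict \<phi> (carrier G), H)"

lemma Ab_Hom:
  "f \<in> Hom Ab G H \<longleftrightarrow> comm_group G \<and> comm_group H \<and>
     (\<exists>\<phi>. f = (G, \<phi>, H) \<and> \<phi> \<in> hom G H \<and> \<phi> \<in> extensional (carrier G))"
  by (auto simp: Ab_def Hom_iff)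

lemma Ab_Obj [simp]: "G \<in> Obj Ab \<longleftrightarrow> comm_group G"
  by (simp add: Ab_def)

lemma Ab_Hom_group: "f \<in> Hom Ab G H \<Longrightarrow> comm_group G \<and> comm_group H"
  by (simp add: Ab_Hom)

lemma ab_arr_Hom:
  assumes "comm_group G" "comm_group H" "\<And>x. x \<in> carrier G \<Longrightarrow> \<phi> x \<in> carrier H"
    and "\<And>x y. x \<in> carrier G \<Longrightarrow> y \<in> carrier G \<Longrightarrow> \<phi> (x \<otimes>\<^bsub>G\<^esub> y) = \<phi> x \<otimes>\<^bsub>H\<^esub> \<phi> y"
  shows "ab_arr G H \<phi> \<in> Hom Ab G H"
proof -
  interpret G: comm_group G by fact
  show ?thesis using assms by (auto simp: Ab_Hom ab_arr_def hom_def)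
qed

lemma ab_arr_app [simp]: "x \<in> carrier G \<Longrightarrow> ab_arr G H \<phi> \<bullet> x = \<phi> x"
  by (simp add: app_def ab_arr_def)

lemma Ab_ext:
  assumes "f \<in> Hom Ab G H" "g \<in> Hom Ab G H" "\<And>x. x \<in> carrier G \<Longrightarrow> f \<bullet> x = g \<bullet> x"
  shows "f = g"
  using assms by (auto simp: Ab_Hom app_def intro: extensionalityI)

lemma Ab_closed: "f \<in> Hom Ab G H \<Longrightarrow> x \<in> carrier G \<Longrightarrow> f \<bullet> x \<in> carrier H"
  by (auto simp: Ab_Hom app_def hom_def)

lemma Ab_mult:
  "f \<in> Hom Ab G H \<Longrightarrow> x \<in> carrier G \<Longrightarrow> y \<in> carrier G \<Longrightarrow> f \<bullet> (x \<otimes>\<^bsub>G\<^esub> y) = f \<bullet> x \<otimes>\<^bsub>H\<^esub> f \<bullet> y"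
  by (auto simp: Ab_Hom app_def hom_def)

lemma Ab_group_hom: "f \<in> Hom Ab G H \<Longrightarrow> group_hom G H (\<lambda>x. f \<bullet> x)"
  by (auto simp: Ab_Hom app_def group_hom_def group_hom_axioms_def comm_group_def)

lemma Ab_one: "f \<in> Hom Ab G H \<Longrightarrow> f \<bullet> \<one>\<^bsub>G\<^esub> = \<one>\<^bsub>H\<^esub>"
  using group_hom.hom_one[OF Ab_group_hom] .

lemma Ab_inv: "f \<in> Hom Ab G H \<Longrightarrow> x \<in> carrier G \<Longrightarrow> f \<bullet> (inv\<^bsub>G\<^esub> x) = inv\<^bsub>H\<^esub> (f \<bullet> x)"
  using group_hom.hom_inv[OF Ab_group_hom] .

lemma Ab_comp_app: "f \<in> Hom Ab G H \<Longrightarrow> x \<in> carrier G \<Longrightarrow> (g \<cdot>\<^bsub>Ab\<^esub> f) \<bullet> x = g \<bullet> (f \<bullet> x)"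
  by (cases g; cases f) (simp add: Hom_def app_def Ab_def compose_def)

lemma Ab_Ide_app [simp]: "x \<in> carrier G \<Longrightarrow> Ide Ab G \<bullet> x = x"
  by (simp add: app_def Ab_def)

lemma Ab_comp: "f \<in> Hom Ab G H \<Longrightarrow> g \<in> Hom Ab H K \<Longrightarrow> g \<cdot>\<^bsub>Ab\<^esub> f \<in> Hom Ab G K"
  unfolding Ab_Hom by (auto simp: Ab_def compose_def hom_def Pi_iff comm_group_def group_def monoid.m_closed)

lemma Ab_Ide: "comm_group G \<Longrightarrow> Ide Ab G \<in> Hom Ab G G"
  unfolding Ab_Hom by (auto simp: Ab_def hom_def comm_group_def group_def monoid.m_closed)

lemma category_Ab: "category Ab"
  unfolding category_def
proof (intro conjI ballI impI)
  fix f :: "'a ab_arr" assume f: "f \<in> Arr Ab"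
  have f': "f \<in> Hom Ab (Dom Ab f) (Cod Ab f)" using f by (rule Arr_Hom)
  then show "Dom Ab f \<in> Obj Ab" "Cod Ab f \<in> Obj Ab" using Ab_Hom_group[OF f'] by simp_all
  have i: "Ide Ab (Dom Ab f) \<in> Hom Ab (Dom Ab f) (Dom Ab f)"
    "Ide Ab (Cod Ab f) \<in> Hom Ab (Cod Ab f) (Cod Ab f)" using Ab_Ide Ab_Hom_group[OF f'] by auto
  show "f \<cdot>\<^bsub>Ab\<^esub> Ide Ab (Dom Ab f) = f"
    by (rule Ab_ext[OF Ab_comp[OF i(1) f'] f']) (simp add: Ab_comp_app[OF i(1)])
  show "Ide Ab (Cod Ab f) \<cdot>\<^bsub>Ab\<^esub> f = f"
    by (rule Ab_ext[OF Ab_comp[OF f' i(2)] f']) (simp add: Ab_comp_app[OF f'] Ab_closed[OF f'])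
next
  fix f g h :: "'a ab_arr"
  assume "f \<in> Arr Ab" "g \<in> Arr Ab" "h \<in> Arr Ab" "Cod Ab f = Dom Ab g" "Cod Ab g = Dom Ab h"
  then have f: "f \<in> Hom Ab (Dom Ab f) (Dom Ab g)" and g: "g \<in> Hom Ab (Dom Ab g) (Dom Ab h)"
    and h: "h \<in> Hom Ab (Dom Ab h) (Cod Ab h)" by (simp_all add: Hom_iff)
  show "h \<cdot>\<^bsub>Ab\<^esub> (g \<cdot>\<^bsub>Ab\<^esub> f) = (h \<cdot>\<^bsub>Ab\<^esub> g) \<cdot>\<^bsub>Ab\<^esub> f"
    by (rule Ab_ext[OF Ab_comp[OF Ab_comp[OF f g] h] Ab_comp[OF f Ab_comp[OF g h]]])
      (simp add: Ab_comp_app[OF f] Ab_comp_app[OF g] Ab_comp_app[OF Ab_comp[OF f g]] Ab_closed[OF f])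
next
  fix f g :: "'a ab_arr"
  assume "f \<in> Arr Ab" "g \<in> Arr Ab" "Cod Ab f = Dom Ab g"
  then show "g \<cdot>\<^bsub>Ab\<^esub> f \<in> Hom Ab (Dom Ab f) (Cod Ab g)"
    by (intro Ab_comp[of _ _ "Dom Ab g"]) (simp_all add: Hom_iff)
qed (simp add: Ab_Ide)

lemma Ab_eqD:
  assumes "f \<cdot>\<^bsub>Ab\<^esub> p = g \<cdot>\<^bsub>Ab\<^esub> q" "p \<in> Hom Ab Z G" "q \<in> Hom Ab Z H" "x \<in> carrier Z"
  shows "f \<bullet> (p \<bullet> x) = g \<bullet> (q \<bullet> x)"
  using assms Ab_comp_app by metis

lemma Ab_eqI:
  assumes "p \<in> Hom Ab Z G" "q \<in> Hom Ab Z H" "f \<in> Hom Ab G K" "g \<in> Hom Ab H K"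
    and "\<And>x. x \<in> carrier Z \<Longrightarrow> f \<bullet> (p \<bullet> x) = g \<bullet> (q \<bullet> x)"
  shows "f \<cdot>\<^bsub>Ab\<^esub> p = g \<cdot>\<^bsub>Ab\<^esub> q"
  using Ab_ext[OF Ab_comp[OF assms(1,3)] Ab_comp[OF assms(2,4)]] assms(5)
    Ab_comp_app[OF assms(1)] Ab_comp_app[OF assms(2)] by simp

lemma Ab_eqI1:
  assumes "p \<in> Hom Ab Z G" "f \<in> Hom Ab G K" "h \<in> Hom Ab Z K"
    and "\<And>x. x \<in> carrier Z \<Longrightarrow> f \<bullet> (p \<bullet> x) = h \<bullet> x"
  shows "f \<cdot>\<^bsub>Ab\<^esub> p = h"
  using Ab_ext[OF Ab_comp[OF assms(1,2)] assms(3)] assms(4) Ab_comp_app[OF assms(1)] by simp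

lemma Ab_eqD1:
  assumes "f \<cdot>\<^bsub>Ab\<^esub> p = h" "p \<in> Hom Ab Z G" "x \<in> carrier Z"
  shows "f \<bullet> (p \<bullet> x) = h \<bullet> x"
  using Ab_comp_app[OF assms(2,3), of f] assms(1) by simp

subsection \<open>Subgroups, quotients and pullbacks\<close>

definition ab_triv :: "'u monoid \<Rightarrow> 'u monoid \<Rightarrow> 'u ab_arr" where
  "ab_triv G H = ab_arr G H (\<lambda>_. \<one>\<^bsub>H\<^esub>)"

lemma ab_triv_Hom: "comm_group G \<Longrightarrow> comm_group H \<Longrightarrow> ab_triv G H \<in> Hom Ab G H"
  unfolding ab_triv_def by (rule ab_arr_Hom) (auto simp: comm_group_def group_def monoid.l_one)

lemma ab_triv_app [simp]: "x \<in> carrier G \<Longrightarrow> ab_triv G H \<bullet> x = \<one>\<^bsub>H\<^esub>"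
  by (simp add: ab_triv_def)

lemma subgroup_comm_group: "comm_group G \<Longrightarrow> subgroup S G \<Longrightarrow> comm_group (G\<lparr>carrier := S\<rparr>)"
  by (rule group.group_comm_groupI)
    (auto simp: subgroup.subgroup_is_group comm_group_def comm_monoid.m_comm subgroup.mem_carrier)

definition ab_incl :: "'u monoid \<Rightarrow> 'u set \<Rightarrow> 'u ab_arr" where
  "ab_incl G S = ab_arr (G\<lparr>carrier := S\<rparr>) G (\<lambda>x. x)"

lemma ab_incl_Hom: "comm_group G \<Longrightarrow> subgroup S G \<Longrightarrow> ab_incl G S \<in> Hom Ab (G\<lparr>carrier := S\<rparr>) G"
  unfolding ab_incl_def
  by (rule ab_arr_Hom) (auto simp: subgroup_comm_group subgroup.mem_carrier)

lemma ab_incl_app [simp]: "x \<in> S \<Longrightarrow> ab_incl G S \<bullet> x = x"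
  by (simp add: ab_incl_def)

lemma ab_factor_incl:
  assumes h: "h \<in> Hom Ab Z G" and S: "subgroup S G" and im: "\<And>z. z \<in> carrier Z \<Longrightarrow> h \<bullet> z \<in> S"
  shows "\<exists>k \<in> Hom Ab Z (G\<lparr>carrier := S\<rparr>). \<forall>z \<in> carrier Z. k \<bullet> z = h \<bullet> z"
proof
  have G: "comm_group G" "comm_group Z" using Ab_Hom_group[OF h] by auto
  show "ab_arr Z (G\<lparr>carrier := S\<rparr>) (\<lambda>z. h \<bullet> z) \<in> Hom Ab Z (G\<lparr>carrier := S\<rparr>)"
    by (rule ab_arr_Hom) (auto simp: G subgroup_comm_group S im Ab_mult[OF h])
qed simp

lemma image_subgroup:
  assumes f: "f \<in> Hom Ab G H"
  shows "subgroup ((\<lambda>x. f \<bullet> x) ` carrier G) H"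
  using group_hom.img_is_subgroup[OF Ab_group_hom[OF f]] .

text \<open>The cosets of \<open>N\<close> do not lie in \<open>'u\<close>, so the quotient is transported to chosen representatives.\<close>

lemma Ab_quotient:
  assumes G: "comm_group G" and N: "subgroup N G"
  shows "\<exists>Q. \<exists>q \<in> Hom Ab G Q. (\<forall>y \<in> carrier Q. \<exists>x \<in> carrier G. q \<bullet> x = y) \<and>
    (\<forall>x \<in> carrier G. q \<bullet> x = \<one>\<^bsub>Q\<^esub> \<longleftrightarrow> x \<in> N)"
proof -
  interpret G: comm_group G by fact
  interpret N: subgroup N G by fact
  have nN: "N \<lhd> G" using G.subgroup_imp_normal[OF N] .
  define \<phi> where "\<phi> x = (SOME y. y \<in> N #>\<^bsub>G\<^esub> x)" for x
  have \<phi>: "\<phi> x \<in> N #>\<^bsub>G\<^esub> x" if "x \<in> carrier G" for x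
    unfolding \<phi>_def using G.rcos_self[OF that N] by (rule someI)
  have "weak_group_morphism \<phi> N G"
  proof (rule weak_group_morphismsI[OF nN])
    fix a b assume ab: "a \<in> carrier G" "b \<in> carrier G"
    have "N #>\<^bsub>G\<^esub> a = N #>\<^bsub>G\<^esub> b \<longleftrightarrow> a \<otimes>\<^bsub>G\<^esub> inv\<^bsub>G\<^esub> b \<in> N"
      using ab G.rcos_self[OF ab(1) N] G.repr_independence[OF _ ab(2) N]
        N.rcos_module[OF G.group_axioms ab(2,1)] by metis
    moreover have "\<phi> a = \<phi> b \<longleftrightarrow> N #>\<^bsub>G\<^esub> a = N #>\<^bsub>G\<^esub> b"
    proof
      assume "\<phi> a = \<phi> b"
      then show "N #>\<^bsub>G\<^esub> a = N #>\<^bsub>G\<^esub> b"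
        using \<phi>[OF ab(1)] \<phi>[OF ab(2)] G.repr_independence[OF _ _ N] ab by metis
    qed (simp add: \<phi>_def)
    ultimately show "\<phi> a = \<phi> b \<longleftrightarrow> a \<otimes>\<^bsub>G\<^esub> inv\<^bsub>G\<^esub> b \<in> N" by simp
  qed
  note wm = this
  define Q where "Q = image_group \<phi> G"
  have \<phi>hom: "group_hom G Q \<phi>" unfolding Q_def using G.weak_group_morphism_group_hom[OF wm] .
  have surj: "carrier Q = \<phi> ` carrier G" by (simp add: Q_def image_group_carrier)
  have Q: "comm_group Q"
  proof -
    have "Q\<lparr>carrier := \<phi> ` carrier G, one := \<phi> \<one>\<^bsub>G\<^esub>\<rparr> = Q" by (simp add: Q_def image_group_def)
    then show ?thesis using G.hom_imp_img_comm_group[of \<phi> Q] group_hom.homh[OF \<phi>hom] by simp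
  qed
  have q: "ab_arr G Q \<phi> \<in> Hom Ab G Q"
    by (rule ab_arr_Hom[OF G Q]) (use \<phi>hom in \<open>auto simp: group_hom.hom_mult surj\<close>)
  have ker: "kernel G Q \<phi> = N" unfolding Q_def using G.weak_group_morphism_ker[OF wm] .
  show ?thesis
  proof (rule exI[of _ Q], rule bexI[OF _ q], intro conjI ballI)
    fix y assume "y \<in> carrier Q"
    then show "\<exists>x\<in>carrier G. ab_arr G Q \<phi> \<bullet> x = y" unfolding surj by auto
  next
    fix x assume "x \<in> carrier G"
    then show "ab_arr G Q \<phi> \<bullet> x = \<one>\<^bsub>Q\<^esub> \<longleftrightarrow> x \<in> N" using ker by (auto simp: kernel_def)
  qed
qed

lemma Ab_factor:
  assumes q: "q \<in> Hom Ab G Q" and surj: "\<And>y. y \<in> carrier Q \<Longrightarrow> \<exists>x \<in> carrier G. q \<bullet> x = y"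
    and h: "h \<in> Hom Ab G K" and ker: "\<And>x. x \<in> carrier G \<Longrightarrow> q \<bullet> x = \<one>\<^bsub>Q\<^esub> \<Longrightarrow> h \<bullet> x = \<one>\<^bsub>K\<^esub>"
  shows "\<exists>!w. w \<in> Hom Ab Q K \<and> w \<cdot>\<^bsub>Ab\<^esub> q = h"
proof -
  interpret G: comm_group G using Ab_Hom_group[OF q] by simp
  interpret Q: comm_group Q using Ab_Hom_group[OF q] by simp
  interpret K: comm_group K using Ab_Hom_group[OF h] by simp
  have eq: "h \<bullet> x = h \<bullet> x'" if x: "x \<in> carrier G" "x' \<in> carrier G" "q \<bullet> x = q \<bullet> x'" for x x'
  proof -
    have "q \<bullet> (x \<otimes>\<^bsub>G\<^esub> inv\<^bsub>G\<^esub> x') = \<one>\<^bsub>Q\<^esub>"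
      using x by (simp add: Ab_mult[OF q] Ab_inv[OF q] Ab_closed[OF q])
    then have "h \<bullet> x \<otimes>\<^bsub>K\<^esub> inv\<^bsub>K\<^esub> (h \<bullet> x') = \<one>\<^bsub>K\<^esub>"
      using ker[of "x \<otimes>\<^bsub>G\<^esub> inv\<^bsub>G\<^esub> x'"] x by (simp add: Ab_mult[OF h] Ab_inv[OF h])
    then show ?thesis using x Ab_closed[OF h] K.inv_equality K.inv_inv K.inv_closed by metis
  qed
  define s where "s y = (SOME x. x \<in> carrier G \<and> q \<bullet> x = y)" for y
  have s: "s y \<in> carrier G" "q \<bullet> s y = y" if "y \<in> carrier Q" for y
    using someI_ex[of "\<lambda>x. x \<in> carrier G \<and> q \<bullet> x = y"] surj[OF that] unfolding s_def by auto
  define w where "w = ab_arr Q K (\<lambda>y. h \<bullet> s y)"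
  have w: "w \<in> Hom Ab Q K"
    unfolding w_def
  proof (rule ab_arr_Hom)
    fix y y' assume y: "y \<in> carrier Q" "y' \<in> carrier Q"
    have "h \<bullet> s (y \<otimes>\<^bsub>Q\<^esub> y') = h \<bullet> (s y \<otimes>\<^bsub>G\<^esub> s y')"
      by (rule eq) (use y s in \<open>auto simp: Ab_mult[OF q]\<close>)
    then show "h \<bullet> s (y \<otimes>\<^bsub>Q\<^esub> y') = h \<bullet> s y \<otimes>\<^bsub>K\<^esub> h \<bullet> s y'"
      using y s by (simp add: Ab_mult[OF h])
  qed (use s Ab_closed[OF h] in \<open>simp_all add: Q.comm_group_axioms K.comm_group_axioms\<close>)
  have wq: "w \<cdot>\<^bsub>Ab\<^esub> q = h"
    by (rule Ab_eqI1[OF q w h]) (auto simp: w_def Ab_closed[OF q] s intro!: eq)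
  show ?thesis
  proof (rule ex1I[of _ w])
    fix v assume v: "v \<in> Hom Ab Q K \<and> v \<cdot>\<^bsub>Ab\<^esub> q = h"
    show "v = w"
    proof (rule Ab_ext)
      fix y assume "y \<in> carrier Q"
      then obtain x where "x \<in> carrier G" "q \<bullet> x = y" using surj by blast
      then show "v \<bullet> y = w \<bullet> y" using v wq Ab_eqD1[OF _ q] by metis
    qed (use v w in auto)
  qed (use w wq in simp)
qed

text \<open>Testing a jointly monic pair on the inclusion of its common kernel shows that it is jointly
  injective.\<close>

lemma Ab_jointly_injective:
  assumes p: "p \<in> Hom Ab P G" and q: "q \<in> Hom Ab P H"
    and mono: "\<And>Z u v. u \<in> Hom Ab Z P \<Longrightarrow> v \<in> Hom Ab Z P \<Longrightarrow> p \<cdot>\<^bsub>Ab\<^esub> u = p \<cdot>\<^bsub>Ab\<^esub> v \<Longrightarrow>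
      q \<cdot>\<^bsub>Ab\<^esub> u = q \<cdot>\<^bsub>Ab\<^esub> v \<Longrightarrow> u = v"
    and w: "w \<in> carrier P" "w' \<in> carrier P" "p \<bullet> w = p \<bullet> w'" "q \<bullet> w = q \<bullet> w'"
  shows "w = w'"
proof -
  interpret P: comm_group P using Ab_Hom_group[OF p] by simp
  interpret G: comm_group G using Ab_Hom_group[OF p] by simp
  interpret H: comm_group H using Ab_Hom_group[OF q] by simp
  define K where "K = {x \<in> carrier P. p \<bullet> x = \<one>\<^bsub>G\<^esub> \<and> q \<bullet> x = \<one>\<^bsub>H\<^esub>}"
  have K: "subgroup K P"
  proof (rule P.subgroupI)
    show "K \<noteq> {}" using Ab_one[OF p] Ab_one[OF q] by (auto simp: K_def)
  qed (auto simp: K_def Ab_mult[OF p] Ab_mult[OF q] Ab_inv[OF p] Ab_inv[OF q])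
  let ?i = "ab_incl P K" and ?o = "ab_triv (P\<lparr>carrier := K\<rparr>) P"
  have i: "?i \<in> Hom Ab (P\<lparr>carrier := K\<rparr>) P" by (rule ab_incl_Hom[OF P.comm_group_axioms K])
  have o: "?o \<in> Hom Ab (P\<lparr>carrier := K\<rparr>) P"
    using ab_triv_Hom subgroup_comm_group[OF P.comm_group_axioms K] P.comm_group_axioms by blast
  have "?i = ?o"
    by (rule mono[OF i o], rule Ab_eqI[OF i o p p], simp add: K_def Ab_one[OF p],
        rule Ab_eqI[OF i o q q], simp add: K_def Ab_one[OF q])
  moreover have "w \<otimes>\<^bsub>P\<^esub> inv\<^bsub>P\<^esub> w' \<in> K"
    using w Ab_closed[OF p] Ab_closed[OF q]
    by (auto simp: K_def Ab_mult[OF p] Ab_mult[OF q] Ab_inv[OF p] Ab_inv[OF q])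
  ultimately have "w \<otimes>\<^bsub>P\<^esub> inv\<^bsub>P\<^esub> w' = \<one>\<^bsub>P\<^esub>"
    using ab_incl_app[of "w \<otimes>\<^bsub>P\<^esub> inv\<^bsub>P\<^esub> w'" K P]
      ab_triv_app[of "w \<otimes>\<^bsub>P\<^esub> inv\<^bsub>P\<^esub> w'" "P\<lparr>carrier := K\<rparr>" P] by simp
  then show ?thesis using w P.inv_equality P.inv_inv P.inv_closed by metis
qed

lemma Ab_pullback_injective:
  assumes pb: "is_pullback Ab f g p q" and p: "p \<in> Hom Ab P G" and q: "q \<in> Hom Ab P H"
    and w: "w \<in> carrier P" "w' \<in> carrier P" "p \<bullet> w = p \<bullet> w'" "q \<bullet> w = q \<bullet> w'"
  shows "w = w'"
  using Ab_jointly_injective[OF p q _ w] pullback_ext[OF category_Ab pb] HomD(2)[OF p] by metis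

lemma Ab_pullbackI:
  assumes f: "f \<in> Hom Ab G K" and g: "g \<in> Hom Ab H K" and p: "p \<in> Hom Ab P G" and q: "q \<in> Hom Ab P H"
    and comm: "f \<cdot>\<^bsub>Ab\<^esub> p = g \<cdot>\<^bsub>Ab\<^esub> q"
    and ex: "\<And>x y. x \<in> carrier G \<Longrightarrow> y \<in> carrier H \<Longrightarrow> f \<bullet> x = g \<bullet> y \<Longrightarrow>
      \<exists>w \<in> carrier P. p \<bullet> w = x \<and> q \<bullet> w = y"
    and inj: "\<And>w w'. w \<in> carrier P \<Longrightarrow> w' \<in> carrier P \<Longrightarrow> p \<bullet> w = p \<bullet> w' \<Longrightarrow> q \<bullet> w = q \<bullet> w' \<Longrightarrow> w = w'"
  shows "is_pullback Ab f g p q"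
proof (rule is_pullbackI[OF f g p q comm])
  fix Z u v assume u: "u \<in> Hom Ab Z G" and v: "v \<in> Hom Ab Z H" and eq: "f \<cdot>\<^bsub>Ab\<^esub> u = g \<cdot>\<^bsub>Ab\<^esub> v"
  interpret P: comm_group P using Ab_Hom_group[OF p] by simp
  interpret Z: comm_group Z using Ab_Hom_group[OF u] by simp
  define t where "t z = (SOME w. w \<in> carrier P \<and> p \<bullet> w = u \<bullet> z \<and> q \<bullet> w = v \<bullet> z)" for z
  have t: "t z \<in> carrier P" "p \<bullet> t z = u \<bullet> z" "q \<bullet> t z = v \<bullet> z" if z: "z \<in> carrier Z" for z
  proof -
    have "\<exists>w. w \<in> carrier P \<and> p \<bullet> w = u \<bullet> z \<and> q \<bullet> w = v \<bullet> z"
      using ex[OF Ab_closed[OF u z] Ab_closed[OF v z] Ab_eqD[OF eq u v z]] by blast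
    from someI_ex[OF this] show "t z \<in> carrier P" "p \<bullet> t z = u \<bullet> z" "q \<bullet> t z = v \<bullet> z"
      unfolding t_def by auto
  qed
  define w where "w = ab_arr Z P t"
  have w: "w \<in> Hom Ab Z P"
    unfolding w_def
  proof (rule ab_arr_Hom)
    fix x y assume "x \<in> carrier Z" "y \<in> carrier Z"
    then show "t (x \<otimes>\<^bsub>Z\<^esub> y) = t x \<otimes>\<^bsub>P\<^esub> t y"
      by - (rule inj, simp_all add: t Ab_mult[OF p] Ab_mult[OF q] Ab_mult[OF u] Ab_mult[OF v])
  qed (simp_all add: t P.comm_group_axioms Z.comm_group_axioms)
  show "\<exists>!w. w \<in> Hom Ab Z P \<and> p \<cdot>\<^bsub>Ab\<^esub> w = u \<and> q \<cdot>\<^bsub>Ab\<^esub> w = v"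
  proof (rule ex1I[of _ w], intro conjI)
    show "w \<in> Hom Ab Z P" by fact
    show "p \<cdot>\<^bsub>Ab\<^esub> w = u" by (rule Ab_eqI1[OF w p u]) (simp add: w_def t)
    show "q \<cdot>\<^bsub>Ab\<^esub> w = v" by (rule Ab_eqI1[OF w q v]) (simp add: w_def t)
    fix w' assume w': "w' \<in> Hom Ab Z P \<and> p \<cdot>\<^bsub>Ab\<^esub> w' = u \<and> q \<cdot>\<^bsub>Ab\<^esub> w' = v"
    show "w' = w"
    proof (rule Ab_ext[OF conjunct1[OF w'] w])
      fix z assume z: "z \<in> carrier Z"
      have w'H: "w' \<in> Hom Ab Z P" using w' by simp
      have "p \<bullet> (w' \<bullet> z) = u \<bullet> z" "q \<bullet> (w' \<bullet> z) = v \<bullet> z"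
        using w' Ab_comp_app[OF w'H z] by metis+
      then show "w' \<bullet> z = w \<bullet> z"
        using t[OF z] Ab_closed[OF w'H z] z by - (rule inj, simp_all add: w_def)
    qed
  qed
qed

lemma pairing_eq [simp]: "\<langle>a, b\<rangle> = \<langle>c, d\<rangle> \<longleftrightarrow> a = c \<and> b = d"
  using inj_pairing by (auto dest: injD)

lemma carrier_ab_prod: "carrier (G \<times>\<^sub>u H) = {\<langle>x, y\<rangle> | x y. x \<in> carrier G \<and> y \<in> carrier H}"
  by (auto simp: ab_prod_def image_group_carrier)

lemma upair_in_ab_prod [simp]: "\<langle>x, y\<rangle> \<in> carrier (G \<times>\<^sub>u H) \<longleftrightarrow> x \<in> carrier G \<and> y \<in> carrier H"
  by (auto simp: carrier_ab_prod)

lemma ab_prodE: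
  assumes "z \<in> carrier (G \<times>\<^sub>u H)"
  obtains x y where "z = \<langle>x, y\<rangle>" "x \<in> carrier G" "y \<in> carrier H"
  using assms by (auto simp: carrier_ab_prod)

lemma ab_prod_mult [simp]:
  assumes "x \<in> carrier G" "x' \<in> carrier G" "y \<in> carrier H" "y' \<in> carrier H"
  shows "\<langle>x, y\<rangle> \<otimes>\<^bsub>G \<times>\<^sub>u H\<^esub> \<langle>x', y'\<rangle> = \<langle>x \<otimes>\<^bsub>G\<^esub> x', y \<otimes>\<^bsub>H\<^esub> y'\<rangle>"
proof -
  have "inj_on pairing (carrier (G \<times>\<times> H))" using inj_pairing by (rule inj_on_subset) simp
  then show ?thesis using assms by (simp add: ab_prod_def image_group_def inv_into_f_f)
qed

lemma ab_prod_one [simp]: "\<one>\<^bsub>G \<times>\<^sub>u H\<^esub> = \<langle>\<one>\<^bsub>G\<^esub>, \<one>\<^bsub>H\<^esub>\<rangle>"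
  by (simp add: ab_prod_def image_group_one)

lemma ab_prod_comm_group:
  assumes "comm_group G" "comm_group H"
  shows "comm_group (G \<times>\<^sub>u H)"
proof -
  interpret G: comm_group G by fact
  interpret H: comm_group H by fact
  show ?thesis
  proof (rule comm_groupI)
    fix x assume "x \<in> carrier (G \<times>\<^sub>u H)"
    then obtain a b where "x = \<langle>a, b\<rangle>" "a \<in> carrier G" "b \<in> carrier H" by (rule ab_prodE)
    then show "\<exists>y\<in>carrier (G \<times>\<^sub>u H). y \<otimes>\<^bsub>G \<times>\<^sub>u H\<^esub> x = \<one>\<^bsub>G \<times>\<^sub>u H\<^esub>"
      by (intro bexI[of _ "\<langle>inv\<^bsub>G\<^esub> a, inv\<^bsub>H\<^esub> b\<rangle>"]) simp_all
  next
    show "x \<otimes>\<^bsub>G \<times>\<^sub>u H\<^esub> y = y \<otimes>\<^bsub>G \<times>\<^sub>u H\<^esub> x"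
      if "x \<in> carrier (G \<times>\<^sub>u H)" "y \<in> carrier (G \<times>\<^sub>u H)" for x y
      using that by (auto elim!: ab_prodE simp: G.m_comm H.m_comm)
  qed (auto elim!: ab_prodE simp: G.m_assoc H.m_assoc)
qed

lemma ab_prod_inv [simp]:
  assumes "comm_group G" "comm_group H" "x \<in> carrier G" "y \<in> carrier H"
  shows "inv\<^bsub>G \<times>\<^sub>u H\<^esub> \<langle>x, y\<rangle> = \<langle>inv\<^bsub>G\<^esub> x, inv\<^bsub>H\<^esub> y\<rangle>"
proof -
  interpret G: comm_group G by fact
  interpret H: comm_group H by fact
  interpret P: comm_group "G \<times>\<^sub>u H" using ab_prod_comm_group assms by blast
  show ?thesis by (rule P.inv_equality) (use assms in auto)
qed

lemma Ab_has_pullbacks: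
  fixes f :: "'u::infinite ab_arr"
  assumes f: "f \<in> Hom Ab G K" and g: "g \<in> Hom Ab H K"
  shows "\<exists>P. \<exists>p \<in> Hom Ab P G. \<exists>q \<in> Hom Ab P H. is_pullback Ab f g p q \<and>
    (\<forall>x \<in> carrier G. \<forall>y \<in> carrier H. f \<bullet> x = g \<bullet> y \<longrightarrow> (\<exists>w \<in> carrier P. p \<bullet> w = x \<and> q \<bullet> w = y))"
proof -
  interpret G: comm_group G using Ab_Hom_group[OF f] by simp
  interpret H: comm_group H using Ab_Hom_group[OF g] by simp
  interpret K: comm_group K using Ab_Hom_group[OF f] by simp
  interpret GH: comm_group "G \<times>\<^sub>u H" using ab_prod_comm_group G.comm_group_axioms H.comm_group_axioms .
  define S where "S = {\<langle>x, y\<rangle> | x y. x \<in> carrier G \<and> y \<in> carrier H \<and> f \<bullet> x = g \<bullet> y}"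
  have S: "subgroup S (G \<times>\<^sub>u H)"
  proof (rule GH.subgroupI)
    show "S \<noteq> {}" using Ab_one[OF f] Ab_one[OF g] by (force simp: S_def)
  qed (auto simp: S_def G.comm_group_axioms H.comm_group_axioms Ab_mult[OF f] Ab_mult[OF g] Ab_inv[OF f] Ab_inv[OF g])
  define P where "P = (G \<times>\<^sub>u H)\<lparr>carrier := S\<rparr>"
  have P: "comm_group P" "carrier P = S" "mult P = mult (G \<times>\<^sub>u H)"
    unfolding P_def using subgroup_comm_group[OF GH.comm_group_axioms S] by auto
  define p where "p = ab_arr P G ufst"
  define q where "q = ab_arr P H usnd"
  have p: "p \<in> Hom Ab P G"
    unfolding p_def by (rule ab_arr_Hom) (auto simp: P S_def G.comm_group_axioms)
  have q: "q \<in> Hom Ab P H"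
    unfolding q_def by (rule ab_arr_Hom) (auto simp: P S_def H.comm_group_axioms)
  have ex: "\<exists>w \<in> carrier P. p \<bullet> w = x \<and> q \<bullet> w = y"
    if "x \<in> carrier G" "y \<in> carrier H" "f \<bullet> x = g \<bullet> y" for x y
  proof -
    have "\<langle>x, y\<rangle> \<in> carrier P" using that by (auto simp: P S_def)
    then show ?thesis by (intro bexI[of _ "\<langle>x, y\<rangle>"]) (auto simp: p_def q_def)
  qed
  have "is_pullback Ab f g p q"
  proof (rule Ab_pullbackI[OF f g p q _ ex])
    show "f \<cdot>\<^bsub>Ab\<^esub> p = g \<cdot>\<^bsub>Ab\<^esub> q"
      by (rule Ab_eqI[OF p q f g]) (auto simp: p_def q_def P S_def)
  next
    fix w w' assume "w \<in> carrier P" "w' \<in> carrier P" "p \<bullet> w = p \<bullet> w'" "q \<bullet> w = q \<bullet> w'"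
    then show "w = w'" by (auto simp: p_def q_def P S_def)
  qed
  with p q ex show ?thesis by blast
qed

lemma Ab_pullback_surjective:
  fixes f :: "'u::infinite ab_arr"
  assumes pb: "is_pullback Ab f g p q" and f: "f \<in> Hom Ab G K" and g: "g \<in> Hom Ab H K"
    and P: "p \<in> Hom Ab P G"
    and xy: "x \<in> carrier G" "y \<in> carrier H" "f \<bullet> x = g \<bullet> y"
  shows "\<exists>w \<in> carrier P. p \<bullet> w = x \<and> q \<bullet> w = y"
proof -
  obtain Q p' q' where Q: "p' \<in> Hom Ab Q G" "q' \<in> Hom Ab Q H" "is_pullback Ab f g p' q'"
    "\<exists>w \<in> carrier Q. p' \<bullet> w = x \<and> q' \<bullet> w = y"
    using Ab_has_pullbacks[OF f g] xy by metis
  have "f \<cdot>\<^bsub>Ab\<^esub> p' = g \<cdot>\<^bsub>Ab\<^esub> q'" using Q(3) by (simp add: is_pullback_def)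
  then obtain w where w: "w \<in> Hom Ab Q P" "p \<cdot>\<^bsub>Ab\<^esub> w = p'" "q \<cdot>\<^bsub>Ab\<^esub> w = q'"
    using pullback_lift[OF pb, of p' Q q'] Q(1,2) HomD[OF f] HomD[OF g] HomD[OF P] by auto
  obtain z where z: "z \<in> carrier Q" "p' \<bullet> z = x" "q' \<bullet> z = y" using Q(4) by blast
  show ?thesis
    using Ab_closed[OF w(1) z(1)] Ab_eqD1[OF w(2,1) z(1)] Ab_eqD1[OF w(3,1) z(1)] z by metis
qed

lemma Ab_pb:
  fixes f :: "'u::infinite ab_arr"
  assumes f: "f \<in> Hom Ab G K" and g: "g \<in> Hom Ab H K"
  shows "is_pullback Ab f g (pb1 Ab f g) (pb2 Ab f g)"
    and "pb1 Ab f g \<in> Hom Ab (Dom Ab (pb1 Ab f g)) G"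
    and "pb2 Ab f g \<in> Hom Ab (Dom Ab (pb1 Ab f g)) H"
    and "f \<cdot>\<^bsub>Ab\<^esub> pb1 Ab f g = g \<cdot>\<^bsub>Ab\<^esub> pb2 Ab f g"
proof -
  show "is_pullback Ab f g (pb1 Ab f g) (pb2 Ab f g)"
  proof -
    obtain p q where "is_pullback Ab f g p q" using Ab_has_pullbacks[OF f g] by metis
    then show ?thesis by (rule pb_is_pullback)
  qed
  then show "pb1 Ab f g \<in> Hom Ab (Dom Ab (pb1 Ab f g)) G"
    "pb2 Ab f g \<in> Hom Ab (Dom Ab (pb1 Ab f g)) H"
    "f \<cdot>\<^bsub>Ab\<^esub> pb1 Ab f g = g \<cdot>\<^bsub>Ab\<^esub> pb2 Ab f g"
    using HomD[OF f] HomD[OF g] by (auto simp: is_pullback_def Hom_iff)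
qed

subsection \<open>Exactness\<close>

lemma Ab_coequalizerI:
  assumes f: "f \<in> Hom Ab G H" and g: "g \<in> Hom Ab G H" and q: "q \<in> Hom Ab H Q"
    and surj: "\<And>y. y \<in> carrier Q \<Longrightarrow> \<exists>x \<in> carrier H. q \<bullet> x = y"
    and ker: "\<And>y. y \<in> carrier H \<Longrightarrow>
      q \<bullet> y = \<one>\<^bsub>Q\<^esub> \<longleftrightarrow> (\<exists>x \<in> carrier G. y = f \<bullet> x \<otimes>\<^bsub>H\<^esub> inv\<^bsub>H\<^esub> (g \<bullet> x))"
  shows "is_coequalizer Ab f g q"
proof -
  interpret H: comm_group H using Ab_Hom_group[OF f] by simp
  interpret Q: comm_group Q using Ab_Hom_group[OF q] by simp
  have "q \<bullet> (f \<bullet> x) = q \<bullet> (g \<bullet> x)" if x: "x \<in> carrier G" for x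
  proof -
    note c = Ab_closed[OF f x] Ab_closed[OF g x]
    have "q \<bullet> (f \<bullet> x \<otimes>\<^bsub>H\<^esub> inv\<^bsub>H\<^esub> (g \<bullet> x)) = \<one>\<^bsub>Q\<^esub>" using ker[of "f \<bullet> x \<otimes>\<^bsub>H\<^esub> inv\<^bsub>H\<^esub> (g \<bullet> x)"] c x by auto
    then have "q \<bullet> (f \<bullet> x) \<otimes>\<^bsub>Q\<^esub> inv\<^bsub>Q\<^esub> (q \<bullet> (g \<bullet> x)) = \<one>\<^bsub>Q\<^esub>"
      using c by (simp add: Ab_mult[OF q] Ab_inv[OF q])
    then show ?thesis using Ab_closed[OF q c(1)] Ab_closed[OF q c(2)] Q.inv_equality Q.inv_inv Q.inv_closed by metis
  qed
  then have qfg: "q \<cdot>\<^bsub>Ab\<^esub> f = q \<cdot>\<^bsub>Ab\<^esub> g" by (rule Ab_eqI[OF f g q q])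
  have "\<exists>!w. w \<in> Hom Ab Q (Cod Ab h) \<and> w \<cdot>\<^bsub>Ab\<^esub> q = h"
    if h: "h \<in> Arr Ab" "Dom Ab h = H" "h \<cdot>\<^bsub>Ab\<^esub> f = h \<cdot>\<^bsub>Ab\<^esub> g" for h
  proof (rule Ab_factor[OF q surj])
    show hH: "h \<in> Hom Ab H (Cod Ab h)" using h by (simp add: Hom_iff)
    interpret K: comm_group "Cod Ab h" using Ab_Hom_group[OF hH] by simp
    fix y assume "y \<in> carrier H" "q \<bullet> y = \<one>\<^bsub>Q\<^esub>"
    then obtain x where x: "x \<in> carrier G" "y = f \<bullet> x \<otimes>\<^bsub>H\<^esub> inv\<^bsub>H\<^esub> (g \<bullet> x)" using ker by blast
    then show "h \<bullet> y = \<one>\<^bsub>Cod Ab h\<^esub>"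
      using Ab_eqD[OF h(3) f g x(1)] Ab_closed[OF f x(1)] Ab_closed[OF g x(1)] Ab_closed[OF hH]
      by (simp add: Ab_mult[OF hH] Ab_inv[OF hH])
  qed
  then show ?thesis
    unfolding is_coequalizer_def using HomD[OF f] HomD[OF g] HomD[OF q] qfg by simp
qed

lemma Ab_has_coequalizers:
  assumes f: "f \<in> Hom Ab G H" and g: "g \<in> Hom Ab G H"
  shows "\<exists>q. is_coequalizer Ab f g q"
proof -
  interpret G: comm_group G using Ab_Hom_group[OF f] by simp
  interpret H: comm_group H using Ab_Hom_group[OF f] by simp
  define d where "d = ab_arr G H (\<lambda>x. f \<bullet> x \<otimes>\<^bsub>H\<^esub> inv\<^bsub>H\<^esub> (g \<bullet> x))"
  have d: "d \<in> Hom Ab G H"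
    unfolding d_def
    by (rule ab_arr_Hom)
      (auto simp: G.comm_group_axioms H.comm_group_axioms Ab_closed[OF f] Ab_closed[OF g] Ab_mult[OF f]
        Ab_mult[OF g] H.inv_mult H.m_ac)
  obtain Q q where q: "q \<in> Hom Ab H Q" "\<forall>y \<in> carrier Q. \<exists>x \<in> carrier H. q \<bullet> x = y"
    "\<forall>x \<in> carrier H. q \<bullet> x = \<one>\<^bsub>Q\<^esub> \<longleftrightarrow> x \<in> (\<lambda>x. d \<bullet> x) ` carrier G"
    using Ab_quotient[OF H.comm_group_axioms image_subgroup[OF d]] by blast
  have "is_coequalizer Ab f g q"
    by (rule Ab_coequalizerI[OF f g q(1)]) (use q in \<open>auto simp: d_def image_iff\<close>)
  then show ?thesis ..
qed

lemma coequalizer_univ: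
  assumes co: "is_coequalizer C f g q" and q: "q \<in> Hom C b c"
    and h: "h \<in> Hom C b x" "h \<cdot>\<^bsub>C\<^esub> f = h \<cdot>\<^bsub>C\<^esub> g"
  shows "\<exists>!w. w \<in> Hom C c x \<and> w \<cdot>\<^bsub>C\<^esub> q = h"
proof -
  have "\<forall>h \<in> Arr C. Dom C h = Cod C f \<and> h \<cdot>\<^bsub>C\<^esub> f = h \<cdot>\<^bsub>C\<^esub> g \<longrightarrow>
        (\<exists>!w. w \<in> Hom C (Cod C q) (Cod C h) \<and> w \<cdot>\<^bsub>C\<^esub> q = h)" and "Dom C q = Cod C f"
    using co by (auto simp: is_coequalizer_def)
  from bspec[OF this(1) HomD(1)[OF h(1)]] this(2) show ?thesis
    using h(2) HomD[OF h(1)] HomD[OF q] by simp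
qed

lemma coequalizer_epi:
  assumes C: "category C" and co: "is_coequalizer C f g q" and q: "q \<in> Hom C b c"
    and h: "h \<in> Hom C c x" "h' \<in> Hom C c x" "h \<cdot>\<^bsub>C\<^esub> q = h' \<cdot>\<^bsub>C\<^esub> q"
  shows "h = h'"
proof -
  have f: "f \<in> Hom C (Dom C f) b" "g \<in> Hom C (Dom C f) b" "q \<cdot>\<^bsub>C\<^esub> f = q \<cdot>\<^bsub>C\<^esub> g"
    using co HomD[OF q] by (auto simp: is_coequalizer_def Hom_iff)
  have hq: "h \<cdot>\<^bsub>C\<^esub> q \<in> Hom C b x" using category_comp[OF C q h(1)] .
  have "(h \<cdot>\<^bsub>C\<^esub> q) \<cdot>\<^bsub>C\<^esub> f = (h \<cdot>\<^bsub>C\<^esub> q) \<cdot>\<^bsub>C\<^esub> g"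
    using category_assoc[OF C f(1) q h(1)] category_assoc[OF C f(2) q h(1)] f(3) by simp
  from coequalizer_univ[OF co q hq this] show ?thesis using h by metis
qed

text \<open>A coequalizer \<open>q\<close> factors through the inclusion of its image; the universal property, applied to the
  corestriction of \<open>q\<close>, splits this inclusion. Conversely a surjection is the cokernel of its kernel.\<close>

lemma Ab_regular_epi_iff:
  fixes q :: "'u::infinite ab_arr"
  assumes q: "q \<in> Hom Ab H Q"
  shows "regular_epi Ab q \<longleftrightarrow> (\<forall>y \<in> carrier Q. \<exists>x \<in> carrier H. q \<bullet> x = y)"
proof
  assume "regular_epi Ab q"
  then obtain f g where co: "is_coequalizer Ab f g q" by (auto simp: regular_epi_def)
  have Q: "comm_group Q" using Ab_Hom_group[OF q] by simp
  define S where "S = (\<lambda>x. q \<bullet> x) ` carrier H"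
  have S: "subgroup S Q" unfolding S_def by (rule image_subgroup[OF q])
  obtain k where k: "k \<in> Hom Ab H (Q\<lparr>carrier := S\<rparr>)" "\<And>z. z \<in> carrier H \<Longrightarrow> k \<bullet> z = q \<bullet> z"
    using ab_factor_incl[OF q S] by (auto simp: S_def)
  have i: "ab_incl Q S \<in> Hom Ab (Q\<lparr>carrier := S\<rparr>) Q" by (rule ab_incl_Hom[OF Q S])
  have f: "f \<in> Hom Ab (Dom Ab f) H" "g \<in> Hom Ab (Dom Ab f) H" "q \<cdot>\<^bsub>Ab\<^esub> f = q \<cdot>\<^bsub>Ab\<^esub> g"
    using co HomD[OF q] by (auto simp: is_coequalizer_def Hom_iff)
  have "k \<cdot>\<^bsub>Ab\<^esub> f = k \<cdot>\<^bsub>Ab\<^esub> g"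
    by (rule Ab_eqI[OF f(1,2) k(1) k(1)])
      (simp add: k(2) Ab_closed[OF f(1)] Ab_closed[OF f(2)] Ab_eqD[OF f(3,1,2)])
  then obtain w where w: "w \<in> Hom Ab Q (Q\<lparr>carrier := S\<rparr>)" "w \<cdot>\<^bsub>Ab\<^esub> q = k"
    using coequalizer_univ[OF co q k(1)] by blast
  have "ab_incl Q S \<cdot>\<^bsub>Ab\<^esub> w = Ide Ab Q"
  proof (rule coequalizer_epi[OF category_Ab co q Ab_comp[OF w(1) i] Ab_Ide[OF Q]])
    show "(ab_incl Q S \<cdot>\<^bsub>Ab\<^esub> w) \<cdot>\<^bsub>Ab\<^esub> q = Ide Ab Q \<cdot>\<^bsub>Ab\<^esub> q"
    proof (rule Ab_eqI[OF q q Ab_comp[OF w(1) i] Ab_Ide[OF Q]])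
      fix x assume x: "x \<in> carrier H"
      have "w \<bullet> (q \<bullet> x) = q \<bullet> x" using Ab_eqD1[OF w(2) q x] k(2)[OF x] by simp
      then show "(ab_incl Q S \<cdot>\<^bsub>Ab\<^esub> w) \<bullet> (q \<bullet> x) = Ide Ab Q \<bullet> (q \<bullet> x)"
        using Ab_closed[OF q x] x by (simp add: Ab_comp_app[OF w(1)] S_def)
    qed
  qed
  then have "y \<in> S" if y: "y \<in> carrier Q" for y
    using Ab_eqD1[OF _ w(1) y, of "ab_incl Q S" "Ide Ab Q"] Ab_closed[OF w(1) y] y by simp
  then show "\<forall>y \<in> carrier Q. \<exists>x \<in> carrier H. q \<bullet> x = y" by (auto simp: S_def)
next
  assume surj: "\<forall>y \<in> carrier Q. \<exists>x \<in> carrier H. q \<bullet> x = y"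
  interpret H: comm_group H using Ab_Hom_group[OF q] by simp
  interpret Q: comm_group Q using Ab_Hom_group[OF q] by simp
  define N where "N = {x \<in> carrier H. q \<bullet> x = \<one>\<^bsub>Q\<^esub>}"
  have N: "subgroup N H"
  proof (rule H.subgroupI)
    show "N \<noteq> {}" using Ab_one[OF q] by (auto simp: N_def)
  qed (auto simp: N_def Ab_mult[OF q] Ab_inv[OF q])
  have "is_coequalizer Ab (ab_incl H N) (ab_triv (H\<lparr>carrier := N\<rparr>) H) q"
  proof (rule Ab_coequalizerI)
    show "ab_incl H N \<in> Hom Ab (H\<lparr>carrier := N\<rparr>) H" by (rule ab_incl_Hom[OF H.comm_group_axioms N])
    show "ab_triv (H\<lparr>carrier := N\<rparr>) H \<in> Hom Ab (H\<lparr>carrier := N\<rparr>) H"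
      by (rule ab_triv_Hom[OF subgroup_comm_group[OF H.comm_group_axioms N] H.comm_group_axioms])
  qed (use q surj in \<open>auto simp: N_def\<close>)
  then show "regular_epi Ab q" unfolding regular_epi_def by blast
qed


definition unit_group :: "'u monoid" where
  "unit_group = \<lparr>carrier = {undefined}, mult = (\<lambda>_ _. undefined), one = undefined\<rparr>"

lemma unit_group_comm_group: "comm_group unit_group"
  by (rule comm_groupI) (auto simp: unit_group_def)

lemma unit_group_carrier: "x \<in> carrier unit_group \<longleftrightarrow> x = \<one>\<^bsub>unit_group\<^esub>"
  by (simp add: unit_group_def)

lemma unit_group_terminal: "is_terminal Ab unit_group"
  unfolding is_terminal_def
proof (intro conjI ballI)
  fix G :: "'a monoid" assume "G \<in> Obj Ab"
  then have t: "ab_triv G unit_group \<in> Hom Ab G unit_group"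
    by (simp add: ab_triv_Hom unit_group_comm_group)
  show "\<exists>!f. f \<in> Hom Ab G unit_group"
  proof (rule ex1I[of _ "ab_triv G unit_group"])
    show "ab_triv G unit_group \<in> Hom Ab G unit_group" by (rule t)
    fix f assume f: "f \<in> Hom Ab G unit_group"
    show "f = ab_triv G unit_group"
      by (rule Ab_ext[OF f t]) (use Ab_closed[OF f] in \<open>simp add: unit_group_carrier\<close>)
  qed
qed (simp add: unit_group_comm_group)

text \<open>An internal equivalence relation \<open>(r, s)\<close> is the kernel pair of the quotient by the class of \<open>0\<close>,
  because \<open>x\<close> and \<open>y\<close> are related if and only if \<open>0\<close> and \<open>y - x\<close> are.\<close>

lemma Ab_equivalence_effective:
  fixes r :: "'u::infinite ab_arr"
  assumes eq: "equivalence_relation Ab r s"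
  shows "\<exists>f. is_pullback Ab f f r s"
proof -
  define R X where "R = Dom Ab r" and "X = Cod Ab r"
  have r: "r \<in> Hom Ab R X" and s: "s \<in> Hom Ab R X"
    using eq by (simp_all add: equivalence_relation_def Hom_iff R_def X_def)
  interpret R: comm_group R using Ab_Hom_group[OF r] by simp
  interpret X: comm_group X using Ab_Hom_group[OF r] by simp
  obtain e where e: "e \<in> Hom Ab X R" "r \<cdot>\<^bsub>Ab\<^esub> e = Ide Ab X" "s \<cdot>\<^bsub>Ab\<^esub> e = Ide Ab X"
    using eq by (auto simp: equivalence_relation_def R_def X_def)
  have e': "r \<bullet> (e \<bullet> x) = x" "s \<bullet> (e \<bullet> x) = x" if "x \<in> carrier X" for x
    using Ab_eqD1[OF e(2,1) that] Ab_eqD1[OF e(3,1) that] that by simp_all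
  define N where "N = {s \<bullet> x | x. x \<in> carrier R \<and> r \<bullet> x = \<one>\<^bsub>X\<^esub>}"
  have N: "subgroup N X"
  proof (rule X.subgroupI)
    show "N \<subseteq> carrier X" using Ab_closed[OF s] by (auto simp: N_def)
    show "N \<noteq> {}" using Ab_one[OF r] by (auto simp: N_def)
  next
    fix a assume "a \<in> N"
    then obtain x where x: "a = s \<bullet> x" "x \<in> carrier R" "r \<bullet> x = \<one>\<^bsub>X\<^esub>" by (auto simp: N_def)
    then show "inv\<^bsub>X\<^esub> a \<in> N"
      unfolding N_def by (intro CollectI exI[of _ "inv\<^bsub>R\<^esub> x"]) (simp add: Ab_inv[OF s] Ab_inv[OF r])
  next
    fix a b assume "a \<in> N" "b \<in> N"
    then obtain x y where x: "a = s \<bullet> x" "x \<in> carrier R" "r \<bullet> x = \<one>\<^bsub>X\<^esub>"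
      and y: "b = s \<bullet> y" "y \<in> carrier R" "r \<bullet> y = \<one>\<^bsub>X\<^esub>" by (auto simp: N_def)
    then show "a \<otimes>\<^bsub>X\<^esub> b \<in> N"
      unfolding N_def by (intro CollectI exI[of _ "x \<otimes>\<^bsub>R\<^esub> y"]) (simp add: Ab_mult[OF s] Ab_mult[OF r])
  qed
  obtain Q f where f: "f \<in> Hom Ab X Q" "\<And>x. x \<in> carrier X \<Longrightarrow> f \<bullet> x = \<one>\<^bsub>Q\<^esub> \<longleftrightarrow> x \<in> N"
    using Ab_quotient[OF X.comm_group_axioms N] by metis
  interpret Q: comm_group Q using Ab_Hom_group[OF f(1)] by simp
  have "is_pullback Ab f f r s"
  proof (rule Ab_pullbackI[OF f(1) f(1) r s])
    show "f \<cdot>\<^bsub>Ab\<^esub> r = f \<cdot>\<^bsub>Ab\<^esub> s"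
    proof (rule Ab_eqI[OF r s f(1) f(1)])
      fix x assume x: "x \<in> carrier R"
      note c = Ab_closed[OF r x] Ab_closed[OF s x] Ab_closed[OF e(1) Ab_closed[OF r x]]
      have "r \<bullet> (x \<otimes>\<^bsub>R\<^esub> inv\<^bsub>R\<^esub> (e \<bullet> (r \<bullet> x))) = \<one>\<^bsub>X\<^esub>"
        using x c by (simp add: Ab_mult[OF r] Ab_inv[OF r] e')
      moreover have "s \<bullet> (x \<otimes>\<^bsub>R\<^esub> inv\<^bsub>R\<^esub> (e \<bullet> (r \<bullet> x))) = s \<bullet> x \<otimes>\<^bsub>X\<^esub> inv\<^bsub>X\<^esub> (r \<bullet> x)"
        using x c by (simp add: Ab_mult[OF s] Ab_inv[OF s] e')
      ultimately have "s \<bullet> x \<otimes>\<^bsub>X\<^esub> inv\<^bsub>X\<^esub> (r \<bullet> x) \<in> N"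
        unfolding N_def using x c by (intro CollectI exI[of _ "x \<otimes>\<^bsub>R\<^esub> inv\<^bsub>R\<^esub> (e \<bullet> (r \<bullet> x))"]) simp
      then have "f \<bullet> (s \<bullet> x) \<otimes>\<^bsub>Q\<^esub> inv\<^bsub>Q\<^esub> (f \<bullet> (r \<bullet> x)) = \<one>\<^bsub>Q\<^esub>"
        using f(2)[of "s \<bullet> x \<otimes>\<^bsub>X\<^esub> inv\<^bsub>X\<^esub> (r \<bullet> x)"] c by (simp add: Ab_mult[OF f(1)] Ab_inv[OF f(1)])
      then show "f \<bullet> (r \<bullet> x) = f \<bullet> (s \<bullet> x)"
        using Ab_closed[OF f(1) c(1)] Ab_closed[OF f(1) c(2)] Q.inv_equality Q.inv_inv Q.inv_closed by metis
    qed
  next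
    fix x y assume xy: "x \<in> carrier X" "y \<in> carrier X" "f \<bullet> x = f \<bullet> y"
    then have "f \<bullet> (inv\<^bsub>X\<^esub> x \<otimes>\<^bsub>X\<^esub> y) = \<one>\<^bsub>Q\<^esub>"
      by (simp add: Ab_mult[OF f(1)] Ab_inv[OF f(1)] Ab_closed[OF f(1)])
    then obtain z where z: "z \<in> carrier R" "r \<bullet> z = \<one>\<^bsub>X\<^esub>" "s \<bullet> z = inv\<^bsub>X\<^esub> x \<otimes>\<^bsub>X\<^esub> y"
      using f(2)[of "inv\<^bsub>X\<^esub> x \<otimes>\<^bsub>X\<^esub> y"] xy by (auto simp: N_def)
    then show "\<exists>w \<in> carrier R. r \<bullet> w = x \<and> s \<bullet> w = y"
      using xy Ab_closed[OF e(1) xy(1)]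
      by (intro bexI[of _ "e \<bullet> x \<otimes>\<^bsub>R\<^esub> z"]) (simp_all add: Ab_mult[OF r] Ab_mult[OF s] e' X.m_assoc[symmetric])
  next
    show "w = w'" if "w \<in> carrier R" "w' \<in> carrier R" "r \<bullet> w = r \<bullet> w'" "s \<bullet> w = s \<bullet> w'" for w w'
      by (rule Ab_jointly_injective[OF r s equivalence_relation_mono[OF eq] that]) (simp_all add: R_def)
  qed
  then show ?thesis ..
qed

theorem barr_exact_Ab: "barr_exact (Ab :: ('u::infinite monoid, 'u ab_arr) cat)"
  unfolding barr_exact_def
proof (intro conjI allI ballI impI)
  show "category (Ab :: ('u monoid, 'u ab_arr) cat)" by (rule category_Ab)
  show "\<exists>t. is_terminal (Ab :: ('u monoid, 'u ab_arr) cat) t" using unit_group_terminal by blast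
next
  fix f g :: "'u ab_arr" assume "f \<in> Arr Ab" "g \<in> Arr Ab" "Cod Ab f = Cod Ab g"
  then have "f \<in> Hom Ab (Dom Ab f) (Cod Ab g)" "g \<in> Hom Ab (Dom Ab g) (Cod Ab g)"
    by (simp_all add: Hom_iff)
  from Ab_pb(1)[OF this] show "\<exists>p q. is_pullback Ab f g p q" by blast
next
  fix f p q :: "'u ab_arr" assume "is_pullback Ab f f p q"
  then have "p \<in> Hom Ab (Dom Ab p) (Dom Ab f)" "q \<in> Hom Ab (Dom Ab p) (Dom Ab f)"
    by (auto simp: is_pullback_def Hom_iff)
  then show "\<exists>e. is_coequalizer Ab p q e" by (rule Ab_has_coequalizers)
next
  fix f g p q :: "'u ab_arr" assume *: "is_pullback Ab f g p q \<and> regular_epi Ab f"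
  then have f: "f \<in> Hom Ab (Dom Ab f) (Cod Ab f)" and g: "g \<in> Hom Ab (Dom Ab g) (Cod Ab f)"
    and p: "p \<in> Hom Ab (Dom Ab p) (Dom Ab f)" and q: "q \<in> Hom Ab (Dom Ab p) (Dom Ab g)"
    by (auto simp: is_pullback_def Hom_iff)
  show "regular_epi Ab q"
    unfolding Ab_regular_epi_iff[OF q]
  proof
    fix y assume y: "y \<in> carrier (Dom Ab g)"
    then obtain x where "x \<in> carrier (Dom Ab f)" "f \<bullet> x = g \<bullet> y"
      using Ab_closed[OF g y] * Ab_regular_epi_iff[OF f] by blast
    then show "\<exists>x \<in> carrier (Dom Ab p). q \<bullet> x = y"
      using Ab_pullback_surjective[OF conjunct1[OF *] f g p _ y] by blast
  qed
next
  fix r s :: "'u ab_arr" assume "equivalence_relation Ab r s"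
  then show "\<exists>f. is_pullback Ab f f r s" by (rule Ab_equivalence_effective)
qed

section \<open>Groupoids in abelian groups\<close>

lemma Ab_tup:
  fixes f :: "'u::infinite ab_arr"
  assumes f: "f \<in> Hom Ab G K" and g: "g \<in> Hom Ab H K"
    and u: "u \<in> Hom Ab Z G" and v: "v \<in> Hom Ab Z H" and eq: "f \<cdot>\<^bsub>Ab\<^esub> u = g \<cdot>\<^bsub>Ab\<^esub> v"
  shows "tup Ab f g u v \<in> Hom Ab Z (Dom Ab (pb1 Ab f g))"
    and "z \<in> carrier Z \<Longrightarrow> pb1 Ab f g \<bullet> (tup Ab f g u v \<bullet> z) = u \<bullet> z"
    and "z \<in> carrier Z \<Longrightarrow> pb2 Ab f g \<bullet> (tup Ab f g u v \<bullet> z) = v \<bullet> z"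
proof -
  have uv: "u \<in> Hom Ab Z (Dom Ab f)" "v \<in> Hom Ab Z (Dom Ab g)"
    using u v HomD[OF f] HomD[OF g] by simp_all
  note t = tup[OF Ab_pb(1)[OF f g] uv eq]
  show "tup Ab f g u v \<in> Hom Ab Z (Dom Ab (pb1 Ab f g))" by (rule t(1))
  show "pb1 Ab f g \<bullet> (tup Ab f g u v \<bullet> z) = u \<bullet> z" "pb2 Ab f g \<bullet> (tup Ab f g u v \<bullet> z) = v \<bullet> z"
    if "z \<in> carrier Z" using Ab_eqD1[OF t(2,1) that] Ab_eqD1[OF t(3,1) that] .
qed

definition refl_graph :: "('u monoid, 'u ab_arr) igpd \<Rightarrow> bool" where
  "refl_graph X \<longleftrightarrow> gd X \<in> Hom Ab (G1 X) (G0 X) \<and> gc X \<in> Hom Ab (G1 X) (G0 X) \<and>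
     ge X \<in> Hom Ab (G0 X) (G1 X) \<and>
     (\<forall>x \<in> carrier (G0 X). gd X \<bullet> (ge X \<bullet> x) = x \<and> gc X \<bullet> (ge X \<bullet> x) = x)"

lemma refl_graphD:
  assumes "refl_graph X"
  shows "gd X \<in> Hom Ab (G1 X) (G0 X)" "gc X \<in> Hom Ab (G1 X) (G0 X)" "ge X \<in> Hom Ab (G0 X) (G1 X)"
    "x \<in> carrier (G0 X) \<Longrightarrow> gd X \<bullet> (ge X \<bullet> x) = x" "x \<in> carrier (G0 X) \<Longrightarrow> gc X \<bullet> (ge X \<bullet> x) = x"
    "comm_group (G0 X)" "comm_group (G1 X)"
  using assms Ab_Hom_group[of "gd X"] by (auto simp: refl_graph_def)

abbreviation gpairs :: "('u::infinite monoid, 'u ab_arr) igpd \<Rightarrow> 'u monoid" where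
  "gpairs X \<equiv> Dom Ab (pb1 Ab (gc X) (gd X))"

definition canonical_comp :: "('u::infinite monoid, 'u ab_arr) igpd \<Rightarrow> 'u ab_arr" where
  "canonical_comp X = ab_arr (gpairs X) (G1 X) (\<lambda>w. pb1 Ab (gc X) (gd X) \<bullet> w \<otimes>\<^bsub>G1 X\<^esub>
     inv\<^bsub>G1 X\<^esub> (ge X \<bullet> (gc X \<bullet> (pb1 Ab (gc X) (gd X) \<bullet> w))) \<otimes>\<^bsub>G1 X\<^esub> pb2 Ab (gc X) (gd X) \<bullet> w)"

lemma canonical_comp_Hom:
  assumes X: "refl_graph X"
  shows "canonical_comp X \<in> Hom Ab (gpairs X) (G1 X)"
proof -
  note d = refl_graphD[OF X]
  note p = Ab_pb(2,3)[OF d(2,1)]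
  interpret G1: comm_group "G1 X" by (rule d(7))
  have "comm_group (gpairs X)" using Ab_Hom_group[OF p(1)] by simp
  then show ?thesis
    unfolding canonical_comp_def
    by (rule ab_arr_Hom[OF _ d(7)])
      (simp_all add: Ab_closed[OF d(2)] Ab_closed[OF d(3)] Ab_closed[OF p(1)] Ab_closed[OF p(2)]
        Ab_mult[OF d(2)] Ab_mult[OF d(3)] Ab_mult[OF p(1)] Ab_mult[OF p(2)] G1.inv_mult G1.m_ac)
qed

text \<open>In abelian groups the composite of \<open>f : x \<rightarrow> y\<close> and \<open>g : y \<rightarrow> z\<close> can only be \<open>f - 1\<^sub>y + g\<close>: as
  composition is a homomorphism, it is determined by its values on \<open>(f, 1\<^sub>y)\<close>, \<open>(1\<^sub>y, 1\<^sub>y)\<close> and \<open>(1\<^sub>y, g)\<close>.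
  Conversely this formula makes every reflexive graph a groupoid.\<close>

theorem internal_groupoid_Ab_iff:
  "internal_groupoid Ab X \<longleftrightarrow> refl_graph X \<and> gm X = canonical_comp X"
proof
  assume "internal_groupoid Ab X"
  then have cat: "internal_category Ab X" by (simp add: internal_groupoid_def)
  define d c e m where "d = gd X" and "c = gc X" and "e = ge X" and "m = gm X"
  have d: "d \<in> Hom Ab (G1 X) (G0 X)" and c: "c \<in> Hom Ab (G1 X) (G0 X)" and e: "e \<in> Hom Ab (G0 X) (G1 X)"
    and m: "m \<in> Hom Ab (gpairs X) (G1 X)" and de: "d \<cdot>\<^bsub>Ab\<^esub> e = Ide Ab (G0 X)" "c \<cdot>\<^bsub>Ab\<^esub> e = Ide Ab (G0 X)"
    and m1: "m \<cdot>\<^bsub>Ab\<^esub> tup Ab c d (e \<cdot>\<^bsub>Ab\<^esub> d) (Ide Ab (G1 X)) = Ide Ab (G1 X)"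
    and m2: "m \<cdot>\<^bsub>Ab\<^esub> tup Ab c d (Ide Ab (G1 X)) (e \<cdot>\<^bsub>Ab\<^esub> c) = Ide Ab (G1 X)"
    using cat unfolding internal_category_def Let_def d_def c_def e_def m_def by blast+
  interpret G0: comm_group "G0 X" using Ab_Hom_group[OF d] by simp
  interpret G1: comm_group "G1 X" using Ab_Hom_group[OF d] by simp
  have de': "d \<bullet> (e \<bullet> x) = x" "c \<bullet> (e \<bullet> x) = x" if "x \<in> carrier (G0 X)" for x
    using Ab_eqD1[OF de(1) e that] Ab_eqD1[OF de(2) e that] that by simp_all
  have rg: "refl_graph X"
    using d c e de' by (simp add: refl_graph_def d_def c_def e_def)
  have I: "Ide Ab (G1 X) \<in> Hom Ab (G1 X) (G1 X)" by (rule Ab_Ide[OF G1.comm_group_axioms])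
  have ed: "e \<cdot>\<^bsub>Ab\<^esub> d \<in> Hom Ab (G1 X) (G1 X)" and ec: "e \<cdot>\<^bsub>Ab\<^esub> c \<in> Hom Ab (G1 X) (G1 X)"
    using Ab_comp d c e by blast+
  have "c \<cdot>\<^bsub>Ab\<^esub> (e \<cdot>\<^bsub>Ab\<^esub> d) = d \<cdot>\<^bsub>Ab\<^esub> Ide Ab (G1 X)"
    by (rule Ab_eqI[OF ed I c d]) (simp add: Ab_comp_app[OF d] de' Ab_closed[OF d])
  note t1 = Ab_tup[OF c d ed I this]
  have "c \<cdot>\<^bsub>Ab\<^esub> Ide Ab (G1 X) = d \<cdot>\<^bsub>Ab\<^esub> (e \<cdot>\<^bsub>Ab\<^esub> c)"
    by (rule Ab_eqI[OF I ec c d]) (simp add: Ab_comp_app[OF c] de' Ab_closed[OF c])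
  note t2 = Ab_tup[OF c d I ec this]
  note p = Ab_pb[OF c d]
  interpret P: comm_group "gpairs X" using Ab_Hom_group[OF m] by simp
  define a b where "a = tup Ab c d (e \<cdot>\<^bsub>Ab\<^esub> d) (Ide Ab (G1 X))"
    and "b = tup Ab c d (Ide Ab (G1 X)) (e \<cdot>\<^bsub>Ab\<^esub> c)"
  note t1 = t1[folded a_def] and t2 = t2[folded b_def] and m1 = m1[folded a_def] and m2 = m2[folded b_def]
  have gp: "Dom Ab (pb1 Ab c d) = gpairs X" by (simp add: c_def d_def)
  note t1 = t1[unfolded gp] and t2 = t2[unfolded gp] and p = p[unfolded gp]
  have "m = canonical_comp X"
  proof (rule Ab_ext[OF m canonical_comp_Hom[OF rg]])
    fix w assume w: "w \<in> carrier (gpairs X)"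
    define f g where "f = pb1 Ab c d \<bullet> w" and "g = pb2 Ab c d \<bullet> w"
    have f: "f \<in> carrier (G1 X)" and g: "g \<in> carrier (G1 X)" and fg: "c \<bullet> f = d \<bullet> g"
      using Ab_closed[OF p(2) w] Ab_closed[OF p(3) w] Ab_eqD[OF p(4,2,3) w] by (simp_all add: f_def g_def)
    have y: "e \<bullet> (c \<bullet> f) \<in> carrier (G1 X)" "c \<bullet> f \<in> carrier (G0 X)" "d \<bullet> g \<in> carrier (G0 X)"
      using Ab_closed[OF e] Ab_closed[OF c] Ab_closed[OF d] f g by blast+
    have abf: "b \<bullet> f \<in> carrier (gpairs X)" "b \<bullet> (e \<bullet> (c \<bullet> f)) \<in> carrier (gpairs X)" "a \<bullet> g \<in> carrier (gpairs X)"
      using Ab_closed[OF t2(1)] Ab_closed[OF t1(1)] f g y by blast+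
    let ?w = "b \<bullet> f \<otimes>\<^bsub>gpairs X\<^esub> inv\<^bsub>gpairs X\<^esub> (b \<bullet> (e \<bullet> (c \<bullet> f))) \<otimes>\<^bsub>gpairs X\<^esub> a \<bullet> g"
    have "w = ?w"
    proof (rule Ab_pullback_injective[OF p(1-3) w])
      show "?w \<in> carrier (gpairs X)" using abf by simp
      show "pb1 Ab c d \<bullet> w = pb1 Ab c d \<bullet> ?w"
        using abf f g y fg
        by (simp add: Ab_mult[OF p(2)] Ab_inv[OF p(2)] t1 t2 Ab_comp_app[OF d] G1.m_assoc flip: f_def)
      show "pb2 Ab c d \<bullet> w = pb2 Ab c d \<bullet> ?w"
        using abf f g y fg
        by (simp add: Ab_mult[OF p(3)] Ab_inv[OF p(3)] t1 t2 Ab_comp_app[OF c] de' flip: g_def)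
    qed
    moreover have "m \<bullet> ?w = f \<otimes>\<^bsub>G1 X\<^esub> inv\<^bsub>G1 X\<^esub> (e \<bullet> (c \<bullet> f)) \<otimes>\<^bsub>G1 X\<^esub> g"
      using abf f g y
      by (simp add: Ab_mult[OF m] Ab_inv[OF m] Ab_eqD1[OF m1 t1(1)] Ab_eqD1[OF m2 t2(1)])
    ultimately show "m \<bullet> w = canonical_comp X \<bullet> w"
      using w by (simp add: canonical_comp_def f_def g_def c_def d_def e_def)
  qed
  then show "refl_graph X \<and> gm X = canonical_comp X" using rg by (simp add: m_def)
next
  assume "refl_graph X \<and> gm X = canonical_comp X"
  then have rg: "refl_graph X" and gm: "gm X = canonical_comp X" by auto
  define d c e m where "d = gd X" and "c = gc X" and "e = ge X" and "m = gm X"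
  note * = refl_graphD[OF rg, folded d_def c_def e_def]
  note d = *(1) and c = *(2) and e = *(3) and de = *(4,5)
  interpret G0: comm_group "G0 X" by (rule *)
  interpret G1: comm_group "G1 X" by (rule *)
  have m: "m \<in> Hom Ab (gpairs X) (G1 X)" unfolding m_def gm by (rule canonical_comp_Hom[OF rg])
  note p = Ab_pb[OF c d]
  have gp: "Dom Ab (pb1 Ab c d) = gpairs X" by (simp add: c_def d_def)
  note p = p[unfolded gp]
  define p1 p2 where "p1 = pb1 Ab c d" and "p2 = pb2 Ab c d"
  note p = p[folded p1_def p2_def]
  have ma: "m \<bullet> w = p1 \<bullet> w \<otimes>\<^bsub>G1 X\<^esub> inv\<^bsub>G1 X\<^esub> (e \<bullet> (c \<bullet> (p1 \<bullet> w))) \<otimes>\<^bsub>G1 X\<^esub> p2 \<bullet> w"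
    if "w \<in> carrier (gpairs X)" for w
    using that unfolding m_def gm canonical_comp_def c_def d_def e_def p1_def p2_def by simp
  note cl = Ab_closed[OF d] Ab_closed[OF c] Ab_closed[OF e] Ab_closed[OF p(2)] Ab_closed[OF p(3)]
  have pe: "c \<bullet> (p1 \<bullet> w) = d \<bullet> (p2 \<bullet> w)" if "w \<in> carrier (gpairs X)" for w
    using Ab_eqD[OF p(4,2,3) that] .
  have I: "Ide Ab (G1 X) \<in> Hom Ab (G1 X) (G1 X)" by (rule Ab_Ide[OF G1.comm_group_axioms])
  have ed: "e \<cdot>\<^bsub>Ab\<^esub> d \<in> Hom Ab (G1 X) (G1 X)" and ec: "e \<cdot>\<^bsub>Ab\<^esub> c \<in> Hom Ab (G1 X) (G1 X)"
    using Ab_comp d c e by blast+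
  have mtup: "(m \<cdot>\<^bsub>Ab\<^esub> tup Ab c d u v) \<bullet> z = u \<bullet> z \<otimes>\<^bsub>G1 X\<^esub> inv\<^bsub>G1 X\<^esub> (e \<bullet> (c \<bullet> (u \<bullet> z))) \<otimes>\<^bsub>G1 X\<^esub> v \<bullet> z"
    and mtup_Hom: "m \<cdot>\<^bsub>Ab\<^esub> tup Ab c d u v \<in> Hom Ab Z (G1 X)"
    if "u \<in> Hom Ab Z (G1 X)" "v \<in> Hom Ab Z (G1 X)" "\<And>z. z \<in> carrier Z \<Longrightarrow> c \<bullet> (u \<bullet> z) = d \<bullet> (v \<bullet> z)" "z \<in> carrier Z"
    for u v Z z
  proof -
    have "c \<cdot>\<^bsub>Ab\<^esub> u = d \<cdot>\<^bsub>Ab\<^esub> v" by (rule Ab_eqI[OF that(1,2) c d that(3)])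
    note t = Ab_tup[OF c d that(1,2) this, unfolded gp, folded p1_def p2_def]
    show "(m \<cdot>\<^bsub>Ab\<^esub> tup Ab c d u v) \<bullet> z = u \<bullet> z \<otimes>\<^bsub>G1 X\<^esub> inv\<^bsub>G1 X\<^esub> (e \<bullet> (c \<bullet> (u \<bullet> z))) \<otimes>\<^bsub>G1 X\<^esub> v \<bullet> z"
      using that(4) by (simp add: Ab_comp_app[OF t(1)] ma Ab_closed[OF t(1)] t)
    show "m \<cdot>\<^bsub>Ab\<^esub> tup Ab c d u v \<in> Hom Ab Z (G1 X)" by (rule Ab_comp[OF t(1) m])
  qed
  have "internal_category Ab X"
    unfolding internal_category_def Let_def
    unfolding d_def[symmetric] c_def[symmetric] e_def[symmetric] m_def[symmetric]
    unfolding p1_def[symmetric] p2_def[symmetric]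
  proof (intro conjI)
    show "G0 X \<in> Obj Ab" "G1 X \<in> Obj Ab" using * by simp_all
    show "m \<in> Hom Ab (Dom Ab p1) (G1 X)" using m by (simp add: p1_def gp)
    show "d \<cdot>\<^bsub>Ab\<^esub> e = Ide Ab (G0 X)" "c \<cdot>\<^bsub>Ab\<^esub> e = Ide Ab (G0 X)"
      using Ab_Ide[OF *(6)] by (auto intro!: Ab_eqI1[OF e] d c simp: de)
    show "d \<cdot>\<^bsub>Ab\<^esub> m = d \<cdot>\<^bsub>Ab\<^esub> p1"
      by (rule Ab_eqI[OF m p(2) d d]) (simp add: ma cl Ab_mult[OF d] Ab_inv[OF d] de pe G0.m_assoc)
    show "c \<cdot>\<^bsub>Ab\<^esub> m = c \<cdot>\<^bsub>Ab\<^esub> p2"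
      by (rule Ab_eqI[OF m p(3) c c]) (simp add: ma cl Ab_mult[OF c] Ab_inv[OF c] de)
    show "m \<cdot>\<^bsub>Ab\<^esub> tup Ab c d (e \<cdot>\<^bsub>Ab\<^esub> d) (Ide Ab (G1 X)) = Ide Ab (G1 X)"
    proof -
      have eq: "c \<bullet> ((e \<cdot>\<^bsub>Ab\<^esub> d) \<bullet> z) = d \<bullet> (Ide Ab (G1 X) \<bullet> z)" if "z \<in> carrier (G1 X)" for z
        using that by (simp add: Ab_comp_app[OF d] de cl)
      show ?thesis
        by (rule Ab_ext[OF mtup_Hom[OF ed I eq G1.one_closed] I])
          (simp_all add: mtup[OF ed I eq] Ab_comp_app[OF d] de cl)
    qed
    show "m \<cdot>\<^bsub>Ab\<^esub> tup Ab c d (Ide Ab (G1 X)) (e \<cdot>\<^bsub>Ab\<^esub> c) = Ide Ab (G1 X)"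
    proof -
      have eq: "c \<bullet> (Ide Ab (G1 X) \<bullet> z) = d \<bullet> ((e \<cdot>\<^bsub>Ab\<^esub> c) \<bullet> z)" if "z \<in> carrier (G1 X)" for z
        using that by (simp add: Ab_comp_app[OF c] de cl)
      show ?thesis
        by (rule Ab_ext[OF mtup_Hom[OF I ec eq G1.one_closed] I])
          (simp_all add: mtup[OF I ec eq] Ab_comp_app[OF c] de cl G1.m_assoc)
    qed
    let ?r1 = "pb1 Ab p2 p1" and ?r2 = "pb2 Ab p2 p1"
    note r = Ab_pb[OF p(3,2)]
    let ?R = "Dom Ab ?r1"
    interpret R: comm_group ?R using Ab_Hom_group[OF r(2)] by simp
    have re: "p2 \<bullet> (?r1 \<bullet> z) = p1 \<bullet> (?r2 \<bullet> z)" if "z \<in> carrier ?R" for z using Ab_eqD[OF r(4,2,3) that] .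
    have H: "m \<cdot>\<^bsub>Ab\<^esub> ?r1 \<in> Hom Ab ?R (G1 X)" "p2 \<cdot>\<^bsub>Ab\<^esub> ?r2 \<in> Hom Ab ?R (G1 X)"
      "p1 \<cdot>\<^bsub>Ab\<^esub> ?r1 \<in> Hom Ab ?R (G1 X)" "m \<cdot>\<^bsub>Ab\<^esub> ?r2 \<in> Hom Ab ?R (G1 X)"
      using Ab_comp m p r by blast+
    note app = Ab_comp_app[OF r(2)] Ab_comp_app[OF r(3)]
    note rcl = Ab_closed[OF r(2)] Ab_closed[OF r(3)]
    have cm: "c \<bullet> (m \<bullet> w) = c \<bullet> (p2 \<bullet> w)" and dm: "d \<bullet> (m \<bullet> w) = d \<bullet> (p1 \<bullet> w)" if "w \<in> carrier (gpairs X)" for w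
      using that by (simp_all add: ma cl Ab_mult[OF c] Ab_inv[OF c] Ab_mult[OF d] Ab_inv[OF d] de pe G0.m_assoc)
    have eq1: "c \<bullet> ((m \<cdot>\<^bsub>Ab\<^esub> ?r1) \<bullet> z) = d \<bullet> ((p2 \<cdot>\<^bsub>Ab\<^esub> ?r2) \<bullet> z)" if "z \<in> carrier ?R" for z
      using that by (simp add: app cm rcl re pe)
    have eq2: "c \<bullet> ((p1 \<cdot>\<^bsub>Ab\<^esub> ?r1) \<bullet> z) = d \<bullet> ((m \<cdot>\<^bsub>Ab\<^esub> ?r2) \<bullet> z)" if "z \<in> carrier ?R" for z
      using that by (simp add: app dm rcl re pe)
    show "m \<cdot>\<^bsub>Ab\<^esub> tup Ab c d (m \<cdot>\<^bsub>Ab\<^esub> ?r1) (p2 \<cdot>\<^bsub>Ab\<^esub> ?r2) =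
      m \<cdot>\<^bsub>Ab\<^esub> tup Ab c d (p1 \<cdot>\<^bsub>Ab\<^esub> ?r1) (m \<cdot>\<^bsub>Ab\<^esub> ?r2)"
    proof (rule Ab_ext[OF mtup_Hom[OF H(1,2) eq1 R.one_closed] mtup_Hom[OF H(3,4) eq2 R.one_closed]])
      fix z assume z: "z \<in> carrier ?R"
      show "(m \<cdot>\<^bsub>Ab\<^esub> tup Ab c d (m \<cdot>\<^bsub>Ab\<^esub> ?r1) (p2 \<cdot>\<^bsub>Ab\<^esub> ?r2)) \<bullet> z =
        (m \<cdot>\<^bsub>Ab\<^esub> tup Ab c d (p1 \<cdot>\<^bsub>Ab\<^esub> ?r1) (m \<cdot>\<^bsub>Ab\<^esub> ?r2)) \<bullet> z"
        using z by (simp add: mtup[OF H(1,2) eq1] mtup[OF H(3,4) eq2] app cm rcl)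
          (simp add: ma rcl cl re G1.m_assoc)
    qed
  qed (rule d c e)+
  moreover have "\<exists>i \<in> Hom Ab (G1 X) (G1 X). d \<cdot>\<^bsub>Ab\<^esub> i = c \<and> c \<cdot>\<^bsub>Ab\<^esub> i = d \<and>
        m \<cdot>\<^bsub>Ab\<^esub> tup Ab c d (Ide Ab (G1 X)) i = e \<cdot>\<^bsub>Ab\<^esub> d \<and>
        m \<cdot>\<^bsub>Ab\<^esub> tup Ab c d i (Ide Ab (G1 X)) = e \<cdot>\<^bsub>Ab\<^esub> c"
  proof -
    \<comment> \<open>The inverse of \<open>x : a \<rightarrow> b\<close> is \<open>1\<^sub>a - x + 1\<^sub>b\<close>.\<close>
    define i where "i = ab_arr (G1 X) (G1 X) (\<lambda>x. e \<bullet> (d \<bullet> x) \<otimes>\<^bsub>G1 X\<^esub> inv\<^bsub>G1 X\<^esub> x \<otimes>\<^bsub>G1 X\<^esub> e \<bullet> (c \<bullet> x))"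
    have i: "i \<in> Hom Ab (G1 X) (G1 X)"
      unfolding i_def
      by (rule ab_arr_Hom)
        (simp_all add: *(7) cl Ab_mult[OF d] Ab_mult[OF c] Ab_mult[OF e] G1.inv_mult G1.m_ac)
    have ia: "i \<bullet> x = e \<bullet> (d \<bullet> x) \<otimes>\<^bsub>G1 X\<^esub> inv\<^bsub>G1 X\<^esub> x \<otimes>\<^bsub>G1 X\<^esub> e \<bullet> (c \<bullet> x)" if "x \<in> carrier (G1 X)" for x
      using that by (simp add: i_def)
    have di: "d \<bullet> (i \<bullet> x) = c \<bullet> x" and ci: "c \<bullet> (i \<bullet> x) = d \<bullet> x" if "x \<in> carrier (G1 X)" for x
      using that by (simp_all add: ia cl Ab_mult[OF d] Ab_mult[OF c] Ab_inv[OF d] Ab_inv[OF c] de G0.m_assoc)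
    have eq1: "c \<bullet> (Ide Ab (G1 X) \<bullet> z) = d \<bullet> (i \<bullet> z)" and eq2: "c \<bullet> (i \<bullet> z) = d \<bullet> (Ide Ab (G1 X) \<bullet> z)"
      if "z \<in> carrier (G1 X)" for z using that by (simp_all add: di ci)
    have cancel: "x \<otimes>\<^bsub>G1 X\<^esub> (inv\<^bsub>G1 X\<^esub> y \<otimes>\<^bsub>G1 X\<^esub> (z \<otimes>\<^bsub>G1 X\<^esub> (inv\<^bsub>G1 X\<^esub> x \<otimes>\<^bsub>G1 X\<^esub> y))) = z"
      if "x \<in> carrier (G1 X)" "y \<in> carrier (G1 X)" "z \<in> carrier (G1 X)" for x y z
    proof -
      have "x \<otimes>\<^bsub>G1 X\<^esub> (inv\<^bsub>G1 X\<^esub> y \<otimes>\<^bsub>G1 X\<^esub> (z \<otimes>\<^bsub>G1 X\<^esub> (inv\<^bsub>G1 X\<^esub> x \<otimes>\<^bsub>G1 X\<^esub> y))) =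
        z \<otimes>\<^bsub>G1 X\<^esub> ((x \<otimes>\<^bsub>G1 X\<^esub> inv\<^bsub>G1 X\<^esub> x) \<otimes>\<^bsub>G1 X\<^esub> (y \<otimes>\<^bsub>G1 X\<^esub> inv\<^bsub>G1 X\<^esub> y))"
        using that by (simp only: G1.m_ac G1.inv_closed G1.m_closed)
      then show ?thesis using that by simp
    qed
    show ?thesis
    proof (rule bexI[OF _ i], intro conjI)
      show "d \<cdot>\<^bsub>Ab\<^esub> i = c" by (rule Ab_eqI1[OF i d c di])
      show "c \<cdot>\<^bsub>Ab\<^esub> i = d" by (rule Ab_eqI1[OF i c d ci])
      show "m \<cdot>\<^bsub>Ab\<^esub> tup Ab c d (Ide Ab (G1 X)) i = e \<cdot>\<^bsub>Ab\<^esub> d"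
      proof (rule Ab_ext[OF mtup_Hom[OF I i eq1 G1.one_closed] ed])
        fix x assume x: "x \<in> carrier (G1 X)"
        have "x \<otimes>\<^bsub>G1 X\<^esub> inv\<^bsub>G1 X\<^esub> (e \<bullet> (c \<bullet> x)) \<otimes>\<^bsub>G1 X\<^esub> i \<bullet> x = e \<bullet> (d \<bullet> x)"
          using x cancel[of x "e \<bullet> (c \<bullet> x)" "e \<bullet> (d \<bullet> x)"] by (simp add: ia cl G1.m_assoc)
        then show "(m \<cdot>\<^bsub>Ab\<^esub> tup Ab c d (Ide Ab (G1 X)) i) \<bullet> x = (e \<cdot>\<^bsub>Ab\<^esub> d) \<bullet> x"
          using x by (simp add: mtup[OF I i eq1] Ab_comp_app[OF d])
      qed
      show "m \<cdot>\<^bsub>Ab\<^esub> tup Ab c d i (Ide Ab (G1 X)) = e \<cdot>\<^bsub>Ab\<^esub> c"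
      proof (rule Ab_ext[OF mtup_Hom[OF i I eq2 G1.one_closed] ec])
        fix x assume x: "x \<in> carrier (G1 X)"
        have "i \<bullet> x \<otimes>\<^bsub>G1 X\<^esub> inv\<^bsub>G1 X\<^esub> (e \<bullet> (d \<bullet> x)) \<otimes>\<^bsub>G1 X\<^esub> x = e \<bullet> (c \<bullet> x)"
          using x cancel[of "x" "e \<bullet> (d \<bullet> x)" "e \<bullet> (c \<bullet> x)"] by (simp add: ia cl G1.m_ac)
        then show "(m \<cdot>\<^bsub>Ab\<^esub> tup Ab c d i (Ide Ab (G1 X))) \<bullet> x = (e \<cdot>\<^bsub>Ab\<^esub> c) \<bullet> x"
          using x by (simp add: mtup[OF i I eq2] Ab_comp_app[OF c] ci)
      qed
    qed
  qed
  ultimately show "internal_groupoid Ab X"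
    by (simp add: internal_groupoid_def d_def c_def e_def m_def)
qed

lemma internal_groupoidD:
  assumes "internal_groupoid Ab X"
  shows "refl_graph X" "gm X = canonical_comp X"
  using assms by (simp_all add: internal_groupoid_Ab_iff)

text \<open>As composition is given by a formula in the group structure and the reflexive graph,
  homomorphisms of reflexive graphs preserve it.\<close>

theorem Gpd_Hom:
  fixes X Y :: "('u::infinite monoid, 'u ab_arr) igpd"
  shows "H \<in> Hom (Gpd Ab) X Y \<longleftrightarrow> Src H = X \<and> Tgt H = Y \<and> internal_groupoid Ab X \<and> internal_groupoid Ab Y \<and>
     F0 H \<in> Hom Ab (G0 X) (G0 Y) \<and> F1 H \<in> Hom Ab (G1 X) (G1 Y) \<and>
     (\<forall>x \<in> carrier (G1 X). gd Y \<bullet> (F1 H \<bullet> x) = F0 H \<bullet> (gd X \<bullet> x) \<and>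
        gc Y \<bullet> (F1 H \<bullet> x) = F0 H \<bullet> (gc X \<bullet> x)) \<and>
     (\<forall>x \<in> carrier (G0 X). F1 H \<bullet> (ge X \<bullet> x) = ge Y \<bullet> (F0 H \<bullet> x))" (is "_ \<longleftrightarrow> ?R")
proof
  assume "H \<in> Hom (Gpd Ab) X Y"
  then have H: "Src H = X" "Tgt H = Y" "internal_groupoid Ab X" "internal_groupoid Ab Y" "internal_functor Ab H"
    by (auto simp: Gpd_def Hom_iff)
  note x = refl_graphD[OF internal_groupoidD(1)[OF H(3)]] and y = refl_graphD[OF internal_groupoidD(1)[OF H(4)]]
  have F: "F0 H \<in> Hom Ab (G0 X) (G0 Y)" "F1 H \<in> Hom Ab (G1 X) (G1 Y)"
    "gd Y \<cdot>\<^bsub>Ab\<^esub> F1 H = F0 H \<cdot>\<^bsub>Ab\<^esub> gd X" "gc Y \<cdot>\<^bsub>Ab\<^esub> F1 H = F0 H \<cdot>\<^bsub>Ab\<^esub> gc X"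
    "F1 H \<cdot>\<^bsub>Ab\<^esub> ge X = ge Y \<cdot>\<^bsub>Ab\<^esub> F0 H"
    using H unfolding internal_functor_def Let_def by auto
  show ?R
    using H F(1,2) Ab_eqD[OF F(3) F(2) x(1)] Ab_eqD[OF F(4) F(2) x(2)] Ab_eqD[OF F(5) x(3) F(1)] by blast
next
  assume R: ?R
  then have H: "Src H = X" "Tgt H = Y" "internal_groupoid Ab X" "internal_groupoid Ab Y" by auto
  note X = internal_groupoidD[OF H(3)] and Y = internal_groupoidD[OF H(4)]
  note x = refl_graphD[OF X(1)] and y = refl_graphD[OF Y(1)]
  interpret X1: comm_group "G1 X" by (rule x)
  interpret Y1: comm_group "G1 Y" by (rule y)
  have F: "F0 H \<in> Hom Ab (G0 X) (G0 Y)" "F1 H \<in> Hom Ab (G1 X) (G1 Y)" using R by auto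
  have e: "gd Y \<bullet> (F1 H \<bullet> z) = F0 H \<bullet> (gd X \<bullet> z)" "gc Y \<bullet> (F1 H \<bullet> z) = F0 H \<bullet> (gc X \<bullet> z)"
    if "z \<in> carrier (G1 X)" for z using R that by auto
  have e': "F1 H \<bullet> (ge X \<bullet> z) = ge Y \<bullet> (F0 H \<bullet> z)" if "z \<in> carrier (G0 X)" for z using R that by auto
  let ?p1 = "pb1 Ab (gc X) (gd X)" and ?p2 = "pb2 Ab (gc X) (gd X)"
  note p = Ab_pb[OF x(2,1)]
  have u: "F1 H \<cdot>\<^bsub>Ab\<^esub> ?p1 \<in> Hom Ab (gpairs X) (G1 Y)" "F1 H \<cdot>\<^bsub>Ab\<^esub> ?p2 \<in> Hom Ab (gpairs X) (G1 Y)"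
    using Ab_comp p F by blast+
  note pa = Ab_comp_app[OF p(2)] Ab_comp_app[OF p(3)] and pc = Ab_closed[OF p(2)] Ab_closed[OF p(3)]
  have "gc Y \<cdot>\<^bsub>Ab\<^esub> (F1 H \<cdot>\<^bsub>Ab\<^esub> ?p1) = gd Y \<cdot>\<^bsub>Ab\<^esub> (F1 H \<cdot>\<^bsub>Ab\<^esub> ?p2)"
    by (rule Ab_eqI[OF u y(2,1)]) (simp add: pa e pc Ab_eqD[OF p(4,2,3)])
  note t = Ab_tup[OF y(2,1) u this]
  have gmX: "gm X \<in> Hom Ab (gpairs X) (G1 X)" and gmY: "gm Y \<in> Hom Ab (gpairs Y) (G1 Y)"
    unfolding X(2) Y(2) by (rule canonical_comp_Hom[OF X(1)], rule canonical_comp_Hom[OF Y(1)])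
  have "F1 H \<cdot>\<^bsub>Ab\<^esub> gm X = gm Y \<cdot>\<^bsub>Ab\<^esub> tup Ab (gc Y) (gd Y) (F1 H \<cdot>\<^bsub>Ab\<^esub> ?p1) (F1 H \<cdot>\<^bsub>Ab\<^esub> ?p2)"
  proof (rule Ab_eqI[OF gmX t(1) F(2) gmY])
    fix w assume w: "w \<in> carrier (gpairs X)"
    show "F1 H \<bullet> (gm X \<bullet> w) = gm Y \<bullet> (tup Ab (gc Y) (gd Y) (F1 H \<cdot>\<^bsub>Ab\<^esub> ?p1) (F1 H \<cdot>\<^bsub>Ab\<^esub> ?p2) \<bullet> w)"
      unfolding X(2) Y(2) canonical_comp_def
      using w by (simp add: Ab_closed[OF t(1)] t pa pc Ab_mult[OF F(2)] Ab_inv[OF F(2)] e e'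
          Ab_closed[OF x(2)] Ab_closed[OF x(3)])
  qed
  moreover have "gd Y \<cdot>\<^bsub>Ab\<^esub> F1 H = F0 H \<cdot>\<^bsub>Ab\<^esub> gd X" by (rule Ab_eqI[OF F(2) x(1) y(1) F(1) e(1)])
  moreover have "gc Y \<cdot>\<^bsub>Ab\<^esub> F1 H = F0 H \<cdot>\<^bsub>Ab\<^esub> gc X" by (rule Ab_eqI[OF F(2) x(2) y(2) F(1) e(2)])
  moreover have "F1 H \<cdot>\<^bsub>Ab\<^esub> ge X = ge Y \<cdot>\<^bsub>Ab\<^esub> F0 H" by (rule Ab_eqI[OF x(3) F(1) F(2) y(3) e'])
  ultimately have "internal_functor Ab H"
    using F H(1,2) unfolding internal_functor_def Let_def by simp
  then show "H \<in> Hom (Gpd Ab) X Y" using H by (simp add: Gpd_def Hom_iff)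
qed

lemma Gpd_HomD:
  fixes X Y :: "('u::infinite monoid, 'u ab_arr) igpd"
  assumes "H \<in> Hom (Gpd Ab) X Y"
  shows "F0 H \<in> Hom Ab (G0 X) (G0 Y)" "F1 H \<in> Hom Ab (G1 X) (G1 Y)"
    "x \<in> carrier (G1 X) \<Longrightarrow> gd Y \<bullet> (F1 H \<bullet> x) = F0 H \<bullet> (gd X \<bullet> x)"
    "x \<in> carrier (G1 X) \<Longrightarrow> gc Y \<bullet> (F1 H \<bullet> x) = F0 H \<bullet> (gc X \<bullet> x)"
    "z \<in> carrier (G0 X) \<Longrightarrow> F1 H \<bullet> (ge X \<bullet> z) = ge Y \<bullet> (F0 H \<bullet> z)"
    "internal_groupoid Ab X" "internal_groupoid Ab Y" "refl_graph X" "refl_graph Y" "Src H = X" "Tgt H = Y"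
  using assms unfolding Gpd_Hom by (auto dest: internal_groupoidD)

lemma Gpd_Obj [simp]: "X \<in> Obj (Gpd C) \<longleftrightarrow> internal_groupoid C X"
  by (simp add: Gpd_def)

lemma Gpd_Comp [simp]: "F0 (G \<cdot>\<^bsub>Gpd C\<^esub> F) = F0 G \<cdot>\<^bsub>C\<^esub> F0 F" "F1 (G \<cdot>\<^bsub>Gpd C\<^esub> F) = F1 G \<cdot>\<^bsub>C\<^esub> F1 F"
  "Src (G \<cdot>\<^bsub>Gpd C\<^esub> F) = Src F" "Tgt (G \<cdot>\<^bsub>Gpd C\<^esub> F) = Tgt G"
  by (simp_all add: Gpd_def)

lemma Gpd_Ide [simp]: "F0 (Ide (Gpd C) X) = Ide C (G0 X)" "F1 (Ide (Gpd C) X) = Ide C (G1 X)"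
  "Src (Ide (Gpd C) X) = X" "Tgt (Ide (Gpd C) X) = X"
  by (simp_all add: Gpd_def)

lemma Gpd_ext:
  fixes X Y :: "('u::infinite monoid, 'u ab_arr) igpd"
  assumes "H \<in> Hom (Gpd Ab) X Y" "H' \<in> Hom (Gpd Ab) X Y" "F0 H = F0 H'" "F1 H = F1 H'"
  shows "H = H'"
  using assms Gpd_HomD(10,11) by (metis ifun.equality old.unit.exhaust)

lemma category_Gpd_Ab: "category (Gpd (Ab :: ('u::infinite monoid, 'u ab_arr) cat))" (is "category ?G")
proof -
  have comp: "G \<cdot>\<^bsub>?G\<^esub> F \<in> Hom ?G X Z" if F: "F \<in> Hom ?G X Y" and G: "G \<in> Hom ?G Y Z" for F G X Y Z
  proof -
    note f = Gpd_HomD[OF F] and g = Gpd_HomD[OF G]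
    show ?thesis
      unfolding Gpd_Hom
      using f(6,10) g(7,11) Ab_comp[OF f(1) g(1)] Ab_comp[OF f(2) g(2)]
      by (simp add: Ab_comp_app[OF f(1)] Ab_comp_app[OF f(2)] f(3-5) g(3-5) Ab_closed[OF f(1)]
          Ab_closed[OF f(2)] Ab_closed[OF refl_graphD(1)[OF f(8)]] Ab_closed[OF refl_graphD(2)[OF f(8)]]
          Ab_closed[OF refl_graphD(3)[OF f(8)]])
  qed
  have ide: "Ide ?G X \<in> Hom ?G X X" if X: "internal_groupoid Ab X" for X
  proof -
    note x = refl_graphD[OF internal_groupoidD(1)[OF X]]
    show ?thesis
      unfolding Gpd_Hom using X Ab_Ide[OF x(6)] Ab_Ide[OF x(7)]
      by (simp add: Ab_closed[OF x(1)] Ab_closed[OF x(2)] Ab_closed[OF x(3)])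
  qed
  have obj: "internal_groupoid Ab (Dom ?G F) \<and> internal_groupoid Ab (Cod ?G F)" if "F \<in> Arr ?G" for F
    using that by (simp add: Gpd_def)
  show ?thesis
    unfolding category_def
  proof (intro conjI ballI impI)
    fix F assume F: "F \<in> Arr ?G"
    note f = Gpd_HomD[OF Arr_Hom[OF F]]
    show "F \<cdot>\<^bsub>?G\<^esub> Ide ?G (Dom ?G F) = F"
      by (rule Gpd_ext[OF comp[OF ide Arr_Hom[OF F]] Arr_Hom[OF F]])
        (use obj[OF F] category_Ide_right[OF category_Ab f(1)] category_Ide_right[OF category_Ab f(2)] in simp_all)
    show "Ide ?G (Cod ?G F) \<cdot>\<^bsub>?G\<^esub> F = F"
      by (rule Gpd_ext[OF comp[OF Arr_Hom[OF F] ide] Arr_Hom[OF F]])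
        (use obj[OF F] category_Ide_left[OF category_Ab f(1)] category_Ide_left[OF category_Ab f(2)] in simp_all)
  next
    fix F G H assume "F \<in> Arr ?G" "G \<in> Arr ?G" "H \<in> Arr ?G" "Cod ?G F = Dom ?G G" "Cod ?G G = Dom ?G H"
    then have F: "F \<in> Hom ?G (Dom ?G F) (Dom ?G G)" and G: "G \<in> Hom ?G (Dom ?G G) (Dom ?G H)"
      and H: "H \<in> Hom ?G (Dom ?G H) (Cod ?G H)" by (simp_all add: Hom_iff)
    show "H \<cdot>\<^bsub>?G\<^esub> (G \<cdot>\<^bsub>?G\<^esub> F) = (H \<cdot>\<^bsub>?G\<^esub> G) \<cdot>\<^bsub>?G\<^esub> F"
      by (rule Gpd_ext[OF comp[OF comp[OF F G] H] comp[OF F comp[OF G H]]])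
        (simp_all add: category_assoc[OF category_Ab Gpd_HomD(1)[OF F] Gpd_HomD(1)[OF G] Gpd_HomD(1)[OF H]]
          category_assoc[OF category_Ab Gpd_HomD(2)[OF F] Gpd_HomD(2)[OF G] Gpd_HomD(2)[OF H]])
  next
    fix F G assume "F \<in> Arr ?G" "G \<in> Arr ?G" "Cod ?G F = Dom ?G G"
    then have "F \<in> Hom ?G (Dom ?G F) (Dom ?G G)" "G \<in> Hom ?G (Dom ?G G) (Cod ?G G)" by (simp_all add: Hom_iff)
    then show "G \<cdot>\<^bsub>?G\<^esub> F \<in> Hom ?G (Dom ?G F) (Cod ?G G)" by (rule comp)
  qed (use obj ide in auto)
qed

lemma Gpd_comp_app:
  fixes X Y :: "('u::infinite monoid, 'u ab_arr) igpd"
  assumes "H \<in> Hom (Gpd Ab) X Y"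
  shows "x \<in> carrier (G0 X) \<Longrightarrow> F0 (K \<cdot>\<^bsub>Gpd Ab\<^esub> H) \<bullet> x = F0 K \<bullet> (F0 H \<bullet> x)"
    and "y \<in> carrier (G1 X) \<Longrightarrow> F1 (K \<cdot>\<^bsub>Gpd Ab\<^esub> H) \<bullet> y = F1 K \<bullet> (F1 H \<bullet> y)"
  using Ab_comp_app[OF Gpd_HomD(1)[OF assms]] Ab_comp_app[OF Gpd_HomD(2)[OF assms]] by simp_all

lemma Gpd_ext_app:
  fixes X Y :: "('u::infinite monoid, 'u ab_arr) igpd"
  assumes H: "H \<in> Hom (Gpd Ab) X Y" "H' \<in> Hom (Gpd Ab) X Y"
    and "\<And>x. x \<in> carrier (G0 X) \<Longrightarrow> F0 H \<bullet> x = F0 H' \<bullet> x"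
    and "\<And>x. x \<in> carrier (G1 X) \<Longrightarrow> F1 H \<bullet> x = F1 H' \<bullet> x"
  shows "H = H'"
  by (rule Gpd_ext[OF H Ab_ext[OF Gpd_HomD(1)[OF H(1)] Gpd_HomD(1)[OF H(2)] assms(3)]
        Ab_ext[OF Gpd_HomD(2)[OF H(1)] Gpd_HomD(2)[OF H(2)] assms(4)]])

lemma Gpd_comp:
  fixes X Y :: "('u::infinite monoid, 'u ab_arr) igpd"
  shows "H \<in> Hom (Gpd Ab) X Y \<Longrightarrow> K \<in> Hom (Gpd Ab) Y Z \<Longrightarrow> K \<cdot>\<^bsub>Gpd Ab\<^esub> H \<in> Hom (Gpd Ab) X Z"
  by (rule category_comp[OF category_Gpd_Ab])

lemma Gpd_Dom [simp]: "Dom (Gpd C) = Src" "Cod (Gpd C) = Tgt"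
  by (simp_all add: Gpd_def)

lemma Gpd_Arr_Hom: "H \<in> Arr (Gpd C) \<Longrightarrow> H \<in> Hom (Gpd C) (Src H) (Tgt H)"
  by (simp add: Hom_iff)

subsection \<open>Discrete groupoids\<close>

lemma disc_simps [simp]: "G0 (disc C a) = a" "G1 (disc C a) = a" "gd (disc C a) = Ide C a"
  "gc (disc C a) = Ide C a" "ge (disc C a) = Ide C a" "gm (disc C a) = pb1 C (Ide C a) (Ide C a)"
  by (simp_all add: disc_def)

lemma disc_groupoid:
  fixes A :: "'u::infinite monoid"
  assumes A: "comm_group A"
  shows "internal_groupoid Ab (disc Ab A)"
  unfolding internal_groupoid_Ab_iff
proof
  interpret A: comm_group A by fact
  note i = Ab_Ide[OF A]
  show rg: "refl_graph (disc Ab A)" by (simp add: refl_graph_def i)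
  note p = Ab_pb[OF i i]
  show "gm (disc Ab A) = canonical_comp (disc Ab A)"
  proof (rule Ab_ext[OF _ canonical_comp_Hom[OF rg]])
    show "gm (disc Ab A) \<in> Hom Ab (gpairs (disc Ab A)) (G1 (disc Ab A))" using p(2) by simp
    fix w assume w: "w \<in> carrier (gpairs (disc Ab A))"
    then have w: "w \<in> carrier (Dom Ab (pb1 Ab (Ide Ab A) (Ide Ab A)))" by simp
    then show "gm (disc Ab A) \<bullet> w = canonical_comp (disc Ab A) \<bullet> w"
      using Ab_eqD[OF p(4,2,3) w] Ab_closed[OF p(2) w] Ab_closed[OF p(3) w]
      by (simp add: canonical_comp_def)
  qed
qed

lemma disc_functor:
  fixes X :: "('u::infinite monoid, 'u ab_arr) igpd"
  assumes X: "internal_groupoid Ab X" and h: "h \<in> Hom Ab A (G0 X)"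
  shows "\<lparr>Src = disc Ab A, Tgt = X, F0 = h, F1 = ge X \<cdot>\<^bsub>Ab\<^esub> h\<rparr> \<in> Hom (Gpd Ab) (disc Ab A) X"
proof -
  note x = refl_graphD[OF internal_groupoidD(1)[OF X]]
  show ?thesis
    unfolding Gpd_Hom using X disc_groupoid Ab_Hom_group[OF h] h Ab_comp[OF h x(3)]
    by (simp add: Ab_comp_app[OF h] Ab_closed[OF h] x)
qed

lemma disc_functor_F1:
  fixes X :: "('u::infinite monoid, 'u ab_arr) igpd"
  assumes H: "H \<in> Hom (Gpd Ab) (disc Ab A) X" and a: "a \<in> carrier A"
  shows "F1 H \<bullet> a = ge X \<bullet> (F0 H \<bullet> a)"
  using Gpd_HomD(5)[OF H, of a] a by simp

lemma disc_ext:
  fixes X :: "('u::infinite monoid, 'u ab_arr) igpd"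
  assumes H: "H \<in> Hom (Gpd Ab) (disc Ab A) X" "H' \<in> Hom (Gpd Ab) (disc Ab A) X"
    and eq: "\<And>a. a \<in> carrier A \<Longrightarrow> F0 H \<bullet> a = F0 H' \<bullet> a"
  shows "H = H'"
  by (rule Gpd_ext_app[OF H]) (simp_all add: eq disc_functor_F1[OF H(1)] disc_functor_F1[OF H(2)])

subsection \<open>Relations as groupoids\<close>

lemma relation_groupoid_Ab:
  fixes r :: "'u::infinite ab_arr"
  assumes eq: "equivalence_relation Ab r s"
  shows "internal_groupoid Ab (relation_groupoid Ab r s)"
proof -
  let ?X = "relation_groupoid Ab r s"
  let ?R = "Dom Ab r" and ?B = "Cod Ab r"
  have r: "r \<in> Hom Ab ?R ?B" and s: "s \<in> Hom Ab ?R ?B"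
    using eq by (simp_all add: equivalence_relation_def Hom_iff)
  have X: "G0 ?X = ?B" "G1 ?X = ?R" "gd ?X = r" "gc ?X = s" by (simp_all add: relation_groupoid_def)
  note mono = equivalence_relation_mono[OF eq]
  have "\<exists>e. e \<in> Hom Ab ?B ?R \<and> r \<cdot>\<^bsub>Ab\<^esub> e = Ide Ab ?B \<and> s \<cdot>\<^bsub>Ab\<^esub> e = Ide Ab ?B"
    using eq unfolding equivalence_relation_def by blast
  then have "\<exists>!e. e \<in> Hom Ab ?B ?R \<and> r \<cdot>\<^bsub>Ab\<^esub> e = Ide Ab ?B \<and> s \<cdot>\<^bsub>Ab\<^esub> e = Ide Ab ?B"
    using mono by (metis (no_types, lifting))
  from theI'[OF this] have e: "ge ?X \<in> Hom Ab ?B ?R" "r \<cdot>\<^bsub>Ab\<^esub> ge ?X = Ide Ab ?B" "s \<cdot>\<^bsub>Ab\<^esub> ge ?X = Ide Ab ?B"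
    by (simp_all add: relation_groupoid_def)
  have rg: "refl_graph ?X"
    unfolding refl_graph_def X
    using r s e(1) Ab_eqD1[OF e(2,1)] Ab_eqD1[OF e(3,1)] by simp
  interpret B: comm_group ?B using Ab_Hom_group[OF r] by simp
  interpret R: comm_group ?R using Ab_Hom_group[OF r] by simp
  note p = Ab_pb[OF s r]
  note m = canonical_comp_Hom[OF rg, unfolded X]
  note cl = Ab_closed[OF r] Ab_closed[OF s] Ab_closed[OF e(1)] Ab_closed[OF p(2)] Ab_closed[OF p(3)]
  have de: "r \<bullet> (ge ?X \<bullet> x) = x" "s \<bullet> (ge ?X \<bullet> x) = x" if "x \<in> carrier ?B" for x
    using Ab_eqD1[OF e(2,1) that] Ab_eqD1[OF e(3,1) that] that by simp_all
  have "gm ?X = (THE m. m \<in> Hom Ab (Dom Ab (pb1 Ab s r)) ?R \<and>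
      r \<cdot>\<^bsub>Ab\<^esub> m = r \<cdot>\<^bsub>Ab\<^esub> pb1 Ab s r \<and> s \<cdot>\<^bsub>Ab\<^esub> m = s \<cdot>\<^bsub>Ab\<^esub> pb2 Ab s r)"
    by (simp add: relation_groupoid_def)
  also have "\<dots> = canonical_comp ?X"
  proof (rule the_equality, intro conjI)
    show "canonical_comp ?X \<in> Hom Ab (Dom Ab (pb1 Ab s r)) ?R" by (rule m)
    show *: "r \<cdot>\<^bsub>Ab\<^esub> canonical_comp ?X = r \<cdot>\<^bsub>Ab\<^esub> pb1 Ab s r"
      by (rule Ab_eqI[OF m p(2) r r])
        (simp add: canonical_comp_def X cl Ab_mult[OF r] Ab_inv[OF r] de Ab_eqD[OF p(4,2,3)] B.m_assoc)
    show **: "s \<cdot>\<^bsub>Ab\<^esub> canonical_comp ?X = s \<cdot>\<^bsub>Ab\<^esub> pb2 Ab s r"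
      by (rule Ab_eqI[OF m p(3) s s])
        (simp add: canonical_comp_def X cl Ab_mult[OF s] Ab_inv[OF s] de)
    fix m' assume "m' \<in> Hom Ab (Dom Ab (pb1 Ab s r)) ?R \<and>
      r \<cdot>\<^bsub>Ab\<^esub> m' = r \<cdot>\<^bsub>Ab\<^esub> pb1 Ab s r \<and> s \<cdot>\<^bsub>Ab\<^esub> m' = s \<cdot>\<^bsub>Ab\<^esub> pb2 Ab s r"
    then show "m' = canonical_comp ?X"
      by (intro mono[of m' _ "canonical_comp ?X"]) (use m * ** in auto)
  qed
  finally show ?thesis using rg by (simp add: internal_groupoid_Ab_iff)
qed

lemma Y_dom_eq: "Y_dom A = ab_arr (A \<times>\<^sub>u A \<times>\<^sub>u A) (A \<times>\<^sub>u A) (\<lambda>z. \<langle>ufst z, ufst (usnd z)\<rangle>)"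
  by (auto simp: Y_dom_def ab_prod_map_def ab_proj1_def Ab_def ab_arr_def fun_eq_iff elim!: ab_prodE)

lemma Y_cod_eq: "Y_cod A = ab_arr (A \<times>\<^sub>u A \<times>\<^sub>u A) (A \<times>\<^sub>u A) (\<lambda>z. \<langle>ufst z, usnd (usnd z)\<rangle>)"
  by (auto simp: Y_cod_def ab_prod_map_def ab_proj2_def Ab_def ab_arr_def fun_eq_iff elim!: ab_prodE)

context
  fixes A :: "'u::infinite monoid"
  assumes A: "comm_group A"
begin

interpretation A: comm_group A by (rule A)

lemma AA: "comm_group (A \<times>\<^sub>u A)" and AAA: "comm_group (A \<times>\<^sub>u A \<times>\<^sub>u A)"
  using ab_prod_comm_group A by blast+

lemma Y_dom_Hom: "Y_dom A \<in> Hom Ab (A \<times>\<^sub>u A \<times>\<^sub>u A) (A \<times>\<^sub>u A)"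
  unfolding Y_dom_eq by (rule ab_arr_Hom[OF AAA AA]) (auto elim!: ab_prodE)

lemma Y_cod_Hom: "Y_cod A \<in> Hom Ab (A \<times>\<^sub>u A \<times>\<^sub>u A) (A \<times>\<^sub>u A)"
  unfolding Y_cod_eq by (rule ab_arr_Hom[OF AAA AA]) (auto elim!: ab_prodE)

lemma Y_dom_app [simp]:
  "a \<in> carrier A \<Longrightarrow> b \<in> carrier A \<Longrightarrow> b' \<in> carrier A \<Longrightarrow> Y_dom A \<bullet> \<langle>a, \<langle>b, b'\<rangle>\<rangle> = \<langle>a, b\<rangle>"
  by (simp add: Y_dom_eq)

lemma Y_cod_app [simp]:
  "a \<in> carrier A \<Longrightarrow> b \<in> carrier A \<Longrightarrow> b' \<in> carrier A \<Longrightarrow> Y_cod A \<bullet> \<langle>a, \<langle>b, b'\<rangle>\<rangle> = \<langle>a, b'\<rangle>"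
  by (simp add: Y_cod_eq)

theorem Y_equivalence_relation: "equivalence_relation Ab (Y_dom A) (Y_cod A)"
proof -
  let ?r = "Y_dom A" and ?s = "Y_cod A"
  let ?R = "A \<times>\<^sub>u A \<times>\<^sub>u A" and ?X = "A \<times>\<^sub>u A"
  note r = Y_dom_Hom and s = Y_cod_Hom
  note D = HomD[OF r] HomD[OF s]
  have inj: "x = y" if "x \<in> carrier ?R" "y \<in> carrier ?R" "?r \<bullet> x = ?r \<bullet> y" "?s \<bullet> x = ?s \<bullet> y" for x y
    using that by (auto elim!: ab_prodE)
  have mono: "u = v" if u: "u \<in> Hom Ab Z ?R" and v: "v \<in> Hom Ab Z ?R"
    and eq: "?r \<cdot>\<^bsub>Ab\<^esub> u = ?r \<cdot>\<^bsub>Ab\<^esub> v" "?s \<cdot>\<^bsub>Ab\<^esub> u = ?s \<cdot>\<^bsub>Ab\<^esub> v" for u v Z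
    by (rule Ab_ext[OF u v], rule inj)
      (simp_all add: Ab_closed[OF u] Ab_closed[OF v] Ab_eqD[OF eq(1) u v] Ab_eqD[OF eq(2) u v])
  define e where "e = ab_arr ?X ?R (\<lambda>z. \<langle>ufst z, \<langle>usnd z, usnd z\<rangle>\<rangle>)"
  have e: "e \<in> Hom Ab ?X ?R" unfolding e_def by (rule ab_arr_Hom[OF AA AAA]) (auto elim!: ab_prodE)
  have re: "?r \<cdot>\<^bsub>Ab\<^esub> e = Ide Ab ?X" "?s \<cdot>\<^bsub>Ab\<^esub> e = Ide Ab ?X"
    by (rule Ab_eqI1[OF e r Ab_Ide[OF AA]], force simp: e_def elim!: ab_prodE)
      (rule Ab_eqI1[OF e s Ab_Ide[OF AA]], force simp: e_def elim!: ab_prodE)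
  define i where "i = ab_arr ?R ?R (\<lambda>z. \<langle>ufst z, \<langle>usnd (usnd z), ufst (usnd z)\<rangle>\<rangle>)"
  have i: "i \<in> Hom Ab ?R ?R" unfolding i_def by (rule ab_arr_Hom[OF AAA AAA]) (auto elim!: ab_prodE)
  have ri: "?r \<cdot>\<^bsub>Ab\<^esub> i = ?s" "?s \<cdot>\<^bsub>Ab\<^esub> i = ?r"
    by (rule Ab_eqI1[OF i r s], force simp: i_def elim!: ab_prodE)
      (rule Ab_eqI1[OF i s r], force simp: i_def elim!: ab_prodE)
  note p = Ab_pb[OF s r]
  let ?P = "Dom Ab (pb1 Ab ?s ?r)"
  let ?p1 = "pb1 Ab ?s ?r" and ?p2 = "pb2 Ab ?s ?r"
  define t where "t = ab_arr ?P ?R (\<lambda>w. \<langle>ufst (?p1 \<bullet> w), \<langle>ufst (usnd (?p1 \<bullet> w)), usnd (usnd (?p2 \<bullet> w))\<rangle>\<rangle>)"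
  have c: "?p1 \<bullet> w \<in> carrier ?R" "?p2 \<bullet> w \<in> carrier ?R" if "w \<in> carrier ?P" for w
    using Ab_closed[OF p(2) that] Ab_closed[OF p(3) that] .
  have t: "t \<in> Hom Ab ?P ?R"
    unfolding t_def
  proof (rule ab_arr_Hom)
    show "comm_group ?P" "comm_group ?R" using Ab_Hom_group[OF p(2)] by auto
    fix w assume w: "w \<in> carrier ?P"
    show "\<langle>ufst (?p1 \<bullet> w), \<langle>ufst (usnd (?p1 \<bullet> w)), usnd (usnd (?p2 \<bullet> w))\<rangle>\<rangle> \<in> carrier ?R"
      using c[OF w] by (auto elim!: ab_prodE)
    fix w' assume w': "w' \<in> carrier ?P"
    show "\<langle>ufst (?p1 \<bullet> (w \<otimes>\<^bsub>?P\<^esub> w')), \<langle>ufst (usnd (?p1 \<bullet> (w \<otimes>\<^bsub>?P\<^esub> w'))), usnd (usnd (?p2 \<bullet> (w \<otimes>\<^bsub>?P\<^esub> w')))\<rangle>\<rangle> =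
      \<langle>ufst (?p1 \<bullet> w), \<langle>ufst (usnd (?p1 \<bullet> w)), usnd (usnd (?p2 \<bullet> w))\<rangle>\<rangle> \<otimes>\<^bsub>?R\<^esub>
      \<langle>ufst (?p1 \<bullet> w'), \<langle>ufst (usnd (?p1 \<bullet> w')), usnd (usnd (?p2 \<bullet> w'))\<rangle>\<rangle>"
      using c[OF w] c[OF w'] unfolding Ab_mult[OF p(2) w w'] Ab_mult[OF p(3) w w']
      by (auto elim!: ab_prodE)
  qed
  have rt: "?r \<cdot>\<^bsub>Ab\<^esub> t = ?r \<cdot>\<^bsub>Ab\<^esub> ?p1"
  proof (rule Ab_eqI[OF t p(2) r r])
    fix w assume w: "w \<in> carrier ?P"
    show "?r \<bullet> (t \<bullet> w) = ?r \<bullet> (?p1 \<bullet> w)"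
      using c[OF w] w by (auto simp: t_def elim!: ab_prodE)
  qed
  have st: "?s \<cdot>\<^bsub>Ab\<^esub> t = ?s \<cdot>\<^bsub>Ab\<^esub> ?p2"
  proof (rule Ab_eqI[OF t p(3) s s])
    fix w assume w: "w \<in> carrier ?P"
    show "?s \<bullet> (t \<bullet> w) = ?s \<bullet> (?p2 \<bullet> w)"
      using c[OF w] w Ab_eqD[OF p(4,2,3) w] by (auto simp: t_def elim!: ab_prodE)
  qed
  show ?thesis
    unfolding equivalence_relation_def D
  proof (intro conjI ballI impI)
    fix u v :: "'u ab_arr" assume "u \<in> Arr Ab" "v \<in> Arr Ab"
      and *: "Dom Ab u = Dom Ab v \<and> Cod Ab u = ?R \<and> Cod Ab v = ?R \<and>
        ?r \<cdot>\<^bsub>Ab\<^esub> u = ?r \<cdot>\<^bsub>Ab\<^esub> v \<and> ?s \<cdot>\<^bsub>Ab\<^esub> u = ?s \<cdot>\<^bsub>Ab\<^esub> v"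
    then show "u = v" by (intro mono[of u "Dom Ab u" v]) (simp_all add: Hom_iff)
  next
    show "\<exists>e \<in> Hom Ab ?X ?R. ?r \<cdot>\<^bsub>Ab\<^esub> e = Ide Ab ?X \<and> ?s \<cdot>\<^bsub>Ab\<^esub> e = Ide Ab ?X" using e re by blast
    show "\<exists>i \<in> Hom Ab ?R ?R. ?r \<cdot>\<^bsub>Ab\<^esub> i = ?s \<and> ?s \<cdot>\<^bsub>Ab\<^esub> i = ?r" using i ri by blast
    show "\<exists>t \<in> Hom Ab ?P ?R. ?r \<cdot>\<^bsub>Ab\<^esub> t = ?r \<cdot>\<^bsub>Ab\<^esub> ?p1 \<and> ?s \<cdot>\<^bsub>Ab\<^esub> t = ?s \<cdot>\<^bsub>Ab\<^esub> ?p2" using t rt st by blast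
  qed (rule D refl)+
qed

lemma Y_groupoid: "internal_groupoid Ab (Y_gpd A)"
  unfolding Y_gpd_def by (rule relation_groupoid_Ab[OF Y_equivalence_relation])

lemma Y_simps [simp]: "G0 (Y_gpd A) = A \<times>\<^sub>u A" "G1 (Y_gpd A) = A \<times>\<^sub>u A \<times>\<^sub>u A"
  "gd (Y_gpd A) = Y_dom A" "gc (Y_gpd A) = Y_cod A"
  using HomD[OF Y_dom_Hom] by (simp_all add: Y_gpd_def relation_groupoid_def)

lemma Y_ge_app [simp]:
  assumes ab: "a \<in> carrier A" "b \<in> carrier A"
  shows "ge (Y_gpd A) \<bullet> \<langle>a, b\<rangle> = \<langle>a, \<langle>b, b\<rangle>\<rangle>"
proof -
  note y = refl_graphD[OF internal_groupoidD(1)[OF Y_groupoid]]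
  have "\<langle>a, b\<rangle> \<in> carrier (G0 (Y_gpd A))" using ab by simp
  from Ab_closed[OF y(3) this] y(4,5)[OF this] show ?thesis by (auto elim!: ab_prodE)
qed

lemma F_fun_Hom: "F_fun A \<in> Hom (Gpd Ab) (disc Ab A) (Y_gpd A)"
proof -
  have "F0 (F_fun A) = ab_arr A (A \<times>\<^sub>u A) (\<lambda>a. \<langle>a, \<one>\<^bsub>A\<^esub>\<rangle>)"
    "F1 (F_fun A) = ab_arr A (A \<times>\<^sub>u A \<times>\<^sub>u A) (\<lambda>a. \<langle>a, \<langle>\<one>\<^bsub>A\<^esub>, \<one>\<^bsub>A\<^esub>\<rangle>\<rangle>)"
    by (simp_all add: F_fun_def ab_arr_def)
  moreover from this have "F0 (F_fun A) \<in> Hom Ab A (A \<times>\<^sub>u A)" "F1 (F_fun A) \<in> Hom Ab A (A \<times>\<^sub>u A \<times>\<^sub>u A)"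
    using A AA AAA by (auto intro!: ab_arr_Hom)
  moreover have "Src (F_fun A) = disc Ab A" "Tgt (F_fun A) = Y_gpd A" by (simp_all add: F_fun_def)
  ultimately show ?thesis
    unfolding Gpd_Hom using disc_groupoid[OF A] Y_groupoid by simp
qed

lemma G_fun_Hom: "G_fun A \<in> Hom (Gpd Ab) (disc Ab A) (Y_gpd A)"
proof -
  have "F0 (G_fun A) = ab_arr A (A \<times>\<^sub>u A) (\<lambda>a. \<langle>\<one>\<^bsub>A\<^esub>, a\<rangle>)"
    "F1 (G_fun A) = ab_arr A (A \<times>\<^sub>u A \<times>\<^sub>u A) (\<lambda>a. \<langle>\<one>\<^bsub>A\<^esub>, \<langle>a, a\<rangle>\<rangle>)"
    by (simp_all add: G_fun_def ab_arr_def)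
  moreover from this have "F0 (G_fun A) \<in> Hom Ab A (A \<times>\<^sub>u A)" "F1 (G_fun A) \<in> Hom Ab A (A \<times>\<^sub>u A \<times>\<^sub>u A)"
    using A AA AAA by (auto intro!: ab_arr_Hom)
  moreover have "Src (G_fun A) = disc Ab A" "Tgt (G_fun A) = Y_gpd A" by (simp_all add: G_fun_def)
  ultimately show ?thesis
    unfolding Gpd_Hom using disc_groupoid[OF A] Y_groupoid by simp
qed

lemma F_fun_app [simp]: "a \<in> carrier A \<Longrightarrow> F0 (F_fun A) \<bullet> a = \<langle>a, \<one>\<^bsub>A\<^esub>\<rangle>"
  and G_fun_app [simp]: "a \<in> carrier A \<Longrightarrow> F0 (G_fun A) \<bullet> a = \<langle>\<one>\<^bsub>A\<^esub>, a\<rangle>"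
  by (simp_all add: F_fun_def G_fun_def app_def)

subsection \<open>Functors out of \<open>Y\<close>\<close>

text \<open>A functor \<open>Y \<rightarrow> X\<close> amounts to a homomorphism \<open>x : A \<rightarrow> X\<^sub>0\<close>, its restriction along \<open>F\<close>, and a
  homomorphism \<open>k\<close> from \<open>A\<close> to the kernel of the codomain map of \<open>X\<close>, the values on the arrows
  \<open>(0, b) \<rightarrow> (0, 0)\<close>: an arrow \<open>(a, b) \<rightarrow> (a, b')\<close> is the sum of the identity of \<open>(a, b')\<close> and the arrow
  \<open>(0, b - b') \<rightarrow> (0, 0)\<close>, and \<open>(0, b)\<close> is the domain of \<open>(0, b) \<rightarrow> (0, 0)\<close>.\<close>

lemma Y_ext:
  assumes H: "H \<in> Hom (Gpd Ab) (Y_gpd A) X" "H' \<in> Hom (Gpd Ab) (Y_gpd A) X"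
    and eq0: "\<And>a. a \<in> carrier A \<Longrightarrow> F0 H \<bullet> \<langle>a, \<one>\<^bsub>A\<^esub>\<rangle> = F0 H' \<bullet> \<langle>a, \<one>\<^bsub>A\<^esub>\<rangle>"
    and eq1: "\<And>a. a \<in> carrier A \<Longrightarrow> F1 H \<bullet> \<langle>\<one>\<^bsub>A\<^esub>, \<langle>a, \<one>\<^bsub>A\<^esub>\<rangle>\<rangle> = F1 H' \<bullet> \<langle>\<one>\<^bsub>A\<^esub>, \<langle>a, \<one>\<^bsub>A\<^esub>\<rangle>\<rangle>"
  shows "H = H'"
proof -
  have e0: "F0 K \<bullet> \<langle>a, b\<rangle> = F0 K \<bullet> \<langle>a, \<one>\<^bsub>A\<^esub>\<rangle> \<otimes>\<^bsub>G0 X\<^esub> gd X \<bullet> (F1 K \<bullet> \<langle>\<one>\<^bsub>A\<^esub>, \<langle>b, \<one>\<^bsub>A\<^esub>\<rangle>\<rangle>)"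
    if K: "K \<in> Hom (Gpd Ab) (Y_gpd A) X" and ab: "a \<in> carrier A" "b \<in> carrier A" for K a b
    using Ab_mult[OF Gpd_HomD(1)[OF K], of "\<langle>a, \<one>\<^bsub>A\<^esub>\<rangle>" "\<langle>\<one>\<^bsub>A\<^esub>, b\<rangle>"] ab
      Gpd_HomD(3)[OF K, of "\<langle>\<one>\<^bsub>A\<^esub>, \<langle>b, \<one>\<^bsub>A\<^esub>\<rangle>\<rangle>"] by simp
  have e1: "F1 K \<bullet> \<langle>a, \<langle>b, b'\<rangle>\<rangle> = ge X \<bullet> (F0 K \<bullet> \<langle>a, b'\<rangle>) \<otimes>\<^bsub>G1 X\<^esub> F1 K \<bullet> \<langle>\<one>\<^bsub>A\<^esub>, \<langle>b \<otimes>\<^bsub>A\<^esub> inv\<^bsub>A\<^esub> b', \<one>\<^bsub>A\<^esub>\<rangle>\<rangle>"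
    if K: "K \<in> Hom (Gpd Ab) (Y_gpd A) X" and ab: "a \<in> carrier A" "b \<in> carrier A" "b' \<in> carrier A" for K a b b'
  proof -
    have "b' \<otimes>\<^bsub>A\<^esub> (b \<otimes>\<^bsub>A\<^esub> inv\<^bsub>A\<^esub> b') = b \<otimes>\<^bsub>A\<^esub> (b' \<otimes>\<^bsub>A\<^esub> inv\<^bsub>A\<^esub> b')"
      using ab by (simp only: A.m_ac A.inv_closed A.m_closed)
    then show ?thesis
      using Ab_mult[OF Gpd_HomD(2)[OF K], of "\<langle>a, \<langle>b', b'\<rangle>\<rangle>" "\<langle>\<one>\<^bsub>A\<^esub>, \<langle>b \<otimes>\<^bsub>A\<^esub> inv\<^bsub>A\<^esub> b', \<one>\<^bsub>A\<^esub>\<rangle>\<rangle>"] ab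
        Gpd_HomD(5)[OF K, of "\<langle>a, b'\<rangle>"] by simp
  qed
  show ?thesis
  proof (rule Gpd_ext_app[OF H])
    fix z assume "z \<in> carrier (G0 (Y_gpd A))"
    then obtain a b where "z = \<langle>a, b\<rangle>" and ab: "a \<in> carrier A" "b \<in> carrier A" by (auto elim!: ab_prodE)
    then show "F0 H \<bullet> z = F0 H' \<bullet> z"
      using e0[OF H(1) ab] e0[OF H(2) ab] eq0[OF ab(1)] eq1[OF ab(2)] by simp
  next
    fix z assume "z \<in> carrier (G1 (Y_gpd A))"
    then obtain a b b' where z: "z = \<langle>a, \<langle>b, b'\<rangle>\<rangle>" "a \<in> carrier A" "b \<in> carrier A" "b' \<in> carrier A"
      by (auto elim!: ab_prodE)
    have "F0 H \<bullet> \<langle>a, b'\<rangle> = F0 H' \<bullet> \<langle>a, b'\<rangle>"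
      using e0[OF H(1) z(2,4)] e0[OF H(2) z(2,4)] eq0[OF z(2)] eq1[OF z(4)] by simp
    moreover have "b \<otimes>\<^bsub>A\<^esub> inv\<^bsub>A\<^esub> b' \<in> carrier A" using z by simp
    ultimately show "F1 H \<bullet> z = F1 H' \<bullet> z"
      using e1[OF H(1) z(2-4)] e1[OF H(2) z(2-4)] eq1 z(1) by simp
  qed
qed

lemma Y_extend:
  assumes X: "internal_groupoid Ab X" and x: "x \<in> Hom Ab A (G0 X)" and k: "k \<in> Hom Ab A (G1 X)"
    and ck: "\<And>a. a \<in> carrier A \<Longrightarrow> gc X \<bullet> (k \<bullet> a) = \<one>\<^bsub>G0 X\<^esub>"
  shows "\<exists>H \<in> Hom (Gpd Ab) (Y_gpd A) X. (\<forall>a \<in> carrier A. F0 H \<bullet> \<langle>a, \<one>\<^bsub>A\<^esub>\<rangle> = x \<bullet> a) \<and>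
    (\<forall>a \<in> carrier A. F1 H \<bullet> \<langle>\<one>\<^bsub>A\<^esub>, \<langle>a, \<one>\<^bsub>A\<^esub>\<rangle>\<rangle> = k \<bullet> a)"
proof -
  note X' = refl_graphD[OF internal_groupoidD(1)[OF X]]
  note d = X'(1) and c = X'(2) and e = X'(3)
  interpret X0: comm_group "G0 X" by (rule X')
  interpret X1: comm_group "G1 X" by (rule X')
  note cl = Ab_closed[OF d] Ab_closed[OF c] Ab_closed[OF e] Ab_closed[OF x] Ab_closed[OF k]
  note mult = Ab_mult[OF d] Ab_mult[OF c] Ab_mult[OF e] Ab_mult[OF x] Ab_mult[OF k]
  define h0 where "h0 = ab_arr (A \<times>\<^sub>u A) (G0 X) (\<lambda>z. x \<bullet> ufst z \<otimes>\<^bsub>G0 X\<^esub> gd X \<bullet> (k \<bullet> usnd z))"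
  define h1 where "h1 = ab_arr (A \<times>\<^sub>u A \<times>\<^sub>u A) (G1 X) (\<lambda>z. ge X \<bullet> (x \<bullet> ufst z) \<otimes>\<^bsub>G1 X\<^esub>
    (k \<bullet> ufst (usnd z) \<otimes>\<^bsub>G1 X\<^esub> (inv\<^bsub>G1 X\<^esub> (k \<bullet> usnd (usnd z)) \<otimes>\<^bsub>G1 X\<^esub> ge X \<bullet> (gd X \<bullet> (k \<bullet> usnd (usnd z))))))"
  have h0: "h0 \<in> Hom Ab (A \<times>\<^sub>u A) (G0 X)"
    unfolding h0_def
    by (rule ab_arr_Hom[OF AA X'(6)]) (auto elim!: ab_prodE simp: cl mult X0.m_ac)
  have h1: "h1 \<in> Hom Ab (A \<times>\<^sub>u A \<times>\<^sub>u A) (G1 X)"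
    unfolding h1_def
    by (rule ab_arr_Hom[OF AAA X'(7)]) (auto elim!: ab_prodE simp: cl mult X1.inv_mult X1.m_ac)
  have h0a: "h0 \<bullet> \<langle>a, b\<rangle> = x \<bullet> a \<otimes>\<^bsub>G0 X\<^esub> gd X \<bullet> (k \<bullet> b)" if "a \<in> carrier A" "b \<in> carrier A" for a b
    using that by (simp add: h0_def)
  have h1a: "h1 \<bullet> \<langle>a, \<langle>b, b'\<rangle>\<rangle> = ge X \<bullet> (x \<bullet> a) \<otimes>\<^bsub>G1 X\<^esub>
    (k \<bullet> b \<otimes>\<^bsub>G1 X\<^esub> (inv\<^bsub>G1 X\<^esub> (k \<bullet> b') \<otimes>\<^bsub>G1 X\<^esub> ge X \<bullet> (gd X \<bullet> (k \<bullet> b'))))"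
    if "a \<in> carrier A" "b \<in> carrier A" "b' \<in> carrier A" for a b b'
    using that by (simp add: h1_def)
  let ?H = "\<lparr>Src = Y_gpd A, Tgt = X, F0 = h0, F1 = h1\<rparr>"
  have "?H \<in> Hom (Gpd Ab) (Y_gpd A) X"
    unfolding Gpd_Hom
  proof (intro conjI ballI)
    fix z assume "z \<in> carrier (G1 (Y_gpd A))"
    then obtain a b b' where z: "z = \<langle>a, \<langle>b, b'\<rangle>\<rangle>" "a \<in> carrier A" "b \<in> carrier A" "b' \<in> carrier A"
      by (auto elim!: ab_prodE)
    then show "gd X \<bullet> (F1 ?H \<bullet> z) = F0 ?H \<bullet> (gd (Y_gpd A) \<bullet> z)" "gc X \<bullet> (F1 ?H \<bullet> z) = F0 ?H \<bullet> (gc (Y_gpd A) \<bullet> z)"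
      by (simp_all add: h0a h1a mult Ab_inv[OF d] Ab_inv[OF c] cl X'(4,5) ck)
  next
    fix z assume "z \<in> carrier (G0 (Y_gpd A))"
    then obtain a b where z: "z = \<langle>a, b\<rangle>" "a \<in> carrier A" "b \<in> carrier A" by (auto elim!: ab_prodE)
    have "k \<bullet> b \<otimes>\<^bsub>G1 X\<^esub> (inv\<^bsub>G1 X\<^esub> (k \<bullet> b) \<otimes>\<^bsub>G1 X\<^esub> ge X \<bullet> (gd X \<bullet> (k \<bullet> b))) = ge X \<bullet> (gd X \<bullet> (k \<bullet> b))"
      using z(3) by (simp add: cl flip: X1.m_assoc)
    then show "F1 ?H \<bullet> (ge (Y_gpd A) \<bullet> z) = ge X \<bullet> (F0 ?H \<bullet> z)"
      using z by (simp add: h0a h1a mult cl)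
  qed (simp_all add: X Y_groupoid h0 h1)
  moreover have "h0 \<bullet> \<langle>a, \<one>\<^bsub>A\<^esub>\<rangle> = x \<bullet> a" "h1 \<bullet> \<langle>\<one>\<^bsub>A\<^esub>, \<langle>a, \<one>\<^bsub>A\<^esub>\<rangle>\<rangle> = k \<bullet> a" if "a \<in> carrier A" for a
    using that by (simp_all add: h0a h1a cl Ab_one[OF x] Ab_one[OF k] Ab_one[OF d] Ab_one[OF e])
  ultimately show ?thesis by (intro bexI[of _ ?H]) simp_all
qed

lemma Y_codomain_kernel:
  assumes H: "H \<in> Hom (Gpd Ab) (Y_gpd A) X" and a: "a \<in> carrier A"
  shows "gc X \<bullet> (F1 H \<bullet> \<langle>\<one>\<^bsub>A\<^esub>, \<langle>a, \<one>\<^bsub>A\<^esub>\<rangle>\<rangle>) = \<one>\<^bsub>G0 X\<^esub>"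
  using Gpd_HomD(4)[OF H, of "\<langle>\<one>\<^bsub>A\<^esub>, \<langle>a, \<one>\<^bsub>A\<^esub>\<rangle>\<rangle>"] a Ab_one[OF Gpd_HomD(1)[OF H]] by simp

text \<open>The arrows \<open>(0, a) \<rightarrow> (0, 0)\<close>, which generate \<open>Y\<close> together with the image of \<open>F\<close>.\<close>

definition Y_arrows :: "'u ab_arr" where
  "Y_arrows = ab_arr A (A \<times>\<^sub>u A \<times>\<^sub>u A) (\<lambda>a. \<langle>\<one>\<^bsub>A\<^esub>, \<langle>a, \<one>\<^bsub>A\<^esub>\<rangle>\<rangle>)"

lemma Y_arrows_Hom: "Y_arrows \<in> Hom Ab A (A \<times>\<^sub>u A \<times>\<^sub>u A)"
  unfolding Y_arrows_def by (rule ab_arr_Hom[OF A AAA]) auto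

lemma Y_arrows_app [simp]: "a \<in> carrier A \<Longrightarrow> Y_arrows \<bullet> a = \<langle>\<one>\<^bsub>A\<^esub>, \<langle>a, \<one>\<^bsub>A\<^esub>\<rangle>\<rangle>"
  by (simp add: Y_arrows_def)

lemma F_comp_app:
  "a \<in> carrier A \<Longrightarrow> F0 (H \<cdot>\<^bsub>Gpd Ab\<^esub> F_fun A) \<bullet> a = F0 H \<bullet> \<langle>a, \<one>\<^bsub>A\<^esub>\<rangle>"
  using Gpd_comp_app(1)[OF F_fun_Hom] by simp

text \<open>For a discrete fibration \<open>m : X \<rightarrow> W\<close> every homomorphism from \<open>A\<close> to the kernel of the codomain map
  of \<open>W\<close> lifts uniquely to \<open>X\<close>. Hence a functor \<open>Y \<rightarrow> W\<close> lifts as soon as its restriction along \<open>F\<close> does.\<close>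

theorem F_final: "F_fun A \<in> final_functors Ab"
proof -
  have "orthogonal (Gpd Ab) (F_fun A) m" if m: "discrete_fibration Ab m" for m
    unfolding orthogonal_def Gpd_Dom
  proof (intro allI impI)
    fix f g
    define X W where "X = Src m" and "W = Tgt m"
    have mH: "m \<in> Hom (Gpd Ab) X W" and pb: "is_pullback Ab (gc W) (F0 m) (F1 m) (gc X)"
      using m Gpd_Arr_Hom by (auto simp: discrete_fibration_def X_def W_def)
    note mD = Gpd_HomD[OF mH]
    note x = refl_graphD[OF mD(8)] and w = refl_graphD[OF mD(9)]
    assume "f \<in> Hom (Gpd Ab) (Src (F_fun A)) (Src m) \<and> g \<in> Hom (Gpd Ab) (Tgt (F_fun A)) (Tgt m) \<and>
      g \<cdot>\<^bsub>Gpd Ab\<^esub> F_fun A = m \<cdot>\<^bsub>Gpd Ab\<^esub> f"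
    then have f: "f \<in> Hom (Gpd Ab) (disc Ab A) X" and g: "g \<in> Hom (Gpd Ab) (Y_gpd A) W"
      and sq: "g \<cdot>\<^bsub>Gpd Ab\<^esub> F_fun A = m \<cdot>\<^bsub>Gpd Ab\<^esub> f"
      using Gpd_HomD(10,11)[OF F_fun_Hom] by (simp_all add: X_def W_def)
    have sq': "F0 g \<bullet> \<langle>a, \<one>\<^bsub>A\<^esub>\<rangle> = F0 m \<bullet> (F0 f \<bullet> a)" if "a \<in> carrier A" for a
      using F_comp_app[OF that, of g] Gpd_comp_app(1)[OF f, of a m] that sq by simp
    have j: "Y_arrows \<in> Hom Ab A (G1 (Y_gpd A))" using Y_arrows_Hom by simp
    define kW where "kW = F1 g \<cdot>\<^bsub>Ab\<^esub> Y_arrows"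
    have kW: "kW \<in> Hom Ab A (G1 W)" unfolding kW_def by (rule Ab_comp[OF j Gpd_HomD(2)[OF g]])
    have kWa: "kW \<bullet> a = F1 g \<bullet> \<langle>\<one>\<^bsub>A\<^esub>, \<langle>a, \<one>\<^bsub>A\<^esub>\<rangle>\<rangle>" if "a \<in> carrier A" for a
      using that by (simp add: kW_def Ab_comp_app[OF j])
    have t: "ab_triv A (G0 X) \<in> Hom Ab A (G0 X)" by (rule ab_triv_Hom[OF A x(6)])
    have "gc W \<cdot>\<^bsub>Ab\<^esub> kW = F0 m \<cdot>\<^bsub>Ab\<^esub> ab_triv A (G0 X)"
      by (rule Ab_eqI[OF kW t w(2) mD(1)]) (simp add: kWa Y_codomain_kernel[OF g] Ab_one[OF mD(1)])
    then obtain k where k: "k \<in> Hom Ab A (G1 X)" "F1 m \<cdot>\<^bsub>Ab\<^esub> k = kW" "gc X \<cdot>\<^bsub>Ab\<^esub> k = ab_triv A (G0 X)"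
      using pullback_lift[OF pb, of kW A "ab_triv A (G0 X)"] kW t HomD[OF w(2)] HomD[OF mD(1)] HomD[OF mD(2)]
      by auto
    have k': "F1 m \<bullet> (k \<bullet> a) = F1 g \<bullet> \<langle>\<one>\<^bsub>A\<^esub>, \<langle>a, \<one>\<^bsub>A\<^esub>\<rangle>\<rangle>" "gc X \<bullet> (k \<bullet> a) = \<one>\<^bsub>G0 X\<^esub>" if "a \<in> carrier A" for a
      using Ab_eqD1[OF k(2,1) that] Ab_eqD1[OF k(3,1) that] kWa that by simp_all
    have f0: "F0 f \<in> Hom Ab A (G0 X)" using Gpd_HomD(1)[OF f] by simp
    obtain \<delta> where \<delta>: "\<delta> \<in> Hom (Gpd Ab) (Y_gpd A) X"
      "\<And>a. a \<in> carrier A \<Longrightarrow> F0 \<delta> \<bullet> \<langle>a, \<one>\<^bsub>A\<^esub>\<rangle> = F0 f \<bullet> a"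
      "\<And>a. a \<in> carrier A \<Longrightarrow> F1 \<delta> \<bullet> \<langle>\<one>\<^bsub>A\<^esub>, \<langle>a, \<one>\<^bsub>A\<^esub>\<rangle>\<rangle> = k \<bullet> a"
      using Y_extend[OF mD(6) f0 k(1) k'(2)] by blast
    have "\<exists>!\<delta>. \<delta> \<in> Hom (Gpd Ab) (Y_gpd A) X \<and> \<delta> \<cdot>\<^bsub>Gpd Ab\<^esub> F_fun A = f \<and> m \<cdot>\<^bsub>Gpd Ab\<^esub> \<delta> = g"
    proof (rule ex1I[of _ \<delta>], intro conjI)
      show "\<delta> \<in> Hom (Gpd Ab) (Y_gpd A) X" by fact
      show "\<delta> \<cdot>\<^bsub>Gpd Ab\<^esub> F_fun A = f"
        by (rule disc_ext[OF Gpd_comp[OF F_fun_Hom \<delta>(1)] f]) (simp only: F_comp_app \<delta>(2))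
      show "m \<cdot>\<^bsub>Gpd Ab\<^esub> \<delta> = g"
        by (rule Y_ext[OF Gpd_comp[OF \<delta>(1) mH] g])
          (simp_all del: Gpd_Comp add: Gpd_comp_app[OF \<delta>(1)] \<delta> sq' k')
      fix \<delta>' assume "\<delta>' \<in> Hom (Gpd Ab) (Y_gpd A) X \<and> \<delta>' \<cdot>\<^bsub>Gpd Ab\<^esub> F_fun A = f \<and> m \<cdot>\<^bsub>Gpd Ab\<^esub> \<delta>' = g"
      then have \<delta>': "\<delta>' \<in> Hom (Gpd Ab) (Y_gpd A) X" and eq: "\<delta>' \<cdot>\<^bsub>Gpd Ab\<^esub> F_fun A = f" "m \<cdot>\<^bsub>Gpd Ab\<^esub> \<delta>' = g" by auto
      show "\<delta>' = \<delta>"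
      proof (rule Y_ext[OF \<delta>' \<delta>(1)])
        fix a assume a: "a \<in> carrier A"
        show "F0 \<delta>' \<bullet> \<langle>a, \<one>\<^bsub>A\<^esub>\<rangle> = F0 \<delta> \<bullet> \<langle>a, \<one>\<^bsub>A\<^esub>\<rangle>"
          using F_comp_app[OF a, of \<delta>'] eq(1) \<delta>(2)[OF a] by simp
        let ?j = "\<langle>\<one>\<^bsub>A\<^esub>, \<langle>a, \<one>\<^bsub>A\<^esub>\<rangle>\<rangle>"
        have jc: "?j \<in> carrier (G1 (Y_gpd A))" using a by simp
        show "F1 \<delta>' \<bullet> ?j = F1 \<delta> \<bullet> ?j"
        proof (rule Ab_pullback_injective[OF pb mD(2) x(2)])
          show "F1 \<delta>' \<bullet> ?j \<in> carrier (G1 X)" "F1 \<delta> \<bullet> ?j \<in> carrier (G1 X)"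
            using Ab_closed[OF Gpd_HomD(2)[OF \<delta>'] jc] Ab_closed[OF Gpd_HomD(2)[OF \<delta>(1)] jc] .
          show "F1 m \<bullet> (F1 \<delta>' \<bullet> ?j) = F1 m \<bullet> (F1 \<delta> \<bullet> ?j)"
            using Gpd_comp_app(2)[OF \<delta>' jc, of m] eq(2) \<delta>(3)[OF a] k'(1)[OF a] by simp
          show "gc X \<bullet> (F1 \<delta>' \<bullet> ?j) = gc X \<bullet> (F1 \<delta> \<bullet> ?j)"
            using Y_codomain_kernel[OF \<delta>' a] Y_codomain_kernel[OF \<delta>(1) a] by simp
        qed
      qed
    qed
    then show "\<exists>!\<delta>. \<delta> \<in> Hom (Gpd Ab) (Tgt (F_fun A)) (Src m) \<and> \<delta> \<cdot>\<^bsub>Gpd Ab\<^esub> F_fun A = f \<and> m \<cdot>\<^bsub>Gpd Ab\<^esub> \<delta> = g"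
      using Gpd_HomD(11)[OF F_fun_Hom] by (simp add: X_def)
  qed
  then show ?thesis using HomD(1)[OF F_fun_Hom] by (simp add: final_functors_def)
qed

text \<open>All objects \<open>(a, b)\<close> with the same \<open>a\<close> are connected in \<open>Y\<close>, so functors from \<open>Y\<close> to discrete
  groupoids are determined by their restriction along \<open>F\<close>, which can be arbitrary.\<close>

lemma Y_disc_extend:
  assumes t: "t \<in> Hom (Gpd Ab) (disc Ab A) (disc Ab B)"
  shows "\<exists>u \<in> Hom (Gpd Ab) (Y_gpd A) (disc Ab B). u \<cdot>\<^bsub>Gpd Ab\<^esub> F_fun A = t"
proof -
  have t0: "F0 t \<in> Hom Ab A (G0 (disc Ab B))" using Gpd_HomD(1)[OF t] by simp
  have B: "comm_group B" using Ab_Hom_group[OF t0] by simp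
  have k: "ab_triv A B \<in> Hom Ab A (G1 (disc Ab B))" using ab_triv_Hom[OF A B] by simp
  have "gc (disc Ab B) \<bullet> (ab_triv A B \<bullet> a) = \<one>\<^bsub>G0 (disc Ab B)\<^esub>" if "a \<in> carrier A" for a
    using that Ab_one[OF Ab_Ide[OF B]] by simp
  from Y_extend[OF Gpd_HomD(7)[OF t] t0 k this]
  obtain u where u: "u \<in> Hom (Gpd Ab) (Y_gpd A) (disc Ab B)"
    "\<And>a. a \<in> carrier A \<Longrightarrow> F0 u \<bullet> \<langle>a, \<one>\<^bsub>A\<^esub>\<rangle> = F0 t \<bullet> a" by blast
  have "u \<cdot>\<^bsub>Gpd Ab\<^esub> F_fun A = t"
    by (rule disc_ext[OF Gpd_comp[OF F_fun_Hom u(1)] t]) (simp only: F_comp_app u(2))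
  with u(1) show ?thesis by blast
qed

lemma Y_disc_ext:
  assumes u: "u \<in> Hom (Gpd Ab) (Y_gpd A) (disc Ab B)" "u' \<in> Hom (Gpd Ab) (Y_gpd A) (disc Ab B)"
    and eq: "u \<cdot>\<^bsub>Gpd Ab\<^esub> F_fun A = u' \<cdot>\<^bsub>Gpd Ab\<^esub> F_fun A"
  shows "u = u'"
proof (rule Y_ext[OF u])
  fix a assume a: "a \<in> carrier A"
  show "F0 u \<bullet> \<langle>a, \<one>\<^bsub>A\<^esub>\<rangle> = F0 u' \<bullet> \<langle>a, \<one>\<^bsub>A\<^esub>\<rangle>"
    using F_comp_app[OF a, of u] F_comp_app[OF a, of u'] eq by simp
  have "F1 v \<bullet> \<langle>\<one>\<^bsub>A\<^esub>, \<langle>a, \<one>\<^bsub>A\<^esub>\<rangle>\<rangle> = \<one>\<^bsub>B\<^esub>" if v: "v \<in> Hom (Gpd Ab) (Y_gpd A) (disc Ab B)" for v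
    using Y_codomain_kernel[OF v a] Ab_closed[OF Gpd_HomD(2)[OF v], of "\<langle>\<one>\<^bsub>A\<^esub>, \<langle>a, \<one>\<^bsub>A\<^esub>\<rangle>\<rangle>"] a by simp
  then show "F1 u \<bullet> \<langle>\<one>\<^bsub>A\<^esub>, \<langle>a, \<one>\<^bsub>A\<^esub>\<rangle>\<rangle> = F1 u' \<bullet> \<langle>\<one>\<^bsub>A\<^esub>, \<langle>a, \<one>\<^bsub>A\<^esub>\<rangle>\<rangle>"
    using u by simp
qed

end

section \<open>Connected components\<close>

lemma pi0_quot:
  fixes X :: "('u::infinite monoid, 'u ab_arr) igpd"
  assumes X: "internal_groupoid Ab X"
  shows "is_coequalizer Ab (gd X) (gc X) (pi0_quot Ab X)"
    and "pi0_quot Ab X \<in> Hom Ab (G0 X) (pi0 Ab X)"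
proof -
  note x = refl_graphD[OF internal_groupoidD(1)[OF X]]
  show co: "is_coequalizer Ab (gd X) (gc X) (pi0_quot Ab X)"
    unfolding pi0_quot_def using Ab_has_coequalizers[OF x(1,2)] by (rule someI_ex)
  then show "pi0_quot Ab X \<in> Hom Ab (G0 X) (pi0 Ab X)"
    using HomD[OF x(1)] by (auto simp: is_coequalizer_def Hom_iff pi0_def)
qed

lemma pi0_map:
  fixes X Y :: "('u::infinite monoid, 'u ab_arr) igpd"
  assumes H: "H \<in> Hom (Gpd Ab) X Y"
  shows "pi0_map Ab H \<in> Hom Ab (pi0 Ab X) (pi0 Ab Y)"
    and "pi0_map Ab H \<cdot>\<^bsub>Ab\<^esub> pi0_quot Ab X = pi0_quot Ab Y \<cdot>\<^bsub>Ab\<^esub> F0 H"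
proof -
  note h = Gpd_HomD[OF H]
  note x = refl_graphD[OF h(8)] and y = refl_graphD[OF h(9)]
  note qx = pi0_quot[OF h(6)] and qy = pi0_quot[OF h(7)]
  have qyh: "pi0_quot Ab Y \<cdot>\<^bsub>Ab\<^esub> F0 H \<in> Hom Ab (G0 X) (pi0 Ab Y)" by (rule Ab_comp[OF h(1) qy(2)])
  have qyeq: "pi0_quot Ab Y \<cdot>\<^bsub>Ab\<^esub> gd Y = pi0_quot Ab Y \<cdot>\<^bsub>Ab\<^esub> gc Y"
    using qy(1) by (simp add: is_coequalizer_def)
  have "(pi0_quot Ab Y \<cdot>\<^bsub>Ab\<^esub> F0 H) \<cdot>\<^bsub>Ab\<^esub> gd X = (pi0_quot Ab Y \<cdot>\<^bsub>Ab\<^esub> F0 H) \<cdot>\<^bsub>Ab\<^esub> gc X"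
  proof (rule Ab_eqI[OF x(1,2) qyh qyh])
    fix z assume z: "z \<in> carrier (G1 X)"
    show "(pi0_quot Ab Y \<cdot>\<^bsub>Ab\<^esub> F0 H) \<bullet> (gd X \<bullet> z) = (pi0_quot Ab Y \<cdot>\<^bsub>Ab\<^esub> F0 H) \<bullet> (gc X \<bullet> z)"
      using Ab_eqD[OF qyeq y(1,2) Ab_closed[OF h(2) z]] h(3)[OF z] h(4)[OF z]
        Ab_closed[OF x(1) z] Ab_closed[OF x(2) z]
      by (simp add: Ab_comp_app[OF h(1)])
  qed
  from theI'[OF coequalizer_univ[OF qx(1,2) qyh this]]
  show "pi0_map Ab H \<in> Hom Ab (pi0 Ab X) (pi0 Ab Y)"
    "pi0_map Ab H \<cdot>\<^bsub>Ab\<^esub> pi0_quot Ab X = pi0_quot Ab Y \<cdot>\<^bsub>Ab\<^esub> F0 H"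
    using h(10,11) by (simp_all add: pi0_map_def)
qed

text \<open>On objects \<open>F\<close> and \<open>G\<close> are the two inclusions of \<open>A\<close> into \<open>A \<times> A\<close>, which only meet in the unit.\<close>

lemma F_G_meet:
  fixes A :: "'u::infinite monoid"
  assumes A: "comm_group A" and u: "u \<in> Hom (Gpd Ab) P (disc Ab A)" and v: "v \<in> Hom (Gpd Ab) P (disc Ab A)"
    and eq: "F_fun A \<cdot>\<^bsub>Gpd Ab\<^esub> u = G_fun A \<cdot>\<^bsub>Gpd Ab\<^esub> v" and x: "x \<in> carrier (G0 P)"
  shows "F0 u \<bullet> x = \<one>\<^bsub>A\<^esub>" and "F0 v \<bullet> x = \<one>\<^bsub>A\<^esub>"
proof -
  have "F0 u \<bullet> x \<in> carrier A" "F0 v \<bullet> x \<in> carrier A"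
    using Ab_closed[OF Gpd_HomD(1)[OF u] x] Ab_closed[OF Gpd_HomD(1)[OF v] x] by simp_all
  then have "\<langle>F0 u \<bullet> x, \<one>\<^bsub>A\<^esub>\<rangle> = \<langle>\<one>\<^bsub>A\<^esub>, F0 v \<bullet> x\<rangle>"
    using Gpd_comp_app(1)[OF u x, of "F_fun A"] Gpd_comp_app(1)[OF v x, of "G_fun A"] eq
    by (simp del: Gpd_Comp add: F_fun_app[OF A] G_fun_app[OF A])
  then show "F0 u \<bullet> x = \<one>\<^bsub>A\<^esub>" "F0 v \<bullet> x = \<one>\<^bsub>A\<^esub>" by simp_all
qed

lemma to_disc_F1:
  fixes A :: "'u::infinite monoid"
  assumes u: "u \<in> Hom (Gpd Ab) P (disc Ab A)" and y: "y \<in> carrier (G1 P)"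
  shows "F1 u \<bullet> y = F0 u \<bullet> (gd P \<bullet> y)"
  using Gpd_HomD(3)[OF u y] Ab_closed[OF Gpd_HomD(2)[OF u] y] by simp

lemma to_disc_ext:
  fixes A :: "'u::infinite monoid"
  assumes u: "u \<in> Hom (Gpd Ab) P (disc Ab A)" "v \<in> Hom (Gpd Ab) P (disc Ab A)"
    and eq: "\<And>x. x \<in> carrier (G0 P) \<Longrightarrow> F0 u \<bullet> x = F0 v \<bullet> x"
  shows "u = v"
  using refl_graphD(1)[OF Gpd_HomD(8)[OF u(1)]]
  by (intro Gpd_ext_app[OF u eq]) (simp_all add: to_disc_F1[OF u(1)] to_disc_F1[OF u(2)] Ab_closed eq)

theorem F_G_pullback_exists:
  fixes A :: "'u::infinite monoid"
  assumes A: "comm_group A"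
  shows "\<exists>p q. is_pullback (Gpd Ab) (F_fun A) (G_fun A) p q"
proof -
  let ?U = "unit_group :: 'u monoid"
  have t: "ab_triv ?U A \<in> Hom Ab ?U (G0 (disc Ab A))" by (simp add: ab_triv_Hom unit_group_comm_group A)
  define p where "p = \<lparr>Src = disc Ab ?U, Tgt = disc Ab A, F0 = ab_triv ?U A,
    F1 = ge (disc Ab A) \<cdot>\<^bsub>Ab\<^esub> ab_triv ?U A\<rparr>"
  have p: "p \<in> Hom (Gpd Ab) (disc Ab ?U) (disc Ab A)"
    unfolding p_def by (rule disc_functor[OF disc_groupoid[OF A] t])
  have p0: "F0 p \<bullet> x = \<one>\<^bsub>A\<^esub>" if "x \<in> carrier ?U" for x using that by (simp add: p_def)
  note F = F_fun_Hom[OF A] and G = G_fun_Hom[OF A]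
  interpret A: comm_group A by (rule A)
  have "is_pullback (Gpd Ab) (F_fun A) (G_fun A) p p"
  proof (rule is_pullbackI[OF F G p p])
    show "F_fun A \<cdot>\<^bsub>Gpd Ab\<^esub> p = G_fun A \<cdot>\<^bsub>Gpd Ab\<^esub> p"
      by (rule disc_ext[OF Gpd_comp[OF p F] Gpd_comp[OF p G]])
        (simp del: Gpd_Comp add: Gpd_comp_app[OF p] p0 F_fun_app[OF A] G_fun_app[OF A])
    fix Z u v assume u: "u \<in> Hom (Gpd Ab) Z (disc Ab A)" and v: "v \<in> Hom (Gpd Ab) Z (disc Ab A)"
      and eq: "F_fun A \<cdot>\<^bsub>Gpd Ab\<^esub> u = G_fun A \<cdot>\<^bsub>Gpd Ab\<^esub> v"
    note m = F_G_meet[OF A u v eq]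
    note Z = Gpd_HomD(6)[OF u]
    note z = refl_graphD[OF internal_groupoidD(1)[OF Z]]
    define w where "w = \<lparr>Src = Z, Tgt = disc Ab ?U, F0 = ab_triv (G0 Z) ?U, F1 = ab_triv (G1 Z) ?U\<rparr>"
    have w: "w \<in> Hom (Gpd Ab) Z (disc Ab ?U)"
      unfolding Gpd_Hom using Z disc_groupoid[OF unit_group_comm_group]
      by (simp add: w_def ab_triv_Hom z(6,7) unit_group_comm_group Ab_closed[OF z(1)] Ab_closed[OF z(2)]
          Ab_closed[OF z(3)] unit_group_carrier)
    have w0: "F0 w \<bullet> x \<in> carrier ?U" if "x \<in> carrier (G0 Z)" for x
      using Ab_closed[OF Gpd_HomD(1)[OF w] that] by simp
    show "\<exists>!w. w \<in> Hom (Gpd Ab) Z (disc Ab ?U) \<and> p \<cdot>\<^bsub>Gpd Ab\<^esub> w = u \<and> p \<cdot>\<^bsub>Gpd Ab\<^esub> w = v"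
    proof (rule ex1I[of _ w], intro conjI)
      show "w \<in> Hom (Gpd Ab) Z (disc Ab ?U)" by (rule w)
      show "p \<cdot>\<^bsub>Gpd Ab\<^esub> w = u"
        by (rule to_disc_ext[OF Gpd_comp[OF w p] u]) (simp del: Gpd_Comp add: Gpd_comp_app[OF w] p0 w0 m)
      show "p \<cdot>\<^bsub>Gpd Ab\<^esub> w = v"
        by (rule to_disc_ext[OF Gpd_comp[OF w p] v]) (simp del: Gpd_Comp add: Gpd_comp_app[OF w] p0 w0 m)
      fix w' assume "w' \<in> Hom (Gpd Ab) Z (disc Ab ?U) \<and> p \<cdot>\<^bsub>Gpd Ab\<^esub> w' = u \<and> p \<cdot>\<^bsub>Gpd Ab\<^esub> w' = v"
      then have w': "w' \<in> Hom (Gpd Ab) Z (disc Ab ?U)" by simp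
      show "w' = w"
      proof (rule to_disc_ext[OF w' w])
        fix x assume x: "x \<in> carrier (G0 Z)"
        have "F0 w' \<bullet> x \<in> carrier ?U" using Ab_closed[OF Gpd_HomD(1)[OF w'] x] by simp
        then show "F0 w' \<bullet> x = F0 w \<bullet> x" using w0[OF x] unfolding unit_group_carrier by simp
      qed
    qed
  qed
  then show ?thesis by blast
qed

text \<open>A pullback \<open>q\<close> of \<open>F\<close> along \<open>G\<close> is zero on objects, so \<open>\<pi>\<^sub>0(q)\<close> is zero; if it were invertible,
  \<open>\<pi>\<^sub>0(D(A)) \<cong> A\<close> would be trivial.\<close>

theorem F_G_pullback_not_iso:
  fixes A :: "'u::infinite monoid"
  assumes A: "comm_group A" and nontriv: "carrier A \<noteq> {\<one>\<^bsub>A\<^esub>}"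
    and pb: "is_pullback (Gpd Ab) (F_fun A) (G_fun A) p q"
  shows "\<not> is_iso Ab (pi0_map Ab q)"
proof
  define P where "P = Src q"
  let ?D = "disc Ab A"
  have p: "p \<in> Hom (Gpd Ab) P ?D" and q: "q \<in> Hom (Gpd Ab) P ?D"
    and eq: "F_fun A \<cdot>\<^bsub>Gpd Ab\<^esub> p = G_fun A \<cdot>\<^bsub>Gpd Ab\<^esub> q"
    using pb HomD[OF F_fun_Hom[OF A]] HomD[OF G_fun_Hom[OF A]]
    by (auto simp: is_pullback_def Hom_iff P_def)
  note q0 = F_G_meet(2)[OF A p q eq]
  define h where "h = pi0_map Ab q"
  assume iso: "is_iso Ab (pi0_map Ab q)"
  note h = pi0_map[OF q, folded h_def]
  note qP = pi0_quot[OF Gpd_HomD(6)[OF q]] and qD = pi0_quot[OF disc_groupoid[OF A]]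
  have qD': "pi0_quot Ab ?D \<in> Hom Ab A (pi0 Ab ?D)" using qD(2) by simp
  interpret A: comm_group A by (rule A)
  let ?t = "ab_triv (pi0 Ab P) (pi0 Ab ?D)"
  have t: "?t \<in> Hom Ab (pi0 Ab P) (pi0 Ab ?D)" using ab_triv_Hom Ab_Hom_group[OF h(1)] by blast
  have "h = ?t"
  proof (rule coequalizer_epi[OF category_Ab qP h(1) t], rule Ab_eqI[OF qP(2,2) h(1) t])
    fix x assume x: "x \<in> carrier (G0 P)"
    have "h \<bullet> (pi0_quot Ab P \<bullet> x) = pi0_quot Ab ?D \<bullet> (F0 q \<bullet> x)"
      by (rule Ab_eqD[OF h(2) qP(2) Gpd_HomD(1)[OF q] x])
    also have "\<dots> = ?t \<bullet> (pi0_quot Ab P \<bullet> x)"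
      using q0[OF x] Ab_one[OF qD'] Ab_closed[OF qP(2) x] by simp
    finally show "h \<bullet> (pi0_quot Ab P \<bullet> x) = ?t \<bullet> (pi0_quot Ab P \<bullet> x)" .
  qed
  obtain g where g: "g \<in> Hom Ab (pi0 Ab ?D) (pi0 Ab P)" "h \<cdot>\<^bsub>Ab\<^esub> g = Ide Ab (pi0 Ab ?D)"
    using is_isoE[OF iso[folded h_def] h(1)] by metis
  have triv: "y = \<one>\<^bsub>pi0 Ab ?D\<^esub>" if y: "y \<in> carrier (pi0 Ab ?D)" for y
    using Ab_eqD1[OF g(2,1) y] \<open>h = ?t\<close> Ab_closed[OF g(1) y] y by simp
  obtain w where w: "w \<in> Hom Ab (pi0 Ab ?D) A" "w \<cdot>\<^bsub>Ab\<^esub> pi0_quot Ab ?D = Ide Ab A"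
    using coequalizer_univ[OF qD(1) qD' Ab_Ide[OF A]] by auto
  have "a = \<one>\<^bsub>A\<^esub>" if a: "a \<in> carrier A" for a
    using Ab_eqD1[OF w(2) qD' a] triv[OF Ab_closed[OF qD' a]] Ab_one[OF w(1)] a by simp
  then have "carrier A = {\<one>\<^bsub>A\<^esub>}" by auto
  with nontriv show False by simp
qed

section \<open>Lifting along effective descent morphisms\<close>

text \<open>The images of \<open>p\<^sub>0\<close> and \<open>p\<^sub>1\<close> form a subgroupoid \<open>I\<close> of \<open>B\<close>: closure under composition comes for
  free from the formula for composites. Its inclusion \<open>n\<close> is a monomorphism through which \<open>p\<close>
  factors, so it is invertible.\<close>

theorem effective_descent_surjective:
  fixes B :: "('u::infinite monoid, 'u ab_arr) igpd"
  assumes p: "p \<in> Hom (Gpd Ab) E B" and ed: "effective_descent (Gpd Ab) p"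
    and y: "y \<in> carrier (G1 B)"
  shows "\<exists>x \<in> carrier (G1 E). F1 p \<bullet> x = y"
proof -
  note pD = Gpd_HomD[OF p]
  note b = refl_graphD[OF pD(9)] and e = refl_graphD[OF pD(8)]
  define S0 where "S0 = (\<lambda>x. F0 p \<bullet> x) ` carrier (G0 E)"
  define S1 where "S1 = (\<lambda>x. F1 p \<bullet> x) ` carrier (G1 E)"
  have S0: "subgroup S0 (G0 B)" and S1: "subgroup S1 (G1 B)"
    unfolding S0_def S1_def using image_subgroup pD(1,2) by blast+
  define N0 where "N0 = (G0 B)\<lparr>carrier := S0\<rparr>"
  define N1 where "N1 = (G1 B)\<lparr>carrier := S1\<rparr>"
  have N: "comm_group N0" "comm_group N1" "carrier N0 = S0" "carrier N1 = S1"
    unfolding N0_def N1_def using subgroup_comm_group b(6,7) S0 S1 by auto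
  have mult: "mult N0 = mult (G0 B)" "mult N1 = mult (G1 B)" by (simp_all add: N0_def N1_def)
  have sub: "x \<in> S0 \<Longrightarrow> x \<in> carrier (G0 B)" "x \<in> S1 \<Longrightarrow> x \<in> carrier (G1 B)" for x
    using subgroup.subset[OF S0] subgroup.subset[OF S1] by auto
  have pS: "z \<in> carrier (G0 E) \<Longrightarrow> F0 p \<bullet> z \<in> S0" "z \<in> carrier (G1 E) \<Longrightarrow> F1 p \<bullet> z \<in> S1" for z
    by (auto simp: S0_def S1_def)
  have Sd: "gd B \<bullet> x \<in> S0" "gc B \<bullet> x \<in> S0" if x: "x \<in> S1" for x
  proof -
    obtain z where "x = F1 p \<bullet> z" "z \<in> carrier (G1 E)" using x by (auto simp: S1_def)
    then show "gd B \<bullet> x \<in> S0" "gc B \<bullet> x \<in> S0"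
      using pD(3,4) pS(1) Ab_closed[OF e(1)] Ab_closed[OF e(2)] by simp_all
  qed
  have Se: "ge B \<bullet> x \<in> S1" if x: "x \<in> S0" for x
  proof -
    obtain z where "x = F0 p \<bullet> z" "z \<in> carrier (G0 E)" using x by (auto simp: S0_def)
    then show ?thesis using pD(5)[of z] pS(2) Ab_closed[OF e(3)] by metis
  qed
  define M where "M = \<lparr>G0 = N0, G1 = N1, gd = ab_arr N1 N0 (\<lambda>x. gd B \<bullet> x), gc = ab_arr N1 N0 (\<lambda>x. gc B \<bullet> x),
    ge = ab_arr N0 N1 (\<lambda>x. ge B \<bullet> x), gm = undefined\<rparr>"
  define I where "I = M\<lparr>gm := canonical_comp M\<rparr>"
  have I: "G0 I = N0" "G1 I = N1" "gd I = ab_arr N1 N0 (\<lambda>x. gd B \<bullet> x)" "gc I = ab_arr N1 N0 (\<lambda>x. gc B \<bullet> x)"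
    "ge I = ab_arr N0 N1 (\<lambda>x. ge B \<bullet> x)" "gm I = canonical_comp I"
    by (simp_all add: I_def M_def canonical_comp_def)
  have dI: "gd I \<in> Hom Ab N1 N0" "gc I \<in> Hom Ab N1 N0" "ge I \<in> Hom Ab N0 N1"
    unfolding I(3-5)
    by (rule ab_arr_Hom; use N Sd Se mult sub in \<open>simp add: Ab_mult[OF b(1)] Ab_mult[OF b(2)] Ab_mult[OF b(3)]\<close>)+
  have "refl_graph I"
    unfolding refl_graph_def using dI I N Sd Se b(4,5) sub by simp
  then have Igpd: "internal_groupoid Ab I" using I(6) by (simp add: internal_groupoid_Ab_iff)
  define n where "n = \<lparr>Src = I, Tgt = B, F0 = ab_incl (G0 B) S0, F1 = ab_incl (G1 B) S1\<rparr>"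
  have inc: "ab_incl (G0 B) S0 \<in> Hom Ab N0 (G0 B)" "ab_incl (G1 B) S1 \<in> Hom Ab N1 (G1 B)"
    unfolding N0_def N1_def using ab_incl_Hom b(6,7) S0 S1 by blast+
  have n: "n \<in> Hom (Gpd Ab) I B"
    unfolding Gpd_Hom using Igpd pD(7) inc I N Sd Se by (simp add: n_def)
  have n0: "F0 n \<bullet> x = x" if "x \<in> S0" for x using that by (simp add: n_def)
  have n1: "F1 n \<bullet> x = x" if "x \<in> S1" for x using that by (simp add: n_def)
  obtain k0 where k0: "k0 \<in> Hom Ab (G0 E) N0" "\<And>z. z \<in> carrier (G0 E) \<Longrightarrow> k0 \<bullet> z = F0 p \<bullet> z"
    using ab_factor_incl[OF pD(1) S0] by (auto simp: S0_def N0_def)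
  obtain k1 where k1: "k1 \<in> Hom Ab (G1 E) N1" "\<And>z. z \<in> carrier (G1 E) \<Longrightarrow> k1 \<bullet> z = F1 p \<bullet> z"
    using ab_factor_incl[OF pD(2) S1] by (auto simp: S1_def N1_def)
  define k where "k = \<lparr>Src = E, Tgt = I, F0 = k0, F1 = k1\<rparr>"
  have k: "k \<in> Hom (Gpd Ab) E I"
    unfolding Gpd_Hom using Igpd pD(6) k0 k1 I N pD(3-5) pS
    by (simp add: k_def Ab_closed[OF e(1)] Ab_closed[OF e(2)] Ab_closed[OF e(3)])
  have nk: "n \<cdot>\<^bsub>Gpd Ab\<^esub> k = p"
    by (rule Gpd_ext_app[OF Gpd_comp[OF k n] p])
      (simp_all del: Gpd_Comp add: Gpd_comp_app[OF k], simp_all add: k_def k0 k1 pS n0 n1)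
  have mono: "u = v" if u: "u \<in> Hom (Gpd Ab) Z I" and v: "v \<in> Hom (Gpd Ab) Z I"
    and eq: "n \<cdot>\<^bsub>Gpd Ab\<^esub> u = n \<cdot>\<^bsub>Gpd Ab\<^esub> v" for Z u v
  proof (rule Gpd_ext_app[OF u v])
    fix x assume x: "x \<in> carrier (G0 Z)"
    show "F0 u \<bullet> x = F0 v \<bullet> x"
      using Gpd_comp_app(1)[OF u x, of n] Gpd_comp_app(1)[OF v x, of n] eq
        Ab_closed[OF Gpd_HomD(1)[OF u] x] Ab_closed[OF Gpd_HomD(1)[OF v] x] by (simp add: n0 I N)
  next
    fix x assume x: "x \<in> carrier (G1 Z)"
    show "F1 u \<bullet> x = F1 v \<bullet> x"
      using Gpd_comp_app(2)[OF u x, of n] Gpd_comp_app(2)[OF v x, of n] eq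
        Ab_closed[OF Gpd_HomD(2)[OF u] x] Ab_closed[OF Gpd_HomD(2)[OF v] x] by (simp add: n1 I N)
  qed
  have "is_iso (Gpd Ab) n"
    by (rule effective_descent_extremal[OF category_Gpd_Ab ed p n mono k nk])
  then obtain g where g: "g \<in> Hom (Gpd Ab) B I" "n \<cdot>\<^bsub>Gpd Ab\<^esub> g = Ide (Gpd Ab) B"
    using is_isoE[OF _ n] by metis
  have "F1 g \<bullet> y \<in> S1" using Ab_closed[OF Gpd_HomD(2)[OF g(1)] y] by (simp add: I N)
  moreover have "F1 n \<bullet> (F1 g \<bullet> y) = y" using Gpd_comp_app(2)[OF g(1) y, of n] g(2) y by simp
  ultimately have "y \<in> S1" by (simp add: n1)
  then show ?thesis by (auto simp: S1_def)
qed

definition projective :: "'u monoid \<Rightarrow> bool" where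
  "projective Z \<longleftrightarrow> comm_group Z \<and>
     (\<forall>G H p h. p \<in> Hom Ab G H \<and> h \<in> Hom Ab Z H \<and> (\<forall>y \<in> carrier H. \<exists>x \<in> carrier G. p \<bullet> x = y) \<longrightarrow>
       (\<exists>k \<in> Hom Ab Z G. \<forall>z \<in> carrier Z. p \<bullet> (k \<bullet> z) = h \<bullet> z))"

text \<open>The integers, carried by the range of an injection into the infinite type \<open>'u\<close>, are projective:
  to lift a homomorphism out of them it is enough to lift its value at \<open>1\<close>.\<close>

lemma projective_exists:
  "\<exists>Z :: 'u::infinite monoid. projective Z \<and> carrier Z \<noteq> {\<one>\<^bsub>Z\<^esub>}"
proof -
  obtain s :: "nat \<Rightarrow> 'u" where "inj s"
    using infinite_countable_subset[OF infinite_UNIV] by auto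
  then have "inj (s \<circ> to_nat :: int \<Rightarrow> 'u)" by (simp add: inj_compose)
  then obtain \<phi> :: "int \<Rightarrow> 'u" where \<phi>: "inj \<phi>" by blast
  define Z where "Z = image_group \<phi> integer_group"
  have Zc: "carrier Z = range \<phi>" by (simp add: Z_def image_group_carrier)
  have Zm: "\<phi> a \<otimes>\<^bsub>Z\<^esub> \<phi> b = \<phi> (a + b)" for a b
    using \<phi> by (simp add: Z_def image_group_def inv_into_f_f)
  have Z1: "\<one>\<^bsub>Z\<^esub> = \<phi> 0" by (simp add: Z_def image_group_one)
  have Z: "comm_group Z"
  proof (rule comm_groupI)
    fix x assume "x \<in> carrier Z"
    then obtain a where "x = \<phi> a" by (auto simp: Zc)
    then show "\<exists>y \<in> carrier Z. y \<otimes>\<^bsub>Z\<^esub> x = \<one>\<^bsub>Z\<^esub>"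
      by (intro bexI[of _ "\<phi> (- a)"]) (simp_all add: Zc Zm Z1)
  qed (auto simp: Zc Zm Z1 algebra_simps)
  have "\<exists>k \<in> Hom Ab Z G. \<forall>z \<in> carrier Z. p \<bullet> (k \<bullet> z) = h \<bullet> z"
    if p: "p \<in> Hom Ab G H" and h: "h \<in> Hom Ab Z H" and surj: "\<forall>y \<in> carrier H. \<exists>x \<in> carrier G. p \<bullet> x = y"
    for G H p h
  proof -
    interpret G: comm_group G using Ab_Hom_group[OF p] by simp
    interpret H: comm_group H using Ab_Hom_group[OF p] by simp
    interpret p: group_hom G H "\<lambda>x. p \<bullet> x" by (rule Ab_group_hom[OF p])
    obtain x where x: "x \<in> carrier G" "p \<bullet> x = h \<bullet> \<phi> 1"
      using surj Ab_closed[OF h, of "\<phi> 1"] by (auto simp: Zc)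
    define k where "k = ab_arr Z G (\<lambda>z. x [^]\<^bsub>G\<^esub> (inv_into UNIV \<phi> z))"
    have k\<phi>: "k \<bullet> \<phi> n = x [^]\<^bsub>G\<^esub> n" for n by (simp add: k_def Zc \<phi>)
    have k: "k \<in> Hom Ab Z G"
      unfolding k_def by (rule ab_arr_Hom[OF Z G.comm_group_axioms]) (auto simp: Zc Zm \<phi> x G.int_pow_mult)
    have h\<phi>: "h \<bullet> \<phi> n = (h \<bullet> \<phi> 1) [^]\<^bsub>H\<^esub> n" for n
    proof -
      have "(\<lambda>n. h \<bullet> \<phi> n) \<in> hom integer_group H"
        by (rule homI) (auto simp: Ab_closed[OF h] Zc Ab_mult[OF h] simp flip: Zm)
      then interpret hZ: group_hom integer_group H "\<lambda>n. h \<bullet> \<phi> n"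
        by (simp add: group_hom_def group_hom_axioms_def H.group_axioms)
      show ?thesis using hZ.hom_int_pow[of 1 n] by simp
    qed
    have "p \<bullet> (k \<bullet> \<phi> n) = h \<bullet> \<phi> n" for n
      using p.hom_int_pow[OF x(1), of n] k\<phi> h\<phi> x(2) by metis
    then show ?thesis using k by (intro bexI[of _ k]) (auto simp: Zc)
  qed
  then have "projective Z" unfolding projective_def using Z by blast
  moreover have "carrier Z \<noteq> {\<one>\<^bsub>Z\<^esub>}"
    using inj_eq[OF \<phi>, of 1 0] by (auto simp: Zc Z1)
  ultimately show ?thesis by blast
qed

text \<open>Both components of a functor out of \<open>Y\<close> lift along the surjections \<open>p\<^sub>0\<close> and \<open>p\<^sub>1\<close>. A lift \<open>l\<close> of the second
  one need not take values in the kernel of the codomain map; subtracting the identity of the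
  codomain corrects this without changing the image under \<open>p\<^sub>1\<close>.\<close>

lemma Y_projective:
  fixes Z :: "'u::infinite monoid"
  assumes Z: "projective Z" and p: "p \<in> Hom (Gpd Ab) E B"
    and surj: "\<And>y. y \<in> carrier (G1 B) \<Longrightarrow> \<exists>x \<in> carrier (G1 E). F1 p \<bullet> x = y"
    and g: "g \<in> Hom (Gpd Ab) (Y_gpd Z) B"
  shows "\<exists>h \<in> Hom (Gpd Ab) (Y_gpd Z) E. p \<cdot>\<^bsub>Gpd Ab\<^esub> h = g"
proof -
  have Zc: "comm_group Z" using Z by (simp add: projective_def)
  note Y = Y_simps[OF Zc]
  note pD = Gpd_HomD[OF p] and gD = Gpd_HomD[OF g]
  note e = refl_graphD[OF pD(8)] and b = refl_graphD[OF pD(9)]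
  interpret E0: comm_group "G0 E" by (rule e)
  interpret E1: comm_group "G1 E" by (rule e)
  interpret B1: comm_group "G1 B" by (rule b)
  have surj0: "\<exists>x \<in> carrier (G0 E). F0 p \<bullet> x = y" if y: "y \<in> carrier (G0 B)" for y
  proof -
    obtain x where x: "x \<in> carrier (G1 E)" "F1 p \<bullet> x = ge B \<bullet> y" using surj Ab_closed[OF b(3) y] by blast
    then have "F0 p \<bullet> (gd E \<bullet> x) = y" using pD(3)[OF x(1)] b(4)[OF y] by simp
    then show ?thesis using Ab_closed[OF e(1) x(1)] by blast
  qed
  have lift: "\<exists>k \<in> Hom Ab Z G. \<forall>z \<in> carrier Z. q \<bullet> (k \<bullet> z) = h \<bullet> z"
    if "q \<in> Hom Ab G H" "h \<in> Hom Ab Z H" "\<And>y. y \<in> carrier H \<Longrightarrow> \<exists>x \<in> carrier G. q \<bullet> x = y" for G H q h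
    using Z that unfolding projective_def by blast
  note gF = Gpd_comp[OF F_fun_Hom[OF Zc] g]
  have "F0 (g \<cdot>\<^bsub>Gpd Ab\<^esub> F_fun Z) \<in> Hom Ab Z (G0 B)" using Gpd_HomD(1)[OF gF] by simp
  from lift[OF pD(1) this surj0] obtain x where x: "x \<in> Hom Ab Z (G0 E)"
    "\<And>a. a \<in> carrier Z \<Longrightarrow> F0 p \<bullet> (x \<bullet> a) = F0 g \<bullet> \<langle>a, \<one>\<^bsub>Z\<^esub>\<rangle>"
    using F_comp_app[OF Zc, of _ g] by auto
  have j: "Y_arrows Z \<in> Hom Ab Z (G1 (Y_gpd Z))" using Y_arrows_Hom[OF Zc] Y by simp
  from lift[OF pD(2) Ab_comp[OF j gD(2)] surj] obtain l where l: "l \<in> Hom Ab Z (G1 E)"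
    "\<And>a. a \<in> carrier Z \<Longrightarrow> F1 p \<bullet> (l \<bullet> a) = F1 g \<bullet> \<langle>\<one>\<^bsub>Z\<^esub>, \<langle>a, \<one>\<^bsub>Z\<^esub>\<rangle>\<rangle>"
    using Ab_comp_app[OF j] Y_arrows_app[OF Zc] by auto
  define k where "k = ab_arr Z (G1 E) (\<lambda>a. l \<bullet> a \<otimes>\<^bsub>G1 E\<^esub> inv\<^bsub>G1 E\<^esub> (ge E \<bullet> (gc E \<bullet> (l \<bullet> a))))"
  note cl = Ab_closed[OF l(1)] Ab_closed[OF e(2)] Ab_closed[OF e(3)]
  have k: "k \<in> Hom Ab Z (G1 E)"
    unfolding k_def
    by (rule ab_arr_Hom[OF Zc e(7)])
      (auto simp: cl Ab_mult[OF l(1)] Ab_mult[OF e(2)] Ab_mult[OF e(3)] E1.inv_mult E1.m_ac)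
  have ck: "gc E \<bullet> (k \<bullet> a) = \<one>\<^bsub>G0 E\<^esub>" if "a \<in> carrier Z" for a
    using that by (simp add: k_def cl Ab_mult[OF e(2)] Ab_inv[OF e(2)] e(5))
  have pk: "F1 p \<bullet> (k \<bullet> a) = F1 g \<bullet> \<langle>\<one>\<^bsub>Z\<^esub>, \<langle>a, \<one>\<^bsub>Z\<^esub>\<rangle>\<rangle>" if a: "a \<in> carrier Z" for a
  proof -
    have "F1 p \<bullet> (ge E \<bullet> (gc E \<bullet> (l \<bullet> a))) = ge B \<bullet> (gc B \<bullet> (F1 p \<bullet> (l \<bullet> a)))"
      using a by (simp add: cl pD(4,5))
    also have "\<dots> = \<one>\<^bsub>G1 B\<^esub>"
      using Y_codomain_kernel[OF Zc g a] l(2)[OF a] Ab_one[OF b(3)] by simp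
    finally show ?thesis
      using a Ab_closed[OF pD(2) Ab_closed[OF l(1) a]] l(2)[OF a]
      by (simp add: k_def cl Ab_mult[OF pD(2)] Ab_inv[OF pD(2)])
  qed
  obtain h where h: "h \<in> Hom (Gpd Ab) (Y_gpd Z) E"
    "\<And>a. a \<in> carrier Z \<Longrightarrow> F0 h \<bullet> \<langle>a, \<one>\<^bsub>Z\<^esub>\<rangle> = x \<bullet> a"
    "\<And>a. a \<in> carrier Z \<Longrightarrow> F1 h \<bullet> \<langle>\<one>\<^bsub>Z\<^esub>, \<langle>a, \<one>\<^bsub>Z\<^esub>\<rangle>\<rangle> = k \<bullet> a"
    using Y_extend[OF Zc pD(6) x(1) k ck] by blast
  interpret Z: comm_group Z by (rule Zc)
  have "p \<cdot>\<^bsub>Gpd Ab\<^esub> h = g"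
    by (rule Y_ext[OF Zc Gpd_comp[OF h(1) p] g])
      (simp_all del: Gpd_Comp add: Gpd_comp_app[OF h(1)] Y h x(2) pk)
  with h(1) show ?thesis by blast
qed

section \<open>Orthogonality to coverings\<close>

lemma orthogonalI:
  assumes e: "e \<in> Hom C a b" and m: "m \<in> Hom C x y"
    and ex: "\<And>f g. f \<in> Hom C a x \<Longrightarrow> g \<in> Hom C b y \<Longrightarrow> g \<cdot>\<^bsub>C\<^esub> e = m \<cdot>\<^bsub>C\<^esub> f \<Longrightarrow>
      \<exists>\<delta> \<in> Hom C b x. \<delta> \<cdot>\<^bsub>C\<^esub> e = f \<and> m \<cdot>\<^bsub>C\<^esub> \<delta> = g"
    and uniq: "\<And>\<delta> \<delta>'. \<delta> \<in> Hom C b x \<Longrightarrow> \<delta>' \<in> Hom C b x \<Longrightarrow> \<delta> \<cdot>\<^bsub>C\<^esub> e = \<delta>' \<cdot>\<^bsub>C\<^esub> e \<Longrightarrow>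
      m \<cdot>\<^bsub>C\<^esub> \<delta> = m \<cdot>\<^bsub>C\<^esub> \<delta>' \<Longrightarrow> \<delta> = \<delta>'"
  shows "orthogonal C e m"
  unfolding orthogonal_def HomD(2,3)[OF e] HomD(2,3)[OF m]
proof (intro allI impI)
  fix f g assume "f \<in> Hom C a x \<and> g \<in> Hom C b y \<and> g \<cdot>\<^bsub>C\<^esub> e = m \<cdot>\<^bsub>C\<^esub> f"
  then obtain \<delta> where "\<delta> \<in> Hom C b x \<and> \<delta> \<cdot>\<^bsub>C\<^esub> e = f \<and> m \<cdot>\<^bsub>C\<^esub> \<delta> = g" using ex by blast
  then show "\<exists>!\<delta>. \<delta> \<in> Hom C b x \<and> \<delta> \<cdot>\<^bsub>C\<^esub> e = f \<and> m \<cdot>\<^bsub>C\<^esub> \<delta> = g"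
    using uniq by (intro ex1I[of _ \<delta>]) auto
qed

lemma orthogonalE:
  assumes "orthogonal C e m" and e: "e \<in> Hom C a b" and m: "m \<in> Hom C x y"
    and "f \<in> Hom C a x" "g \<in> Hom C b y" "g \<cdot>\<^bsub>C\<^esub> e = m \<cdot>\<^bsub>C\<^esub> f"
  shows "\<exists>!\<delta>. \<delta> \<in> Hom C b x \<and> \<delta> \<cdot>\<^bsub>C\<^esub> e = f \<and> m \<cdot>\<^bsub>C\<^esub> \<delta> = g"
  using assms unfolding orthogonal_def HomD(2,3)[OF e] HomD(2,3)[OF m] by blast

text \<open>A morphism in \<open>\<M>\<close> is a pullback of a functor between discrete groupoids, and \<open>F\<close> is orthogonal to
  every such functor since the maps \<open>Y \<rightarrow> D(B)\<close> correspond to the maps \<open>D(A) \<rightarrow> D(B)\<close>.\<close>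

lemma F_orthogonal_M:
  fixes A :: "'u::infinite monoid"
  assumes A: "comm_group A" and m: "m \<in> class_M Ab"
  shows "orthogonal (Gpd Ab) (F_fun A) m"
proof -
  note assoc = category_assoc[OF category_Gpd_Ab]
  note F = F_fun_Hom[OF A]
  define s t r where "s = pi0_unit Ab (Tgt m)" and "t = disc_map Ab (pi0_map Ab m)" and "r = pi0_unit Ab (Src m)"
  define P E where "P = Src m" and "E = Tgt m"
  define B C where "B = Dom Ab (pi0_map Ab m)" and "C = Cod Ab (pi0_map Ab m)"
  have pb: "is_pullback (Gpd Ab) s t m r" and mArr: "m \<in> Arr (Gpd Ab)"
    using m by (auto simp: class_M_def s_def t_def r_def)
  have mH: "m \<in> Hom (Gpd Ab) P E" using Gpd_Arr_Hom[OF mArr] by (simp add: P_def E_def)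
  have t: "t \<in> Hom (Gpd Ab) (disc Ab B) (disc Ab C)"
    using pb by (auto simp: is_pullback_def Hom_iff t_def disc_map_def B_def C_def)
  have s: "s \<in> Hom (Gpd Ab) E (disc Ab C)" and r: "r \<in> Hom (Gpd Ab) P (disc Ab B)"
    and sq: "s \<cdot>\<^bsub>Gpd Ab\<^esub> m = t \<cdot>\<^bsub>Gpd Ab\<^esub> r"
    using pb HomD[OF t] by (auto simp: is_pullback_def Hom_iff P_def E_def)
  show ?thesis
  proof (rule orthogonalI[OF F mH])
    fix f g assume f: "f \<in> Hom (Gpd Ab) (disc Ab A) P" and g: "g \<in> Hom (Gpd Ab) (Y_gpd A) E"
      and eq: "g \<cdot>\<^bsub>Gpd Ab\<^esub> F_fun A = m \<cdot>\<^bsub>Gpd Ab\<^esub> f"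
    obtain u where u: "u \<in> Hom (Gpd Ab) (Y_gpd A) (disc Ab B)" "u \<cdot>\<^bsub>Gpd Ab\<^esub> F_fun A = r \<cdot>\<^bsub>Gpd Ab\<^esub> f"
      using Y_disc_extend[OF A Gpd_comp[OF f r]] by blast
    have "s \<cdot>\<^bsub>Gpd Ab\<^esub> g = t \<cdot>\<^bsub>Gpd Ab\<^esub> u"
      by (rule Y_disc_ext[OF A Gpd_comp[OF g s] Gpd_comp[OF u(1) t]])
        (metis assoc[OF F g s] assoc[OF F u(1) t] assoc[OF f mH s] assoc[OF f r t] eq u(2) sq)
    then obtain \<delta> where \<delta>: "\<delta> \<in> Hom (Gpd Ab) (Y_gpd A) P" "m \<cdot>\<^bsub>Gpd Ab\<^esub> \<delta> = g" "r \<cdot>\<^bsub>Gpd Ab\<^esub> \<delta> = u"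
      using pullback_lift[OF pb, of g "Y_gpd A" u] g u(1) HomD[OF s] HomD[OF t] HomD[OF mH] by auto
    have "\<delta> \<cdot>\<^bsub>Gpd Ab\<^esub> F_fun A = f"
    proof (rule pullback_ext[OF category_Gpd_Ab pb])
      show "\<delta> \<cdot>\<^bsub>Gpd Ab\<^esub> F_fun A \<in> Hom (Gpd Ab) (disc Ab A) (Dom (Gpd Ab) m)" "f \<in> Hom (Gpd Ab) (disc Ab A) (Dom (Gpd Ab) m)"
        using Gpd_comp[OF F \<delta>(1)] f by (simp_all add: P_def)
      show "m \<cdot>\<^bsub>Gpd Ab\<^esub> (\<delta> \<cdot>\<^bsub>Gpd Ab\<^esub> F_fun A) = m \<cdot>\<^bsub>Gpd Ab\<^esub> f"
        unfolding assoc[OF F \<delta>(1) mH] \<delta>(2) by (rule eq)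
      show "r \<cdot>\<^bsub>Gpd Ab\<^esub> (\<delta> \<cdot>\<^bsub>Gpd Ab\<^esub> F_fun A) = r \<cdot>\<^bsub>Gpd Ab\<^esub> f"
        unfolding assoc[OF F \<delta>(1) r] \<delta>(3) by (rule u(2))
    qed
    with \<delta> show "\<exists>\<delta> \<in> Hom (Gpd Ab) (Y_gpd A) P. \<delta> \<cdot>\<^bsub>Gpd Ab\<^esub> F_fun A = f \<and> m \<cdot>\<^bsub>Gpd Ab\<^esub> \<delta> = g" by blast
  next
    fix \<delta> \<delta>' assume d: "\<delta> \<in> Hom (Gpd Ab) (Y_gpd A) P" and d': "\<delta>' \<in> Hom (Gpd Ab) (Y_gpd A) P"
      and eq: "\<delta> \<cdot>\<^bsub>Gpd Ab\<^esub> F_fun A = \<delta>' \<cdot>\<^bsub>Gpd Ab\<^esub> F_fun A" "m \<cdot>\<^bsub>Gpd Ab\<^esub> \<delta> = m \<cdot>\<^bsub>Gpd Ab\<^esub> \<delta>'"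
    have "r \<cdot>\<^bsub>Gpd Ab\<^esub> \<delta> = r \<cdot>\<^bsub>Gpd Ab\<^esub> \<delta>'"
      by (rule Y_disc_ext[OF A Gpd_comp[OF d r] Gpd_comp[OF d' r]])
        (simp only: assoc[OF F d r, symmetric] assoc[OF F d' r, symmetric] eq(1))
    then show "\<delta> = \<delta>'"
      using d d' by (intro pullback_ext[OF category_Gpd_Ab pb _ _ eq(2)]) (simp_all add: P_def)
  qed
qed

text \<open>Since \<open>Y\<close> on a projective group lifts along effective descent morphisms, orthogonality
  of \<open>F\<close> to the pullback of \<open>m\<close> along such a morphism gives orthogonality to \<open>m\<close>.\<close>

theorem F_orthogonal_M_star:
  fixes Z :: "'u::infinite monoid"
  assumes Z: "projective Z" and m: "m \<in> class_M_star Ab"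
  shows "orthogonal (Gpd Ab) (F_fun Z) m"
proof -
  note assoc = category_assoc[OF category_Gpd_Ab]
  have Zc: "comm_group Z" using Z by (simp add: projective_def)
  note F = F_fun_Hom[OF Zc]
  obtain p r q where ed: "effective_descent (Gpd Ab) p" and pb: "is_pullback (Gpd Ab) m p r q" and qM: "q \<in> class_M Ab"
    using m by (auto simp: class_M_star_def)
  define X B E P where "X = Src m" and "B = Tgt m" and "E = Src p" and "P = Src r"
  have mH: "m \<in> Hom (Gpd Ab) X B" and p: "p \<in> Hom (Gpd Ab) E B" and r: "r \<in> Hom (Gpd Ab) P X"
    and q: "q \<in> Hom (Gpd Ab) P E" and sq: "m \<cdot>\<^bsub>Gpd Ab\<^esub> r = p \<cdot>\<^bsub>Gpd Ab\<^esub> q"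
    using pb by (auto simp: is_pullback_def Hom_iff X_def B_def E_def P_def)
  have lift: "\<exists>h \<in> Hom (Gpd Ab) (Y_gpd Z) E. p \<cdot>\<^bsub>Gpd Ab\<^esub> h = g" if "g \<in> Hom (Gpd Ab) (Y_gpd Z) B" for g
    by (rule Y_projective[OF Z p effective_descent_surjective[OF p ed] that])
  have plift: "\<exists>w \<in> Hom (Gpd Ab) V P. r \<cdot>\<^bsub>Gpd Ab\<^esub> w = u \<and> q \<cdot>\<^bsub>Gpd Ab\<^esub> w = v"
    if "u \<in> Hom (Gpd Ab) V X" "v \<in> Hom (Gpd Ab) V E" "m \<cdot>\<^bsub>Gpd Ab\<^esub> u = p \<cdot>\<^bsub>Gpd Ab\<^esub> v" for u v V
    using pullback_lift[OF pb, of u V v] that HomD[OF mH] HomD[OF p] HomD[OF r] by auto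
  note qorth = orthogonalE[OF F_orthogonal_M[OF Zc qM] F q]
  show ?thesis
  proof (rule orthogonalI[OF F mH])
    fix f g assume f: "f \<in> Hom (Gpd Ab) (disc Ab Z) X" and g: "g \<in> Hom (Gpd Ab) (Y_gpd Z) B"
      and eq: "g \<cdot>\<^bsub>Gpd Ab\<^esub> F_fun Z = m \<cdot>\<^bsub>Gpd Ab\<^esub> f"
    obtain g' where g': "g' \<in> Hom (Gpd Ab) (Y_gpd Z) E" "p \<cdot>\<^bsub>Gpd Ab\<^esub> g' = g" using lift[OF g] by blast
    have "m \<cdot>\<^bsub>Gpd Ab\<^esub> f = p \<cdot>\<^bsub>Gpd Ab\<^esub> (g' \<cdot>\<^bsub>Gpd Ab\<^esub> F_fun Z)"
      unfolding assoc[OF F g'(1) p] g'(2) by (rule eq[symmetric])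
    then obtain f' where f': "f' \<in> Hom (Gpd Ab) (disc Ab Z) P" "r \<cdot>\<^bsub>Gpd Ab\<^esub> f' = f"
      "q \<cdot>\<^bsub>Gpd Ab\<^esub> f' = g' \<cdot>\<^bsub>Gpd Ab\<^esub> F_fun Z" using plift[OF f Gpd_comp[OF F g'(1)]] by blast
    obtain \<delta> where \<delta>: "\<delta> \<in> Hom (Gpd Ab) (Y_gpd Z) P" "\<delta> \<cdot>\<^bsub>Gpd Ab\<^esub> F_fun Z = f'" "q \<cdot>\<^bsub>Gpd Ab\<^esub> \<delta> = g'"
      using qorth[OF f'(1) g'(1) f'(3)[symmetric]] by blast
    have "(r \<cdot>\<^bsub>Gpd Ab\<^esub> \<delta>) \<cdot>\<^bsub>Gpd Ab\<^esub> F_fun Z = f"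
      using assoc[OF F \<delta>(1) r] \<delta>(2) f'(2) by simp
    moreover have "m \<cdot>\<^bsub>Gpd Ab\<^esub> (r \<cdot>\<^bsub>Gpd Ab\<^esub> \<delta>) = g"
      using assoc[OF \<delta>(1) r mH] assoc[OF \<delta>(1) q p] sq \<delta>(3) g'(2) by simp
    ultimately show "\<exists>\<delta> \<in> Hom (Gpd Ab) (Y_gpd Z) X. \<delta> \<cdot>\<^bsub>Gpd Ab\<^esub> F_fun Z = f \<and> m \<cdot>\<^bsub>Gpd Ab\<^esub> \<delta> = g"
      using Gpd_comp[OF \<delta>(1) r] by blast
  next
    fix \<delta> \<delta>' assume d: "\<delta> \<in> Hom (Gpd Ab) (Y_gpd Z) X" and d': "\<delta>' \<in> Hom (Gpd Ab) (Y_gpd Z) X"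
      and eq: "\<delta> \<cdot>\<^bsub>Gpd Ab\<^esub> F_fun Z = \<delta>' \<cdot>\<^bsub>Gpd Ab\<^esub> F_fun Z" "m \<cdot>\<^bsub>Gpd Ab\<^esub> \<delta> = m \<cdot>\<^bsub>Gpd Ab\<^esub> \<delta>'"
    obtain g' where g': "g' \<in> Hom (Gpd Ab) (Y_gpd Z) E" "p \<cdot>\<^bsub>Gpd Ab\<^esub> g' = m \<cdot>\<^bsub>Gpd Ab\<^esub> \<delta>"
      using lift[OF Gpd_comp[OF d mH]] by blast
    obtain w where w: "w \<in> Hom (Gpd Ab) (Y_gpd Z) P" "r \<cdot>\<^bsub>Gpd Ab\<^esub> w = \<delta>" "q \<cdot>\<^bsub>Gpd Ab\<^esub> w = g'"
      using plift[OF d g'(1) g'(2)[symmetric]] by blast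
    obtain w' where w': "w' \<in> Hom (Gpd Ab) (Y_gpd Z) P" "r \<cdot>\<^bsub>Gpd Ab\<^esub> w' = \<delta>'" "q \<cdot>\<^bsub>Gpd Ab\<^esub> w' = g'"
      using plift[OF d' g'(1)] g'(2) eq(2) by auto
    have wF: "w \<cdot>\<^bsub>Gpd Ab\<^esub> F_fun Z = w' \<cdot>\<^bsub>Gpd Ab\<^esub> F_fun Z"
    proof (rule pullback_ext[OF category_Gpd_Ab pb])
      show "w \<cdot>\<^bsub>Gpd Ab\<^esub> F_fun Z \<in> Hom (Gpd Ab) (disc Ab Z) (Dom (Gpd Ab) r)"
        "w' \<cdot>\<^bsub>Gpd Ab\<^esub> F_fun Z \<in> Hom (Gpd Ab) (disc Ab Z) (Dom (Gpd Ab) r)"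
        using Gpd_comp[OF F w(1)] Gpd_comp[OF F w'(1)] by (simp_all add: P_def)
      show "r \<cdot>\<^bsub>Gpd Ab\<^esub> (w \<cdot>\<^bsub>Gpd Ab\<^esub> F_fun Z) = r \<cdot>\<^bsub>Gpd Ab\<^esub> (w' \<cdot>\<^bsub>Gpd Ab\<^esub> F_fun Z)"
        unfolding assoc[OF F w(1) r] assoc[OF F w'(1) r] w(2) w'(2) by (rule eq(1))
      show "q \<cdot>\<^bsub>Gpd Ab\<^esub> (w \<cdot>\<^bsub>Gpd Ab\<^esub> F_fun Z) = q \<cdot>\<^bsub>Gpd Ab\<^esub> (w' \<cdot>\<^bsub>Gpd Ab\<^esub> F_fun Z)"
        unfolding assoc[OF F w(1) q] assoc[OF F w'(1) q] w(3) w'(3) by (rule refl)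
    qed
    have "g' \<cdot>\<^bsub>Gpd Ab\<^esub> F_fun Z = q \<cdot>\<^bsub>Gpd Ab\<^esub> (w \<cdot>\<^bsub>Gpd Ab\<^esub> F_fun Z)"
      using assoc[OF F w(1) q] w(3) by simp
    from qorth[OF Gpd_comp[OF F w(1)] g'(1) this] have "w = w'"
      using w w' wF by metis
    then show "\<delta> = \<delta>'" using w(2) w'(2) by simp
  qed
qed

theorem mainTheorem3:
  fixes A :: "'u::infinite monoid"
  assumes "comm_group A" and "carrier A \<noteq> {\<one>\<^bsub>A\<^esub>}"
  shows "barr_exact (Ab :: ('u monoid, 'u ab_arr) cat) \<and>
    equivalence_relation Ab (Y_dom A) (Y_cod A) \<and>
    F_fun A \<in> Hom (Gpd Ab) (disc Ab A) (Y_gpd A) \<and>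
    G_fun A \<in> Hom (Gpd Ab) (disc Ab A) (Y_gpd A) \<and>
    F_fun A \<in> final_functors Ab \<and>
    (\<exists>p q. is_pullback (Gpd Ab) (F_fun A) (G_fun A) p q) \<and>
    (\<forall>p q. is_pullback (Gpd Ab) (F_fun A) (G_fun A) p q \<longrightarrow> \<not> is_iso Ab (pi0_map Ab q)) \<and>
    \<not> final_functors (Ab :: ('u monoid, 'u ab_arr) cat) \<subseteq> class_E' Ab \<and>
    \<not> factorization_system (Gpd (Ab :: ('u monoid, 'u ab_arr) cat)) (class_E' Ab) (class_M_star Ab) \<and>
    \<not> (\<forall>C :: ('u monoid, 'u ab_arr) cat. barr_exact C \<longrightarrow> has_monotone_light_factorization C)"
proof -
  have not_E': "F_fun B \<notin> class_E' Ab" if B: "comm_group B" "carrier B \<noteq> {\<one>\<^bsub>B\<^esub>}" for B :: "'u monoid"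
  proof
    assume F: "F_fun B \<in> class_E' Ab"
    obtain p q where pq: "is_pullback (Gpd Ab) (F_fun B) (G_fun B) p q"
      using F_G_pullback_exists[OF B(1)] by blast
    then have "is_iso Ab (pi0_map Ab q)" using F by (auto simp: class_E'_def class_E_def)
    then show False using F_G_pullback_not_iso[OF B pq] by blast
  qed
  have not_fs: "\<not> factorization_system (Gpd (Ab :: ('u monoid, 'u ab_arr) cat)) (class_E' Ab) (class_M_star Ab)"
  proof
    assume fs: "factorization_system (Gpd (Ab :: ('u monoid, 'u ab_arr) cat)) (class_E' Ab) (class_M_star Ab)"
    obtain Z :: "'u monoid" where Z: "projective Z" "carrier Z \<noteq> {\<one>\<^bsub>Z\<^esub>}" using projective_exists by blast
    then have Zc: "comm_group Z" by (simp add: projective_def)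
    have "F_fun Z \<in> {e \<in> Arr (Gpd Ab). \<forall>m \<in> class_M_star Ab. orthogonal (Gpd Ab) e m}"
      using F_orthogonal_M_star[OF Z(1)] HomD(1)[OF F_fun_Hom[OF Zc]] by blast
    also have "\<dots> = class_E' Ab"
      using fs unfolding factorization_system_def by (elim conjE) (erule sym)
    finally have "F_fun Z \<in> class_E' Ab" .
    then show False using not_E'[OF Zc Z(2)] by contradiction
  qed
  show ?thesis
  proof (intro conjI allI impI)
    show "\<not> final_functors Ab \<subseteq> class_E' (Ab :: ('u monoid, 'u ab_arr) cat)"
      using F_final[OF assms(1)] not_E'[OF assms] by blast
    show "\<not> (\<forall>C :: ('u monoid, 'u ab_arr) cat. barr_exact C \<longrightarrow> has_monotone_light_factorization C)"
      using barr_exact_Ab not_fs unfolding has_monotone_light_factorization_def by blast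
  qed (fact barr_exact_Ab Y_equivalence_relation[OF assms(1)] F_fun_Hom[OF assms(1)] G_fun_Hom[OF assms(1)]
      F_final[OF assms(1)] F_G_pullback_exists[OF assms(1)] F_G_pullback_not_iso[OF assms] not_fs)+
qed

end
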